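(* Consider the two-dimensional risk model with constant interest rate $$U_i(t)=e^{rt}u_i+\frac{c_i}{r}(e^{rt}-1)-\delta_i\sum_{k=1}^{N(t)}e^{r(t-\theta_k)}\sigma_k,\qquad i=1,2,$$ with the assumptions listed in the context, in particular $c_1/\delta_1>c_2/\delta_2$. Let $T_{\max}(u_1,u_2)=\inf\{t\ge 0:\max\{U_1(t),U_2(t)\}<0\}$ and, for $s>0$, $\Psi_{\max}(u_1,u_2,s)=E[e^{-sT_{\max}(u_1,u_2)}]$. Then for $\frac{u_1}{\delta_1}\le\frac{u_2}{\delta_2}$ and $s>0$, the function $\Psi_{\max}(\cdot,\cdot,s)$ satisfies the integral-differential equation $$\Big(u_1+\frac{c_1}{r}\Big)\frac{\partial\Psi_{\max}}{\partial u_1}+\Big(u_2+\frac{c_2}{r}\Big)\frac{\partial\Psi_{\max}}{\partial u_2}-\frac{\lambda+s}{r}\Psi_{\max}+\frac{\lambda}{r}\int_0^\infty\Psi_{\max}(u_1-\delta_1 z,u_2-\delta_2 z,s)f(z)\,dz=0$$ with the boundary condition $$\Psi_{\max}\Big(u_1,\frac{\delta_2}{\delta_1}u_1,s\Big)=E\big[e^{-s\tau_1(u_1)}\big],$$ where $\tau_1(v)=\inf\{t\ge0:U_1(t)<0\}$ denotes the ruin time of the one-dimensional risk process $U_1$ started from initial reserve $U_1(0)=v$. Furthermore, $\Psi_{\max}$ is the unique solution of this integral-differential equation with this boundary condition.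
   Context: Model: $r>0$ is a constant interest rate; $u_1,u_2$ are initial reserves; $c_1,c_2>0$ are premium rates; $0<\delta_1,\delta_2<1$ with $\delta_1+\delta_2=1$; $N(t)$ is a Poisson process with intensity $\lambda>0$; $\{\sigma_k\}_{k\ge1}$ are i.i.d. nonnegative claim sizes, independent of $N$, with distribution function $F$ and probability density $f$; $\theta_k$ is the arrival time of the $k$-th claim of $N$. It is assumed that $c_1/\delta_1>c_2/\delta_2$. The function $\Psi_{\max}(u_1,u_2,s)$ is defined for all real $(u_1,u_2)$; in particular if $\max\{u_1,u_2\}<0$ then $T_{\max}(u_1,u_2)=0$ and $\Psi_{\max}(u_1,u_2,s)=1$.
   Formalization: The equation is claimed only where max{u1,u2}≥0 (where both are negative Ψmax=1 and it fails), with one-sided derivatives at the edge of that domain; uniqueness is among functions equal to 1 where max{u1,u2}<0 and bounded on u1/δ1≤u2/δ2, as unbounded solutions exist. *)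

theory Defs
  imports "HOL-Probability.Probability"
begin

text \<open>Arrival time of the claim with index k (k = 0,1,2,...; this is theta_(k+1) of the paper),
  built from the interarrival times W 0, W 1, ...\<close>
definition arrival :: "(nat \<Rightarrow> 'a \<Rightarrow> real) \<Rightarrow> nat \<Rightarrow> 'a \<Rightarrow> real" where
  "arrival W k \<omega> = (\<Sum>i\<le>k. W i \<omega>)"

definition surplus ::
  "real \<Rightarrow> real \<Rightarrow> real \<Rightarrow> real \<Rightarrow> (nat \<Rightarrow> 'a \<Rightarrow> real) \<Rightarrow> (nat \<Rightarrow> 'a \<Rightarrow> real)
    \<Rightarrow> real \<Rightarrow> 'a \<Rightarrow> real" where
  "surplus r u c \<delta> W \<sigma> t \<omega> =
     exp (r * t) * u + c / r * (exp (r * t) - 1)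
     - \<delta> * (\<Sum>k\<in>{k. arrival W k \<omega> \<le> t}. exp (r * (t - arrival W k \<omega>)) * \<sigma> k \<omega>)"

definition ruin_time1 ::
  "real \<Rightarrow> real \<Rightarrow> real \<Rightarrow> real \<Rightarrow> (nat \<Rightarrow> 'a \<Rightarrow> real) \<Rightarrow> (nat \<Rightarrow> 'a \<Rightarrow> real) \<Rightarrow> 'a \<Rightarrow> ereal" where
  "ruin_time1 r u c \<delta> W \<sigma> \<omega> =
     Inf (ereal ` {t. 0 \<le> t \<and> surplus r u c \<delta> W \<sigma> t \<omega> < 0})"

definition T_max ::
  "real \<Rightarrow> real \<Rightarrow> real \<Rightarrow> real \<Rightarrow> real \<Rightarrow> (nat \<Rightarrow> 'a \<Rightarrow> real) \<Rightarrow> (nat \<Rightarrow> 'a \<Rightarrow> real)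
    \<Rightarrow> real \<Rightarrow> real \<Rightarrow> 'a \<Rightarrow> ereal" where
  "T_max r c1 c2 \<delta>1 \<delta>2 W \<sigma> u1 u2 \<omega> =
     Inf (ereal ` {t. 0 \<le> t \<and>
        max (surplus r u1 c1 \<delta>1 W \<sigma> t \<omega>) (surplus r u2 c2 \<delta>2 W \<sigma> t \<omega>) < 0})"

definition disc :: "real \<Rightarrow> ereal \<Rightarrow> real" where
  "disc s T = (case T of ereal t \<Rightarrow> exp (- s * t) | _ \<Rightarrow> 0)"

definition Psi_max ::
  "'a measure \<Rightarrow> real \<Rightarrow> real \<Rightarrow> real \<Rightarrow> real \<Rightarrow> real \<Rightarrow> (nat \<Rightarrow> 'a \<Rightarrow> real) \<Rightarrow> (nat \<Rightarrow> 'a \<Rightarrow> real)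
    \<Rightarrow> real \<Rightarrow> real \<Rightarrow> real \<Rightarrow> real" where
  "Psi_max M r c1 c2 \<delta>1 \<delta>2 W \<sigma> s u1 u2 =
     (\<integral>\<omega>. disc s (T_max r c1 c2 \<delta>1 \<delta>2 W \<sigma> u1 u2 \<omega>) \<partial>M)"

definition Lap1 ::
  "'a measure \<Rightarrow> real \<Rightarrow> real \<Rightarrow> real \<Rightarrow> (nat \<Rightarrow> 'a \<Rightarrow> real) \<Rightarrow> (nat \<Rightarrow> 'a \<Rightarrow> real)
    \<Rightarrow> real \<Rightarrow> real \<Rightarrow> real" where
  "Lap1 M r c1 \<delta>1 W \<sigma> s v = (\<integral>\<omega>. disc s (ruin_time1 r v c1 \<delta>1 W \<sigma> \<omega>) \<partial>M)"

text \<open>Domain of the equation: u1/delta1 \<le> u2/delta2 and max{u1,u2} \<ge> 0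
  (where max{u1,u2} < 0 the function is identically 1 by convention).\<close>
definition ide_dom :: "real \<Rightarrow> real \<Rightarrow> (real \<times> real) set" where
  "ide_dom \<delta>1 \<delta>2 = {(x, y). x / \<delta>1 \<le> y / \<delta>2 \<and> 0 \<le> max x y}"

definition solves_IDE ::
  "real \<Rightarrow> real \<Rightarrow> real \<Rightarrow> real \<Rightarrow> real \<Rightarrow> real \<Rightarrow> (real \<Rightarrow> real) \<Rightarrow> real
    \<Rightarrow> (real \<Rightarrow> real \<Rightarrow> real) \<Rightarrow> bool" where
  "solves_IDE r c1 c2 \<delta>1 \<delta>2 lam f s g \<longleftrightarrow>
     (\<forall>u1 u2. (u1, u2) \<in> ide_dom \<delta>1 \<delta>2 \<longrightarrow>
        (\<exists>D1 D2.
           ((\<lambda>x. g x u2) has_real_derivative D1) (at u1 within {x. (x, u2) \<in> ide_dom \<delta>1 \<delta>2}) \<and>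
           ((\<lambda>y. g u1 y) has_real_derivative D2) (at u2 within {y. (u1, y) \<in> ide_dom \<delta>1 \<delta>2}) \<and>
           set_integrable lborel {0..} (\<lambda>z. g (u1 - \<delta>1 * z) (u2 - \<delta>2 * z) * f z) \<and>
           (u1 + c1 / r) * D1 + (u2 + c2 / r) * D2 - (lam + s) / r * g u1 u2
             + lam / r * (LBINT z:{0..}. g (u1 - \<delta>1 * z) (u2 - \<delta>2 * z) * f z) = 0))"

end

theory Submission
  imports Defs
begin

text \<open>
  In the coordinates \<open>p = u1/\<delta>1 + c1/(\<delta>1 r)\<close>, \<open>q = u2/\<delta>2 + c2/(\<delta>2 r)\<close> the surplus grows
  between claims by \<open>(p, q) \<mapsto> e\<^sup>r\<^sup>t (p, q)\<close>, a claim subtracts the same \<open>z\<close> from both coordinates,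
  and the line \<open>u1/\<delta>1 = u2/\<delta>2\<close> becomes \<open>p = q + d\<close> with \<open>d > 0\<close>. Conditioning on the first claim
  gives a renewal equation for \<open>\<Phi> p q = Psi_max \<dots> u1 u2\<close>.

  Existence of the partial derivatives. Integrating along the flow smooths \<open>\<Phi>\<close> in the flow
  direction only, and \<open>f\<close> need not be continuous. For fixed \<open>q\<close>, however, \<open>p\<close> matters only
  through the time \<open>\<tau>\<close> at which the two scaled surpluses meet. The derivative in \<open>\<tau>\<close> formally
  satisfies a renewal equation again; that equation is a contraction on bounded continuous functions,
  and integrating its fixed point recovers \<open>\<Phi>\<close>. On the critical line \<open>p = q\<close>, where \<open>\<tau> = \<infinity>\<close>,
  differentiability comes from a bound \<open>O((p - q)\<^sup>1\<^sup>+\<^sup>\<alpha>)\<close> on the probability that the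
  smoothly distributed discounted claims fall into a window of length \<open>p - q\<close>.

  Uniqueness. The difference \<open>w\<close> of two solutions has only separate partial derivatives, so the equation
  says nothing a priori about the derivative of \<open>w\<close> along the flow, and \<open>w\<close> need not be jointly
  continuous. As in Baire's problem on separately differentiable solutions of
  \<open>v\<^sub>x + v\<^sub>y = 0\<close>, a category argument shows that \<open>w\<close> is continuous after all; the maximum
  principle then gives \<open>w = 0\<close>.
\<close>

text \<open>Why \<open>p\<close> enters only through the meeting time: the gap \<open>p - q\<close>
  grows like \<open>e^(rt)\<close> and is unchanged by claims, and for
  \<open>q < p \<le> q + d\<close> it reaches \<open>d\<close> at
  \<open>\<tau> = ln (d / (p - q)) / r\<close>. Up to \<open>\<tau>\<close> the second scaled
  surplus is the larger one, so ruin of both is ruin of the second; from \<open>\<tau>\<close> on it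
  is ruin of the first. Moving \<open>p\<close> only moves the time at which the criterion switches.
  For \<open>p \<le> q\<close> it never switches and \<open>\<Phi>\<close> is constant in
  \<open>p\<close>, so at \<open>p = q\<close> the derivative from the right must vanish as well;
  this is why an exponent above 1 is needed. The exponent is \<open>1 + s/(2r)\<close>: as
  \<open>e^(-r\<tau>) = (p - q)/d\<close>, half of the discount rate \<open>s\<close> yields the
  power \<open>s/(2r)\<close>, and the other half is kept to sum over the claims. In the maximum
  principle the room is the gap \<open>s/r\<close> between the coefficient
  \<open>(lam + s)/r\<close> of the function and the mass \<open>lam/r\<close> of the integral term;
  it absorbs a logarithmic penalty that makes a maximum exist on the unbounded domain.\<close>

section \<open>Continuity of separately differentiable solutions\<close>

text \<open>The penalty \<open>K (x/y - p/b)\<^sup>2\<close> is constant along rays. It keeps the maximum of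
  \<open>F - (M + \<epsilon>) ln y\<close> off the lateral sides of the box, and at a maximum above the base the two
  separate partial derivatives are enough for a contradiction.\<close>

lemma flow_increment_upper:
  fixes F :: "real \<times> real \<Rightarrow> real"
  assumes b: "b > 0" and V: "V \<ge> 1" and eta: "\<eta> > 0" and M: "M \<ge> 0"
    and contF: "continuous_on ({1..V} \<times> {-\<eta>..\<eta>}) (\<lambda>(v,u). F (v * (p + u), v * b))"
    and der: "\<And>v u. 1 < v \<Longrightarrow> v \<le> V \<Longrightarrow> \<bar>u\<bar> < \<eta> \<Longrightarrow>
       \<exists>D1 D2. ((\<lambda>t. F (t, v * b)) has_real_derivative D1) (at (v * (p + u))) \<and>
               ((\<lambda>t. F (v * (p + u), t)) has_real_derivative D2) (at (v * b)) \<and>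
               v * (p + u) * D1 + v * b * D2 \<le> M"
  shows "F (V * p, V * b) - F (p, b) \<le> M * ln V"
proof (rule field_le_epsilon)
  fix e0 :: real assume e0: "e0 > 0"
  \<comment> \<open>One \<open>\<epsilon>\<close> is lost in moving on the base from the maximum
    point to \<open>p\<close>, and \<open>\<epsilon> ln V\<close> in the slope; together they make
    \<open>e0\<close>.\<close>
  define \<epsilon> where "\<epsilon> = e0 / (1 + ln V)"
  have lnV: "ln V \<ge> 0" using V by simp
  have eps: "\<epsilon> > 0"
    using e0 lnV by (auto simp: \<epsilon>_def)
  have "\<epsilon> * (1 + ln V) = e0"
    using lnV by (simp add: \<epsilon>_def)
  then have eps0: "\<epsilon> + \<epsilon> * ln V = e0"
    by (simp add: algebra_simps)
  let ?f = "\<lambda>(v,u). F (v * (p + u), v * b)"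
  have c1: "continuous_on {-\<eta>..\<eta>} (\<lambda>u. F (p + u, b))"
  proof -
    have "continuous_on {-\<eta>..\<eta>} (?f \<circ> (\<lambda>u. (1, u)))"
      using V by (intro continuous_on_compose continuous_intros continuous_on_subset[OF contF]) auto
    then show ?thesis by (simp add: o_def)
  qed
  have "isCont (\<lambda>u. F (p + u, b)) 0"
    by (rule continuous_on_interior[OF c1]) (use eta in \<open>auto simp: interior_atLeastAtMost_real\<close>)
  then obtain e1 where e1: "e1 > 0" "\<And>u. \<bar>u\<bar> < e1 \<Longrightarrow> \<bar>F (p + u, b) - F (p, b)\<bar> < \<epsilon>"
    using eps unfolding continuous_at_eps_delta by (auto simp: dist_real_def)
  define h where "h = min \<eta> (e1/2)"
  have h: "h > 0" "h \<le> \<eta>" "h < e1" using e1 eta by (auto simp: h_def min_def)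
  define Q where "Q = {1..V} \<times> {-h..h}"
  have compQ: "compact Q" unfolding Q_def by (intro compact_Times compact_Icc)
  have Qne: "Q \<noteq> {}" using V h by (auto simp: Q_def)
  have contQ: "continuous_on Q ?f"
    by (rule continuous_on_subset[OF contF]) (use h in \<open>auto simp: Q_def\<close>)
  have "bounded (?f ` Q)" by (intro compact_imp_bounded compact_continuous_image contQ compQ)
  then obtain Bd where Bd0: "\<forall>y\<in>?f ` Q. norm y \<le> Bd"
    unfolding bounded_iff by blast
  have Bd: "\<bar>?f z\<bar> \<le> Bd" if "z \<in> Q" for z
    using Bd0 that unfolding real_norm_def by blast
  \<comment> \<open>On the lateral sides \<open>|u| = h\<close> the penalty \<open>K (u/b)^2\<close>
    is \<open>2 Bd + (M + \<epsilon>) ln V + 1\<close>, more than the rest of \<open>G\<close> can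
    vary over the box, so the maximum avoids them.\<close>
  define K where "K = (2 * Bd + (M + \<epsilon>) * ln V + 1) * (b / h)^2"
  define \<psi> where "\<psi> = (\<lambda>x y. (M + \<epsilon>) * ln y + K * (x / y - p / b)^2)"
  define G where "G = (\<lambda>(v,u). ?f (v,u) - \<psi> (v * (p + u)) (v * b))"
  have uq: "v * (p + u) / (v * b) - p / b = u / b" if "v \<ge> 1" for v u
    using that b by (simp add: field_simps)
  have contG: "continuous_on Q G"
  proof -
    have "continuous_on Q (\<lambda>z. ?f z - ((M + \<epsilon>) * ln (fst z * b) + K * (fst z * (p + snd z) / (fst z * b) - p / b)^2))"
      by (intro continuous_intros contQ) (use b in \<open>auto simp: Q_def\<close>)
    then show ?thesis by (simp add: G_def \<psi>_def split_beta')
  qed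
  obtain z where z: "z \<in> Q" "\<And>z'. z' \<in> Q \<Longrightarrow> G z' \<le> G z"
    using continuous_attains_sup[OF compQ Qne contG] by blast
  obtain v u where vu: "z = (v, u)" by (cases z)
  have v: "1 \<le> v" "v \<le> V" and u: "\<bar>u\<bar> \<le> h" using z(1) by (auto simp: vu Q_def)
  have max: "G (v', u') \<le> G (v, u)" if "1 \<le> v'" "v' \<le> V" "\<bar>u'\<bar> \<le> h" for v' u'
    using z(2)[of "(v',u')"] that by (auto simp: vu Q_def abs_le_iff)
  have Geq: "G (v', u') = F (v' * (p + u'), v' * b) - ((M + \<epsilon>) * ln v' + (M + \<epsilon>) * ln b + K * (u'/b)^2)"
    if "v' \<ge> 1" for v' u'
    using that b uq[OF that, of u'] by (simp add: G_def \<psi>_def ln_mult algebra_simps)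
  have GV: "G (V, 0) \<le> G (v, u)" by (rule max) (use V h in auto)
  have Bd0: "Bd \<ge> 0" using Bd[OF z(1)] by linarith
  have Meps: "M + \<epsilon> > 0" using M eps by simp
  have notlat: "\<bar>u\<bar> < h"
  proof (rule ccontr)
    assume "\<not> \<bar>u\<bar> < h"
    with u have uh: "\<bar>u\<bar> = h" by simp
    then have "u\<^sup>2 = h\<^sup>2" by (metis power2_abs)
    then have "K * (u/b)^2 = 2 * Bd + (M + \<epsilon>) * ln V + 1"
      using h b by (simp add: K_def power_divide)
    moreover have "\<bar>?f (v,u)\<bar> \<le> Bd" "\<bar>?f (V,0)\<bar> \<le> Bd" 
      by (rule Bd; use z(1) vu V h in \<open>auto simp: Q_def\<close>)+
    moreover have "(M + \<epsilon>) * ln v \<ge> 0" using Meps v by simp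
    ultimately show False using GV Geq[OF v(1), of u] Geq[OF V, of 0] by auto
  qed
  have v1: "v = 1"
  proof (rule ccontr)
    assume "v \<noteq> 1"
    with v have v1: "v > 1" by simp
    define x y where "x = v * (p + u)" and "y = v * b"
    have y0: "y > 0" using v1 b by (simp add: y_def)
    obtain D1 D2 where D1: "((\<lambda>t. F (t, y)) has_real_derivative D1) (at x)"
      and D2: "((\<lambda>t. F (x, t)) has_real_derivative D2) (at y)"
      and le: "x * D1 + y * D2 \<le> M"
      using der[OF v1 v(2) less_le_trans[OF notlat h(2)]] unfolding x_def y_def by blast
    have G': "F (x', y') - \<psi> x' y' \<le> F (x, y) - \<psi> x y"
      if "b \<le> y'" "y' \<le> y" "\<bar>b * x' / y' - p\<bar> \<le> h" for x' y'
    proof -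
      have "1 \<le> y'/b" "y'/b \<le> V" using that b v(2) by (auto simp: field_simps y_def intro: order_trans[OF that(2)])
      from max[OF this that(3)] show ?thesis
        using that b v1 by (simp add: G_def x_def y_def)
    qed
    define P1 where "P1 = 2 * K * (x / y - p / b) / y"
    define P2 where "P2 = (M + \<epsilon>) / y - 2 * K * (x / y - p / b) * x / y^2"
    have d1: "((\<lambda>t. F (t, y) - \<psi> t y) has_real_derivative D1 - P1) (at x)"
      unfolding \<psi>_def P1_def using y0 b
      by (auto intro!: derivative_eq_intros D1 simp: field_simps power2_eq_square)
    have d2: "((\<lambda>t. F (x, t) - \<psi> x t) has_real_derivative D2 - P2) (at y)"
      unfolding \<psi>_def P2_def using y0 b
      by (auto intro!: derivative_eq_intros D2 simp: field_simps power2_eq_square)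
    have ux: "b * x / y - p = u" using v1 b by (simp add: x_def y_def)
    have "D1 - P1 = 0"
    proof (rule DERIV_local_max[OF d1])
      show "0 < v * (h - \<bar>u\<bar>)" using notlat v1 by simp
      show "\<forall>t. \<bar>x - t\<bar> < v * (h - \<bar>u\<bar>) \<longrightarrow> F (t, y) - \<psi> t y \<le> F (x, y) - \<psi> x y"
      proof (intro allI impI G')
        fix t assume t: "\<bar>x - t\<bar> < v * (h - \<bar>u\<bar>)"
        have "b * t / y - p = u + (t - x) / v" using v1 b by (simp add: x_def y_def field_simps)
        moreover have "\<bar>(t - x) / v\<bar> < h - \<bar>u\<bar>" using t v1 by (simp add: field_simps abs_minus_commute)
        ultimately show "\<bar>b * t / y - p\<bar> \<le> h" by linarith
      qed (use v1 b in \<open>auto simp: y_def\<close>)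
    qed
    \<comment> \<open>The maximum may lie on the upper edge \<open>v = V\<close>, so only smaller
      values of \<open>y\<close> can be compared; since \<open>y > 0\<close>, one inequality is
      enough.\<close>
    moreover have "D2 - P2 \<ge> 0"
    proof (rule ccontr)
      assume "\<not> D2 - P2 \<ge> 0"
      then obtain e where e: "e > 0" "\<And>k. 0 < k \<Longrightarrow> k < e \<Longrightarrow> F (x, y) - \<psi> x y < F (x, y - k) - \<psi> x (y - k)"
        using DERIV_neg_dec_left[OF d2] by (auto simp: not_le)
      have "isCont (\<lambda>k. b * x / (y - k) - p) 0" using y0 by (intro continuous_intros) auto
      then obtain e' where e': "e' > 0" "\<And>k. \<bar>k\<bar> < e' \<Longrightarrow> \<bar>(b * x / (y - k) - p) - u\<bar> < h - \<bar>u\<bar>"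
        unfolding continuous_at_eps_delta using notlat ux
        by (metis (no_types, lifting) diff_gt_0_iff_gt diff_zero real_norm_def dist_real_def)
      define k where "k = min (min e e') (y - b) / 2"
      have yb: "y - b > 0" using v1 b by (simp add: y_def)
      have k: "0 < k" "k < e" "k < e'" "k < y - b" using e e' yb by (auto simp: k_def min_def)
      have "\<bar>b * x / (y - k) - p\<bar> \<le> h" using e'(2)[of k] k by linarith
      then have "F (x, y - k) - \<psi> x (y - k) \<le> F (x, y) - \<psi> x y"
        by (intro G') (use k in auto)
      with e(2)[of k] k show False by simp
    qed
    moreover have "x * P1 + y * P2 = M + \<epsilon>"
      using y0 by (simp add: P1_def P2_def field_simps power2_eq_square)
    moreover have "y * P2 \<le> y * D2" using calculation(2) y0 by simp
    ultimately have "x * D1 + y * D2 \<ge> M + \<epsilon>" by simp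
    with le eps show False by simp
  qed
  have "F (V * p, V * b) - (M + \<epsilon>) * ln V \<le> F (p + u, b)"
  proof -
    have "K \<ge> 0" using Bd0 Meps lnV by (simp add: K_def)
    then have "K * (u/b)^2 \<ge> 0" by simp
    then show ?thesis using GV Geq[OF V, of 0] Geq[of 1 u] v1 by simp
  qed
  moreover have "F (p + u, b) < F (p, b) + \<epsilon>" using e1(2)[of u] notlat h by linarith
  ultimately show "F (V * p, V * b) - F (p, b) \<le> M * ln V + e0"
    using eps0 by (simp add: algebra_simps)
qed

text \<open>Only a bound on \<open>x D1 + y D2\<close> is kept from the equation; the continuity
  argument never uses the value. At the lower edge \<open>y = q0\<close> the derivative in
  \<open>y\<close> is one-sided. The oblique edge \<open>x = y + d\<close> is excluded, so the
  derivative in \<open>x\<close> is two-sided throughout.\<close>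

locale flow_pde =
  fixes F D1 D2 :: "real \<times> real \<Rightarrow> real" and q0 d M :: real
  assumes q0: "q0 > 0" and M: "M \<ge> 0"
    and hx: "\<And>x y. q0 \<le> y \<Longrightarrow> x < y + d \<Longrightarrow> ((\<lambda>t. F (t, y)) has_real_derivative D1 (x, y)) (at x)"
    and hy: "\<And>x y. q0 \<le> y \<Longrightarrow> x < y + d \<Longrightarrow>
               ((\<lambda>t. F (x, t)) has_real_derivative D2 (x, y)) (at y within {q0..})"
    and bd: "\<And>x y. q0 \<le> y \<Longrightarrow> x < y + d \<Longrightarrow> \<bar>x * D1 (x, y) + y * D2 (x, y)\<bar> \<le> M"
begin

definition X :: "(real \<times> real) set" where "X = {(x, y). q0 \<le> y \<and> x < y + d}"

lemma X_iff [simp]: "(x, y) \<in> X \<longleftrightarrow> q0 \<le> y \<and> x < y + d"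
  by (simp add: X_def)

text \<open>The upper estimate is applied to \<open>F\<close> and to \<open>- F\<close>. The set
  \<open>T\<close> contains the points swept by a short horizontal segment; joint continuity is
  required only there, so the estimate stays available when \<open>F\<close> has discontinuities
  elsewhere.\<close>

lemma flow_increment:
  assumes b: "b \<ge> q0" and V: "V \<ge> 1" and eta: "\<eta> > 0"
    and sub: "\<And>v u. 1 \<le> v \<Longrightarrow> v \<le> V \<Longrightarrow> \<bar>u\<bar> \<le> \<eta> \<Longrightarrow> (v * (p + u), v * b) \<in> T"
    and T: "T \<subseteq> X" and cont: "continuous_on T F"
  shows "\<bar>F (V * p, V * b) - F (p, b)\<bar> \<le> M * ln V"
proof -
  have b0: "b > 0" using b q0 by simp
  have c: "continuous_on ({1..V} \<times> {-\<eta>..\<eta>}) (\<lambda>(v,u). F (v * (p + u), v * b))"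
  proof -
    have "continuous_on ({1..V} \<times> {-\<eta>..\<eta>}) (F \<circ> (\<lambda>z. (fst z * (p + snd z), fst z * b)))"
      by (intro continuous_on_compose continuous_intros continuous_on_subset[OF cont])
         (use sub in \<open>auto simp: abs_le_iff\<close>)
    then show ?thesis by (simp add: o_def split_beta')
  qed
  have der: "((\<lambda>t. F (t, v * b)) has_real_derivative D1 (v * (p + u), v * b)) (at (v * (p + u)))
     \<and> ((\<lambda>t. F (v * (p + u), t)) has_real_derivative D2 (v * (p + u), v * b)) (at (v * b))
     \<and> \<bar>v * (p + u) * D1 (v * (p + u), v * b) + v * b * D2 (v * (p + u), v * b)\<bar> \<le> M"
    if "1 < v" "v \<le> V" "\<bar>u\<bar> < \<eta>" for v u
  proof -
    have "(v * (p + u), v * b) \<in> X" using sub[of v u] T that by auto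
    then have *: "q0 \<le> v * b" "v * (p + u) < v * b + d" by auto
    have "b < v * b" using that b0 by simp
    then have "v * b > q0" using b by linarith
    then have "at (v * b) within {q0..} = at (v * b)"
      by (intro at_within_interior) simp
    then show ?thesis using hx[OF *] hy[OF *] bd[OF *] by simp
  qed
  have "F (V * p, V * b) - F (p, b) \<le> M * ln V"
    by (rule flow_increment_upper[OF b0 V eta M c]) (use der in fastforce)
  moreover have "- F (V * p, V * b) - - F (p, b) \<le> M * ln V"
  proof (rule flow_increment_upper[where F = "\<lambda>z. - F z", OF b0 V eta M])
    show "continuous_on ({1..V} \<times> {-\<eta>..\<eta>}) (\<lambda>(v,u). - F (v * (p + u), v * b))"
      using continuous_on_minus[OF c] by (simp add: split_beta')
    fix v u :: real assume vu: "1 < v" "v \<le> V" "\<bar>u\<bar> < \<eta>"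
    note d = der[OF vu]
    show "\<exists>D1 D2. ((\<lambda>t. - F (t, v * b)) has_real_derivative D1) (at (v * (p + u))) \<and>
               ((\<lambda>t. - F (v * (p + u), t)) has_real_derivative D2) (at (v * b)) \<and>
               v * (p + u) * D1 + v * b * D2 \<le> M"
      by (rule exI[of _ "- D1 (v * (p + u), v * b)"], rule exI[of _ "- D2 (v * (p + u), v * b)"])
         (use d in \<open>auto intro!: derivative_intros simp: abs_le_iff\<close>)
  qed
  ultimately show ?thesis by (simp add: abs_le_iff)
qed

text \<open>For \<open>v < 1\<close> the two ends exchange roles: the scaling by \<open>1/v\<close>
  starts at \<open>(v p, v b)\<close>, where a segment of half-width \<open>v \<eta>\<close> sweeps
  the same region.\<close>

lemma flow_increment_signed:
  assumes b: "b \<ge> q0" "v * b \<ge> q0" and v: "v > 0" and eta: "\<eta> > 0"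
    and sub: "\<And>t u. t \<in> closed_segment 1 v \<Longrightarrow> \<bar>u\<bar> \<le> \<eta> \<Longrightarrow> (t * (p + u), t * b) \<in> T"
    and T: "T \<subseteq> X" and cont: "continuous_on T F"
  shows "\<bar>F (v * p, v * b) - F (p, b)\<bar> \<le> M * \<bar>ln v\<bar>"
proof (cases "v \<ge> 1")
  case True
  then show ?thesis
    using flow_increment[OF b(1) True eta, of p T] sub T cont by (auto simp: closed_segment_eq_real_ivl)
next
  case False
  have "\<bar>F ((1/v) * (v * p), (1/v) * (v * b)) - F (v * p, v * b)\<bar> \<le> M * ln (1/v)"
  proof (rule flow_increment[OF b(2) _ _ _ T cont])
    show "v * \<eta> > 0" using v eta by simp
    show "1 \<le> 1 / v" using False v by simp
    fix w u assume w: "1 \<le> w" "w \<le> 1 / v" and u: "\<bar>u\<bar> \<le> v * \<eta>"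
    have "w * v \<le> 1" using w v by (simp add: field_simps)
    moreover have "v \<le> w * v" using w v by simp
    ultimately have "w * v \<in> closed_segment 1 v" using False by (simp add: closed_segment_eq_real_ivl)
    moreover have "\<bar>u / v\<bar> \<le> \<eta>" using u v by (simp add: field_simps)
    ultimately have "(w * v * (p + u / v), w * v * b) \<in> T" by (rule sub)
    moreover have "w * v * (p + u / v) = w * (v * p + u)" using v by (simp add: field_simps)
    ultimately show "(w * (v * p + u), w * (v * b)) \<in> T" by (metis mult.assoc)
  qed
  then show ?thesis using v False by (simp add: ln_div abs_minus_commute)
qed

text \<open>At the end point \<open>(v p, v b)\<close> itself no joint continuity is assumed: it is approached vertically,
  from the interior of the swept region.\<close>

lemma flow_increment_limit:
  assumes b: "b \<ge> q0" "v * b \<ge> q0" and v: "v > 0" and eta: "\<eta> > 0"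
    and inX: "(p, b) \<in> X" "(v * p, v * b) \<in> X"
    and sub: "\<And>t u. t \<in> closed_segment 1 v \<Longrightarrow> t \<noteq> v \<Longrightarrow> \<bar>u\<bar> \<le> \<eta> \<Longrightarrow>
        (t * (p + u), t * b) \<in> X \<and> continuous (at (t * (p + u), t * b) within X) F"
  shows "\<bar>F (v * p, v * b) - F (p, b)\<bar> \<le> M * \<bar>ln v\<bar>"
proof (cases "v = 1")
  case True then show ?thesis by simp
next
  case False
  define Z where "Z = at v within closed_segment 1 v"
  have "v islimpt closed_segment 1 v"
  proof (rule connected_imp_perfect)
    show "closed_segment 1 v \<noteq> {x}" for x
      using False ends_in_segment[of 1 v] ends_in_segment[of v 1] by (metis singletonD)
  qed auto
  then have Z0: "Z \<noteq> bot" unfolding Z_def by (simp add: trivial_limit_within)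
  have b0: "b > 0" using b q0 by simp
  have ev: "\<forall>\<^sub>F t in Z. t \<in> closed_segment 1 v \<and> t \<noteq> v"
    unfolding Z_def eventually_at_filter by simp
  have t1: "((\<lambda>t. v * p / t) \<longlongrightarrow> v * p / v) Z"
    unfolding Z_def using v by (intro tendsto_intros) auto
  have ev2: "\<forall>\<^sub>F t in Z. \<bar>v * p / t - p\<bar> < \<eta> / 2"
    using tendstoD[OF t1, of "\<eta>/2"] eta v by (simp add: dist_real_def)
  \<comment> \<open>Starting at \<open>v p / t\<close> instead of \<open>p\<close> fixes the first
    coordinate of the end point at \<open>v p\<close>. As \<open>t\<close> tends to
    \<open>v\<close>, only separate continuity is then used: in the first variable at the start, in
    the second at the end.\<close>
  have le: "\<forall>\<^sub>F t in Z. \<bar>F (v * p, t * b) - F (v * p / t, b)\<bar> \<le> M * \<bar>ln t\<bar>"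
    using ev ev2
  proof eventually_elim
    case (elim t)
    have tpos: "t > 0" and seg: "\<And>t'. t' \<in> closed_segment 1 t \<Longrightarrow> t' \<in> closed_segment 1 v \<and> t' \<noteq> v"
      using elim v by (auto simp: closed_segment_eq_real_ivl split: if_splits)
    define T where "T = {(t' * (v * p / t + u), t' * b) | t' u. t' \<in> closed_segment 1 t \<and> \<bar>u\<bar> \<le> \<eta> / 2}"
    have T: "z \<in> X \<and> continuous (at z within X) F" if zT: "z \<in> T" for z
    proof -
      obtain t' u where z: "z = (t' * (v * p / t + u), t' * b)" and t': "t' \<in> closed_segment 1 t" 
        and u: "\<bar>u\<bar> \<le> \<eta> / 2" using zT unfolding T_def by blast
      have "\<bar>v * p / t + u - p\<bar> \<le> \<eta>"
        using u elim(2) abs_triangle_ineq[of "v * p / t - p" u] by (simp add: algebra_simps)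
      with sub[of t' "v * p / t + u - p"] seg[OF t'] show ?thesis by (simp add: z)
    qed
    have "\<bar>F (t * (v * p / t), t * b) - F (v * p / t, b)\<bar> \<le> M * \<bar>ln t\<bar>"
    proof (rule flow_increment_signed[where T = T and \<eta> = "\<eta>/2"])
      show "continuous_on T F"
        unfolding continuous_on_eq_continuous_within
        using T by (meson continuous_within_subset subsetI)
      have "(t * (v * p / t + 0), t * b) \<in> T" 
        unfolding T_def mem_Collect_eq by (intro exI[of _ t] exI[of _ 0]) (use eta in simp)
      from T[OF this] show "t * b \<ge> q0" by simp
      show "T \<subseteq> X" using T by blast
      fix t' u assume "t' \<in> closed_segment 1 t" "\<bar>u\<bar> \<le> \<eta> / 2"
      then show "(t' * (v * p / t + u), t' * b) \<in> T" unfolding T_def by blast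
    qed (use b eta tpos in auto)
    then show ?case using tpos by simp
  qed
  have t2: "((\<lambda>t. F (v * p / t, b)) \<longlongrightarrow> F (p, b)) Z"
  proof -
    have "isCont (\<lambda>t. F (t, b)) p" using hx[of b p] inX by (auto intro: DERIV_isCont)
    from isCont_tendsto_compose[OF this, of "\<lambda>t. v * p / t" Z] t1 v show ?thesis by simp
  qed
  have t3: "((\<lambda>t. F (v * p, t * b)) \<longlongrightarrow> F (v * p, v * b)) Z"
  proof -
    have "continuous (at (v * b) within {q0..}) (\<lambda>t. F (v * p, t))"
      using hy[of "v * b" "v * p"] inX by (auto intro: DERIV_continuous)
    then have c: "((\<lambda>t. F (v * p, t)) \<longlongrightarrow> F (v * p, v * b)) (at (v * b) within {q0..})"
      by (simp add: continuous_within)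
    have "filterlim (\<lambda>t. t * b) (at (v * b) within {q0..}) Z"
      unfolding filterlim_at
    proof
      show "\<forall>\<^sub>F t in Z. t * b \<in> {q0..} \<and> t * b \<noteq> v * b"
        using ev
      proof eventually_elim
        case (elim t)
        have "1 \<le> t \<or> v \<le> t" using elim by (auto simp: closed_segment_eq_real_ivl split: if_splits)
        then have "b \<le> t * b \<or> v * b \<le> t * b" using b0 by auto
        then have "t * b \<ge> q0" using b by linarith
        then show ?case using elim b0 by simp
      qed
      show "((\<lambda>t. t * b) \<longlongrightarrow> v * b) Z" unfolding Z_def by (intro tendsto_intros)
    qed
    from filterlim_compose[OF c this] show ?thesis .
  qed
  have t4: "((\<lambda>t. M * \<bar>ln t\<bar>) \<longlongrightarrow> M * \<bar>ln v\<bar>) Z"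
    unfolding Z_def using v by (intro tendsto_intros) auto
  show ?thesis
    by (rule tendsto_le[OF Z0 t4 _ le]) (intro tendsto_intros t2 t3)
qed

end

section \<open>The category argument\<close>

lemma Baire_closed_cover:
  fixes S :: "'b::{real_normed_vector,heine_borel} set" and A :: "nat \<Rightarrow> 'b set"
  assumes S: "closed S" "S \<noteq> {}" and cover: "S \<subseteq> (\<Union>n. closure (A n))"
  shows "\<exists>n x \<eta>. x \<in> S \<and> \<eta> > 0 \<and> S \<inter> ball x \<eta> \<subseteq> closure (A n)"
proof (rule ccontr)
  assume neg: "\<not> ?thesis"
  let ?\<G> = "range (\<lambda>n. S - closure (A n))"
  \<comment> \<open>If no closure had relative interior in \<open>S\<close>, all these complements
    would be open and dense in \<open>S\<close>; their intersection is empty because the closures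
    cover \<open>S\<close>.\<close>
  have "S \<subseteq> closure (\<Inter>?\<G>)"
  proof (rule Baire[OF S(1)])
    fix T assume "T \<in> ?\<G>"
    then obtain n where T: "T = S - closure (A n)" by blast
    have "openin (top_of_set S) T"
      unfolding T openin_open by (intro exI[of _ "- closure (A n)"]) auto
    moreover have "S \<subseteq> closure T"
    proof
      fix x assume x: "x \<in> S"
      show "x \<in> closure T"
        unfolding closure_approachable
      proof (intro allI impI)
        fix e :: real assume "e > 0"
        with neg x obtain y where "y \<in> S \<inter> ball x e" "y \<notin> closure (A n)" by blast
        then show "\<exists>y\<in>T. dist y x < e" by (auto simp: T dist_commute)
      qed
    qed
    ultimately show "openin (top_of_set S) T \<and> S \<subseteq> closure T" ..
  qed auto
  moreover have "\<Inter>?\<G> = {}" using cover by auto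
  ultimately show False using S(2) by (metis closure_empty subset_empty)
qed

lemma has_real_derivative_pointwise_Lipschitz:
  assumes "(f has_real_derivative D) (at x within S)"
  shows "\<exists>\<delta>>0. \<exists>K. \<forall>y\<in>S. \<bar>y - x\<bar> < \<delta> \<longrightarrow> \<bar>f y - f x\<bar> \<le> K * \<bar>y - x\<bar>"
proof -
  have "(f has_derivative (\<lambda>h. h * D)) (at x within S)"
    using assms by (simp add: has_field_derivative_def mult.commute[of _ D])
  from this[unfolded has_derivative_within_alt, THEN conjunct2, rule_format, of 1]
  obtain \<delta> where \<delta>: "\<delta> > 0" "\<And>y. y \<in> S \<Longrightarrow> norm (y - x) < \<delta> \<Longrightarrow> norm (f y - f x - (y - x) * D) \<le> norm (y - x)"
    by auto
  show ?thesis
  proof (intro exI conjI ballI impI)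
    show "\<delta> > 0" by fact
    fix y assume y: "y \<in> S" "\<bar>y - x\<bar> < \<delta>"
    have "\<bar>f y - f x\<bar> \<le> \<bar>f y - f x - (y - x) * D\<bar> + \<bar>(y - x) * D\<bar>" by linarith
    also have "\<dots> \<le> \<bar>y - x\<bar> + \<bar>y - x\<bar> * \<bar>D\<bar>" using \<delta>(2)[of y] y by (simp add: abs_mult)
    finally show "\<bar>f y - f x\<bar> \<le> (1 + \<bar>D\<bar>) * \<bar>y - x\<bar>" by (simp add: algebra_simps)
  qed
qed

context flow_pde
begin

text \<open>The closure in \<open>X\<close> of the set of discontinuities. Passing to the closure
  makes the set relatively closed, as Baire's theorem requires, and leaves \<open>F\<close>
  continuous on its relatively open complement.\<close>

definition Disc :: "(real \<times> real) set" where
  "Disc = {z \<in> X. \<forall>e>0. \<exists>z'\<in>X. dist z' z < e \<and> \<not> continuous (at z' within X) F}"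

lemma Disc_D: "z \<in> Disc \<Longrightarrow> e > 0 \<Longrightarrow> \<exists>z'\<in>X. dist z' z < e \<and> \<not> continuous (at z' within X) F"
  by (simp add: Disc_def)

lemma Disc_limit:
  assumes "z \<in> X" "z \<in> closure Disc" shows "z \<in> Disc"
  unfolding Disc_def
proof (intro CollectI conjI allI impI)
  fix e :: real assume e: "e > 0"
  then obtain y where y: "y \<in> Disc" "dist y z < e / 2"
    using assms(2) unfolding closure_approachable by (meson half_gt_zero)
  then obtain z' where z': "z' \<in> X" "dist z' y < e / 2" "\<not> continuous (at z' within X) F"
    using Disc_D[OF y(1), of "e/2"] e by auto
  have "dist z' z < e" using y(2) z'(2) dist_triangle[of z' z y] by linarith
  with z' show "\<exists>z'\<in>X. dist z' z < e \<and> \<not> continuous (at z' within X) F" by blast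
qed (fact assms)

lemma not_Disc_continuous: "z \<in> X \<Longrightarrow> z \<notin> Disc \<Longrightarrow> continuous (at z within X) F"
  unfolding Disc_def by force

text \<open>A derivative gives a Lipschitz bound at a single point, with its own constant and
  radius; \<open>A n\<close> makes both uniform, and the \<open>A n\<close> exhaust
  \<open>Disc\<close>. The shift to \<open>n + 1\<close> keeps the radius positive for
  \<open>n = 0\<close>.\<close>

definition A :: "nat \<Rightarrow> (real \<times> real) set" where
  "A n = {(x, y) \<in> Disc. 
     (\<forall>x'. \<bar>x' - x\<bar> \<le> 1 / (real n + 1) \<longrightarrow> x' < y + d \<longrightarrow> \<bar>F (x', y) - F (x, y)\<bar> \<le> (real n + 1) * \<bar>x' - x\<bar>) \<and>
     (\<forall>y'. \<bar>y' - y\<bar> \<le> 1 / (real n + 1) \<longrightarrow> q0 \<le> y' \<longrightarrow> x < y' + d \<longrightarrow> \<bar>F (x, y') - F (x, y)\<bar> \<le> (real n + 1) * \<bar>y' - y\<bar>)}"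

lemma A_cover: "z \<in> Disc \<Longrightarrow> \<exists>n. z \<in> A n"
proof -
  assume z: "z \<in> Disc"
  obtain x y where xy: "z = (x, y)" by (cases z)
  have inX: "q0 \<le> y" "x < y + d" using z by (auto simp: Disc_def xy)
  from has_real_derivative_pointwise_Lipschitz[OF hx[OF inX]]
  obtain e1 K1 where 1: "e1 > 0" "\<And>x'. \<bar>x' - x\<bar> < e1 \<Longrightarrow> \<bar>F (x', y) - F (x, y)\<bar> \<le> K1 * \<bar>x' - x\<bar>"
    by auto
  from has_real_derivative_pointwise_Lipschitz[OF hy[OF inX]]
  obtain e2 K2 where 2: "e2 > 0" "\<And>y'. q0 \<le> y' \<Longrightarrow> \<bar>y' - y\<bar> < e2 \<Longrightarrow> \<bar>F (x, y') - F (x, y)\<bar> \<le> K2 * \<bar>y' - y\<bar>"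
    by auto
  obtain n :: nat where n: "real n > max (max K1 K2) (max (1/e1) (1/e2))"
    using reals_Archimedean2 by blast
  have n1: "1 / (real n + 1) < e1" "1 / (real n + 1) < e2" "K1 \<le> real n + 1" "K2 \<le> real n + 1"
  proof -
    have "1/e1 < real n + 1" "1/e2 < real n + 1" using n by auto
    then show "1 / (real n + 1) < e1" "1 / (real n + 1) < e2"
      using 1(1) 2(1) by (simp_all add: divide_less_eq mult.commute)
  qed (use n in auto)
  have "z \<in> A n"
    unfolding A_def xy
  proof (intro CollectI case_prodI conjI allI impI)
    show "(x, y) \<in> Disc" using z xy by simp
    fix x' assume "\<bar>x' - x\<bar> \<le> 1 / (real n + 1)"
    then have "\<bar>F (x', y) - F (x, y)\<bar> \<le> K1 * \<bar>x' - x\<bar>" using 1(2) n1(1) by simp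
    also have "\<dots> \<le> (real n + 1) * \<bar>x' - x\<bar>" using n1(3) by (intro mult_right_mono) auto
    finally show "\<bar>F (x', y) - F (x, y)\<bar> \<le> (real n + 1) * \<bar>x' - x\<bar>" .
  next
    fix y' assume "\<bar>y' - y\<bar> \<le> 1 / (real n + 1)" "q0 \<le> y'"
    then have "\<bar>F (x, y') - F (x, y)\<bar> \<le> K2 * \<bar>y' - y\<bar>" using 2(2) n1(2) by simp
    also have "\<dots> \<le> (real n + 1) * \<bar>y' - y\<bar>" using n1(4) by (intro mult_right_mono) auto
    finally show "\<bar>F (x, y') - F (x, y)\<bar> \<le> (real n + 1) * \<bar>y' - y\<bar>" .
  qed
  then show ?thesis by blast
qed

text \<open>\<open>X\<close> is not closed at its oblique edge, so Baire's theorem is applied to the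
  closure of the part of \<open>Disc\<close> in a ball small enough that this closure stays inside
  \<open>Disc\<close>. The factor 2 in the bound on \<open>\<delta>\<close> keeps the coordinates of
  any two points of the box within the Lipschitz radius of \<open>A n\<close>.\<close>

lemma portion:
  assumes "Disc \<noteq> {}"
  obtains z0 n \<delta> where "z0 \<in> Disc" "\<delta> > 0" "\<delta> \<le> 1 / (2 * (real n + 1))"
    "\<And>x y. \<bar>x - fst z0\<bar> < \<delta> \<Longrightarrow> \<bar>y - snd z0\<bar> < \<delta> \<Longrightarrow> q0 \<le> y \<Longrightarrow> x < y + d"
    "\<And>x y. \<bar>x - fst z0\<bar> < \<delta> \<Longrightarrow> \<bar>y - snd z0\<bar> < \<delta> \<Longrightarrow> (x, y) \<in> Disc \<Longrightarrow> (x, y) \<in> closure (A n)"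
proof -
  obtain e1 e2 where e: "(e1, e2) \<in> Disc" using assms by auto
  then have eX: "q0 \<le> e2" "e1 < e2 + d" by (auto simp: Disc_def)
  define \<epsilon> where "\<epsilon> = (e2 + d - e1) / 4"
  have eps: "\<epsilon> > 0" using eX by (simp add: \<epsilon>_def)
  have inX: "x < y + d" if "(x, y) \<in> cball (e1, e2) \<epsilon>" for x y
  proof -
    have "\<bar>x - e1\<bar> \<le> \<epsilon>" "\<bar>y - e2\<bar> \<le> \<epsilon>"
      using that dist_fst_le[of "(e1,e2)" "(x,y)"] dist_snd_le[of "(e1,e2)" "(x,y)"]
      by (auto simp: dist_real_def abs_minus_commute)
    then have "x \<le> e1 + \<epsilon>" "e2 - \<epsilon> \<le> y" by linarith+
    then show ?thesis using eps unfolding \<epsilon>_def by (simp add: field_simps)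
  qed
  define S where "S = closure (Disc \<inter> ball (e1, e2) \<epsilon>)"
  have SE: "S \<subseteq> Disc"
  proof
    fix z assume z: "z \<in> S"
    have "S \<subseteq> cball (e1, e2) \<epsilon>" unfolding S_def by (rule closure_minimal) auto
    moreover have "S \<subseteq> {z. q0 \<le> snd z}" unfolding S_def
      by (rule closure_minimal) (auto simp: Disc_def intro!: closed_Collect_le continuous_intros)
    ultimately have "z \<in> X" using z inX by (cases z) auto
    moreover have "z \<in> closure Disc" using z closure_mono[of "Disc \<inter> ball (e1,e2) \<epsilon>" Disc] by (auto simp: S_def)
    ultimately show "z \<in> Disc" by (rule Disc_limit)
  qed
  have "S \<noteq> {}" using e eps closure_subset by (force simp: S_def)
  moreover have "S \<subseteq> (\<Union>n. closure (A n))"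
  proof
    fix z assume "z \<in> S"
    then obtain n where "z \<in> A n" using SE A_cover by blast
    then show "z \<in> (\<Union>n. closure (A n))" using closure_subset[of "A n"] by blast
  qed
  ultimately obtain n xx \<eta> where x: "xx \<in> S" "\<eta> > 0" "S \<inter> ball xx \<eta> \<subseteq> closure (A n)"
    using Baire_closed_cover[of S A] closed_closure unfolding S_def by blast
  from x(1,2) obtain z0 where z0: "z0 \<in> Disc" "z0 \<in> ball (e1,e2) \<epsilon>" "z0 \<in> ball xx \<eta>"
    unfolding S_def closure_approachable by (auto simp: dist_commute)
  have "open (ball (e1,e2) \<epsilon> \<inter> ball xx \<eta>)" by (intro open_Int open_ball)
  then obtain \<rho> where \<rho>: "\<rho> > 0" "ball z0 \<rho> \<subseteq> ball (e1,e2) \<epsilon> \<inter> ball xx \<eta>"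
    using z0 unfolding open_contains_ball by blast
  define \<delta> where "\<delta> = min (\<rho> / 2) (1 / (2 * (real n + 1)))"
  have box: "(x, y) \<in> ball z0 \<rho>" if "\<bar>x - fst z0\<bar> < \<delta>" "\<bar>y - snd z0\<bar> < \<delta>" for x y
  proof -
    have "dist z0 (x, y) \<le> \<bar>x - fst z0\<bar> + \<bar>y - snd z0\<bar>"
      using sqrt_sum_squares_le_sum_abs[of "x - fst z0" "y - snd z0"]
      by (simp add: dist_prod_def dist_real_def power2_commute[of "fst z0"] power2_commute[of "snd z0"])
    then show ?thesis using that by (auto simp: \<delta>_def)
  qed
  show thesis
  proof (rule that[of z0 \<delta> n])
    show "\<delta> > 0" using \<rho> by (simp add: \<delta>_def)
    show "x < y + d" if "\<bar>x - fst z0\<bar> < \<delta>" "\<bar>y - snd z0\<bar> < \<delta>" "q0 \<le> y" for x y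
      using box[OF that(1,2)] \<rho> inX[of x y] by auto
    show "(x, y) \<in> closure (A n)" if "\<bar>x - fst z0\<bar> < \<delta>" "\<bar>y - snd z0\<bar> < \<delta>" "(x, y) \<in> Disc" for x y
    proof -
      have *: "(x, y) \<in> ball (e1,e2) \<epsilon>" "(x, y) \<in> ball xx \<eta>"
        using box[OF that(1,2)] \<rho>(2) by blast+
      then have "(x, y) \<in> S" 
        unfolding S_def using that(3) by (intro subsetD[OF closure_subset]) simp
      with * x(3) show ?thesis by blast
    qed
  qed (use z0 in \<open>auto simp: \<delta>_def\<close>)
qed

text \<open>The Lipschitz bounds hold on \<open>A n\<close>, which is dense in a portion of
  \<open>Disc\<close>. Separate continuity carries them to all of \<open>Disc\<close> there,
  continuity off \<open>Disc\<close> carries them to horizontal neighbours, and the flow carries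
  them to all nearby points. So \<open>F\<close> is continuous on the portion, although every point
  of \<open>Disc\<close> is a limit of discontinuities.\<close>

lemma Disc_empty: "Disc = {}"
proof (rule ccontr)
  assume "Disc \<noteq> {}"
  then obtain z0 n \<delta> where z0: "z0 \<in> Disc" and \<delta>: "\<delta> > 0" "\<delta> \<le> 1 / (2 * (real n + 1))"
    and box: "\<And>x y. \<bar>x - fst z0\<bar> < \<delta> \<Longrightarrow> \<bar>y - snd z0\<bar> < \<delta> \<Longrightarrow> q0 \<le> y \<Longrightarrow> x < y + d"
    and dense: "\<And>x y. \<bar>x - fst z0\<bar> < \<delta> \<Longrightarrow> \<bar>y - snd z0\<bar> < \<delta> \<Longrightarrow> (x, y) \<in> Disc \<Longrightarrow> (x, y) \<in> closure (A n)"
    by (rule portion) blast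
  define Q where "Q = {(x, y). \<bar>x - fst z0\<bar> < \<delta> \<and> \<bar>y - snd z0\<bar> < \<delta>}"
  define N where "N = real n + 1"
  have N: "N > 0" "2 * \<delta> \<le> 1 / N" using \<delta> by (auto simp: N_def field_simps)
  have Q_iff: "(x, y) \<in> Q \<longleftrightarrow> \<bar>x - fst z0\<bar> < \<delta> \<and> \<bar>y - snd z0\<bar> < \<delta>" for x y
    by (simp add: Q_def)
  have openQ: "open Q"
  proof -
    have "Q = {z. \<bar>fst z - fst z0\<bar> < \<delta>} \<inter> {z. \<bar>snd z - snd z0\<bar> < \<delta>}" by (auto simp: Q_def)
    then show ?thesis by (auto intro!: open_Int open_Collect_less continuous_intros)
  qed
  have boxQ: "x < y + d" if "(x, y) \<in> Q" "q0 \<le> y" for x y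
    using box that by (auto simp: Q_iff)
  have EX: "q0 \<le> y" "x < y + d" if "(x, y) \<in> Disc" for x y using that by (auto simp: Disc_def)
  have AE: "z \<in> Disc" if "z \<in> A n" for z using that by (auto simp: A_def)
  have Ah: "\<bar>F (x', y) - F (x, y)\<bar> \<le> N * \<bar>x' - x\<bar>"
    if "(x, y) \<in> A n" "(x, y) \<in> Q" "(x', y) \<in> Q" for x y x'
  proof -
    have "\<bar>x' - x\<bar> < 2 * \<delta>" using that(2,3) by (auto simp: Q_iff)
    then have "\<bar>x' - x\<bar> \<le> 1 / N" using N by linarith
    moreover have "x' < y + d" using boxQ that(3) EX(1)[OF AE[OF that(1)]] by blast
    ultimately show ?thesis using that(1) by (simp add: A_def N_def)
  qed
  have Av: "\<bar>F (x, y') - F (x, y)\<bar> \<le> N * \<bar>y' - y\<bar>"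
    if "(x, y) \<in> A n" "(x, y) \<in> Q" "(x, y') \<in> Q" "q0 \<le> y'" for x y y'
  proof -
    have "\<bar>y' - y\<bar> < 2 * \<delta>" using that(2,3) by (auto simp: Q_iff)
    then have "\<bar>y' - y\<bar> \<le> 1 / N" using N by linarith
    moreover have "x < y' + d" using boxQ that(3,4) by blast
    ultimately show ?thesis using that(1,4) by (simp add: A_def N_def)
  qed
  \<comment> \<open>The corner \<open>(x', y)\<close> need not belong to \<open>A n\<close>: it is
    reached horizontally from one of the two points and vertically from the other.\<close>
  have a: "\<bar>F (x, y) - F (x', y')\<bar> \<le> N * (\<bar>x - x'\<bar> + \<bar>y - y'\<bar>)"
    if "(x, y) \<in> A n" "(x', y') \<in> A n" "(x, y) \<in> Q" "(x', y') \<in> Q" for x y x' y'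
  proof -
    have c: "(x', y) \<in> Q" using that by (auto simp: Q_iff)
    have "\<bar>F (x', y) - F (x, y)\<bar> \<le> N * \<bar>x' - x\<bar>" by (rule Ah) (use that c in auto)
    moreover have "\<bar>F (x', y) - F (x', y')\<bar> \<le> N * \<bar>y - y'\<bar>"
      by (rule Av) (use that c EX(1)[OF AE[OF that(1)]] in auto)
    ultimately have "\<bar>F (x, y) - F (x', y')\<bar> \<le> N * \<bar>x - x'\<bar> + N * \<bar>y - y'\<bar>"
      unfolding abs_minus_commute[of x' x] by linarith
    then show ?thesis by (simp add: distrib_left)
  qed
  \<comment> \<open>\<open>F\<close> is not known to be continuous along \<open>w\<close>. The value
    at \<open>(x, snd (w k))\<close> mediates: it is close to \<open>F (w k)\<close> by the uniform
    horizontal bound at \<open>w k\<close>, and it tends to \<open>F (x, y)\<close> by continuity on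
    the vertical line.\<close>
  have approx: "\<exists>w. (\<forall>k. w k \<in> A n \<inter> Q) \<and> w \<longlonglongrightarrow> (x, y) \<and> (\<lambda>k. F (w k)) \<longlonglongrightarrow> F (x, y)"
    if e: "(x, y) \<in> Disc" "(x, y) \<in> Q" for x y
  proof -
    have "(x, y) \<in> closure (A n)" using dense e by (auto simp: Q_iff)
    then have "(x, y) \<in> closure (A n \<inter> Q)"
      using open_Int_closure_subset[OF openQ, of "A n"] e(2) by (auto simp: Int_commute)
    then obtain w where w: "\<And>k. w k \<in> A n \<inter> Q" "w \<longlonglongrightarrow> (x, y)"
      unfolding closure_sequential by blast
    have w1: "(\<lambda>k. fst (w k)) \<longlonglongrightarrow> x" and w2: "(\<lambda>k. snd (w k)) \<longlonglongrightarrow> y"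
      using tendsto_fst[OF w(2)] tendsto_snd[OF w(2)] by auto
    have wA: "(fst (w k), snd (w k)) \<in> A n" "(fst (w k), snd (w k)) \<in> Q" for k
      using w(1)[of k] by auto
    have "continuous (at y within {q0..}) (\<lambda>t. F (x, t))"
      using hy[of y x] EX[OF e(1)] by (auto intro: DERIV_continuous)
    then have v: "(\<lambda>k. F (x, snd (w k))) \<longlonglongrightarrow> F (x, y)"
      by (rule continuous_within_tendsto_compose'[OF _ _ w2]) (use EX(1)[OF AE[OF wA(1)]] in simp)
    have "(\<lambda>k. F (w k) - F (x, snd (w k))) \<longlonglongrightarrow> 0"
    proof (rule Lim_null_comparison)
      show "\<forall>\<^sub>F k in sequentially. norm (F (w k) - F (x, snd (w k))) \<le> N * \<bar>x - fst (w k)\<bar>"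
      proof (rule always_eventually, rule allI)
        fix k
        have "(x, snd (w k)) \<in> Q" using e(2) wA(2)[of k] by (simp add: Q_def mem_Times_iff)
        from Ah[OF wA this] show "norm (F (w k) - F (x, snd (w k))) \<le> N * \<bar>x - fst (w k)\<bar>"
          by (simp add: abs_minus_commute)
      qed
      have "(\<lambda>k. N * \<bar>x - fst (w k)\<bar>) \<longlonglongrightarrow> N * \<bar>x - x\<bar>" by (intro tendsto_intros w1)
      then show "(\<lambda>k. N * \<bar>x - fst (w k)\<bar>) \<longlonglongrightarrow> 0" by simp
    qed
    from tendsto_add[OF this v] have "(\<lambda>k. F (w k)) \<longlonglongrightarrow> F (x, y)" by simp
    with w show ?thesis by blast
  qed
  have b: "\<bar>F (x, y) - F (x', y')\<bar> \<le> N * (\<bar>x - x'\<bar> + \<bar>y - y'\<bar>)"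
    if e: "(x, y) \<in> Disc" "(x', y') \<in> Disc" "(x, y) \<in> Q" "(x', y') \<in> Q" for x y x' y'
  proof -
    obtain w where w: "\<And>k. w k \<in> A n \<inter> Q" "w \<longlonglongrightarrow> (x, y)" "(\<lambda>k. F (w k)) \<longlonglongrightarrow> F (x, y)"
      using approx e by blast
    obtain w' where w': "\<And>k. w' k \<in> A n \<inter> Q" "w' \<longlonglongrightarrow> (x', y')" "(\<lambda>k. F (w' k)) \<longlonglongrightarrow> F (x', y')"
      using approx e by blast
    have l1: "(\<lambda>k. \<bar>F (w k) - F (w' k)\<bar>) \<longlonglongrightarrow> \<bar>F (x, y) - F (x', y')\<bar>"
      by (intro tendsto_intros w w')
    have l2: "(\<lambda>k. N * (\<bar>fst (w k) - fst (w' k)\<bar> + \<bar>snd (w k) - snd (w' k)\<bar>))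
        \<longlonglongrightarrow> N * (\<bar>fst (x, y) - fst (x', y')\<bar> + \<bar>snd (x, y) - snd (x', y')\<bar>)"
      by (intro tendsto_intros w w')
    have "\<bar>F (w k) - F (w' k)\<bar> \<le> N * (\<bar>fst (w k) - fst (w' k)\<bar> + \<bar>snd (w k) - snd (w' k)\<bar>)" for k
      using a[of "fst (w k)" "snd (w k)" "fst (w' k)" "snd (w' k)"] w(1)[of k] w'(1)[of k] by simp
    with LIMSEQ_le[OF l1 l2] show ?thesis by simp
  qed
  have c: "\<bar>F (x', y) - F (x, y)\<bar> \<le> N * \<bar>x' - x\<bar>"
    if e: "(x, y) \<in> Disc" "(x, y) \<in> Q" "(x', y) \<in> Q" for x y x'
  proof (cases "(x', y) \<in> Disc")
    case True
    with b[of x' y x y] e show ?thesis by simp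
  next
    case False
    obtain w where w: "\<And>k. w k \<in> A n \<inter> Q" "w \<longlonglongrightarrow> (x, y)" "(\<lambda>k. F (w k)) \<longlonglongrightarrow> F (x, y)"
      using approx e by blast
    \<comment> \<open>The approximating points are shifted horizontally by \<open>x' - x\<close>;
      they then tend to \<open>(x', y)\<close>, a point of continuity because it lies outside
      \<open>Disc\<close>.\<close>
    define w' where "w' k = (fst (w k) + (x' - x), snd (w k))" for k
    have wA: "(fst (w k), snd (w k)) \<in> A n" "(fst (w k), snd (w k)) \<in> Q" for k
      using w(1)[of k] by auto
    have "w' \<longlonglongrightarrow> (fst (x, y) + (x' - x), snd (x, y))" unfolding w'_def by (intro tendsto_intros w)
    then have w': "w' \<longlonglongrightarrow> (x', y)" by simp
    have evQ: "\<forall>\<^sub>F k in sequentially. w' k \<in> Q"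
      using w' openQ e(3) by (rule topological_tendstoD)
    have "(x', y) \<in> X" using EX(1)[OF e(1)] boxQ[OF e(3)] by simp
    then have cont: "continuous (at (x', y) within X) F" using False not_Disc_continuous by blast
    have evX: "\<forall>\<^sub>F k in sequentially. w' k \<in> X"
      using evQ
    proof eventually_elim
      case (elim k)
      have "q0 \<le> snd (w k)" using EX(1)[OF AE[OF wA(1)]] .
      then show ?case using elim boxQ by (auto simp: w'_def)
    qed
    have F': "(\<lambda>k. F (w' k)) \<longlonglongrightarrow> F (x', y)"
      by (rule continuous_within_tendsto_compose[OF cont evX w'])
    have l1: "(\<lambda>k. \<bar>F (w' k) - F (w k)\<bar>) \<longlonglongrightarrow> \<bar>F (x', y) - F (x, y)\<bar>"
      by (intro tendsto_intros w F')
    have "\<forall>\<^sub>F k in sequentially. \<bar>F (w' k) - F (w k)\<bar> \<le> N * \<bar>x' - x\<bar>"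
      using evQ
    proof eventually_elim
      case (elim k)
      then show ?case using Ah[OF wA[of k], of "fst (w k) + (x' - x)"] by (simp add: w'_def)
    qed
    with l1 show ?thesis by (intro tendsto_upperbound[OF l1]) auto
  qed
  txt \<open>A horizontal segment around \<open>(a, b)\<close>, wide enough to matter, is moved along the flow towards the
    level \<open>y\<close> until it first meets \<open>Disc\<close>, at the scaling factor \<open>v\<close>. Until then \<open>F\<close> is
    continuous, so \<open>flow_increment_limit\<close> compares \<open>(a, b)\<close> with \<open>(v a, v b)\<close>; that point lies
    on a horizontal line through a point of \<open>Disc\<close>, where \<open>F\<close> is Lipschitz.\<close>
  have d: "\<exists>C r0. r0 > 0 \<and> (\<forall>a b. (a, b) \<in> X \<longrightarrow> \<bar>a - x\<bar> + \<bar>b - y\<bar> < r0 \<longrightarrow>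
      \<bar>F (a, b) - F (x, y)\<bar> \<le> C * (\<bar>a - x\<bar> + \<bar>b - y\<bar>))"
    if e: "(x, y) \<in> Disc" "(x, y) \<in> Q" for x y
  proof -
    \<comment> \<open>During the motion \<open>|v - 1| \<le> \<rho> / q0\<close> and
      \<open>|v| \<le> 3/2\<close>, so the horizontal distance from \<open>x\<close> is at most
      \<open>((|x| + 1) / q0 + 3/2 + 1) \<rho>\<close>, which is below
      \<open>L \<rho>\<close>.\<close>
    define L where "L = (\<bar>x\<bar> + 1) / q0 + 3"
    define \<gamma> where "\<gamma> = \<delta> - max \<bar>x - fst z0\<bar> \<bar>y - snd z0\<bar>"
    have \<gamma>: "\<gamma> > 0" using e(2) by (auto simp: \<gamma>_def Q_iff)
    have L: "L \<ge> 3" using q0 by (simp add: L_def)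
    define r0 where "r0 = min (min 1 (q0 / 2)) (\<gamma> / L)"
    have r0: "r0 > 0" "r0 \<le> 1" "r0 \<le> q0 / 2" "r0 * L \<le> \<gamma>"
  proof -
      have "r0 \<le> \<gamma> / L" by (simp add: r0_def)
      then show "r0 * L \<le> \<gamma>" using L by (simp add: field_simps)
      have "r0 \<le> min 1 (q0 / 2)" by (simp only: r0_def min.cobounded1)
      then show "r0 \<le> 1" "r0 \<le> q0 / 2" by simp_all
    qed (use q0 \<gamma> L in \<open>auto simp: r0_def\<close>)
    have yq: "y \<ge> q0" using EX(1)[OF e(1)] .
    have "\<bar>F (a, b) - F (x, y)\<bar> \<le> (2 * M / q0 + N * (3 * L + 1)) * (\<bar>a - x\<bar> + \<bar>b - y\<bar>)"
      if abX: "(a, b) \<in> X" and ab: "\<bar>a - x\<bar> + \<bar>b - y\<bar> < r0" for a b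
    proof (cases "(a, b) = (x, y)")
      case True then show ?thesis by simp
    next
      case False
      define \<rho> where "\<rho> = \<bar>a - x\<bar> + \<bar>b - y\<bar>"
      have \<rho>: "\<rho> > 0" "\<rho> < r0" using False ab by (auto simp: \<rho>_def)
      have bq: "b \<ge> q0" using abX by simp
      have b0: "b > 0" using bq q0 by simp
      define v1 where "v1 = y / b"
      have v1b: "v1 * b = y" using b0 by (simp add: v1_def)
      define K where "K = closed_segment 1 v1"
      have lev: "q0 \<le> v * b" "\<bar>v * b - y\<bar> \<le> \<rho>" "\<bar>v - 1\<bar> \<le> \<rho> / q0" if "v \<in> K" for v
      proof -
        have "v * b \<in> closed_segment b y"
          using that b0 by (auto simp: K_def v1_def closed_segment_eq_real_ivl field_simps split: if_splits)
        then have vb: "q0 \<le> v * b" "\<bar>v * b - y\<bar> \<le> \<bar>b - y\<bar>" "\<bar>v * b - b\<bar> \<le> \<bar>b - y\<bar>"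
          using bq yq by (auto simp: closed_segment_eq_real_ivl split: if_splits)
        show "q0 \<le> v * b" "\<bar>v * b - y\<bar> \<le> \<rho>" using vb by (auto simp: \<rho>_def)
        have "\<bar>v - 1\<bar> * b = \<bar>v * b - b\<bar>" using b0 abs_mult[of "v - 1" b] by (simp add: left_diff_distrib)
        also have "\<dots> \<le> \<rho>" using vb by (simp add: \<rho>_def)
        finally have "\<bar>v - 1\<bar> * b \<le> \<rho>" .
        moreover have "\<bar>v - 1\<bar> * q0 \<le> \<bar>v - 1\<bar> * b" using bq by (intro mult_left_mono) auto
        ultimately show "\<bar>v - 1\<bar> \<le> \<rho> / q0" using q0 by (simp add: field_simps)
      qed
      have half: "\<rho> / q0 \<le> 1 / 2" using \<rho> r0 q0 by (simp add: field_simps)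
      have near: "\<bar>v * (a + u) - x\<bar> \<le> L * \<rho>" if v: "v \<in> K" and u: "\<bar>u\<bar> \<le> \<rho>" for v u
      proof -
        have v2: "\<bar>v\<bar> \<le> 3 / 2" using lev(3)[OF v] half by linarith
        have "\<bar>a\<bar> \<le> \<bar>x\<bar> + 1" using \<rho> r0 by (auto simp: \<rho>_def)
        then have "\<bar>v - 1\<bar> * \<bar>a\<bar> \<le> (\<rho> / q0) * (\<bar>x\<bar> + 1)"
          using lev(3)[OF v] \<rho> q0 by (intro mult_mono) auto
        moreover have "\<bar>v\<bar> * \<bar>u\<bar> \<le> (3/2) * \<rho>" using v2 u by (intro mult_mono) auto
        moreover have "v * (a + u) - x = (v - 1) * a + v * u + (a - x)" by (simp add: algebra_simps)
        then have "\<bar>v * (a + u) - x\<bar> \<le> \<bar>v - 1\<bar> * \<bar>a\<bar> + \<bar>v\<bar> * \<bar>u\<bar> + \<bar>a - x\<bar>"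
          by (metis (no_types, lifting) abs_mult abs_triangle_ineq add_mono_thms_linordered_semiring(3) order_trans)
        moreover have "\<bar>a - x\<bar> \<le> \<rho>" by (simp add: \<rho>_def)
        ultimately show ?thesis using \<rho> unfolding L_def by (simp add: algebra_simps add_divide_distrib)
      qed
      have inQ: "(x', y') \<in> Q" if "\<bar>x' - x\<bar> \<le> L * \<rho>" "\<bar>y' - y\<bar> \<le> \<rho>" for x' y'
      proof -
        have "L * \<rho> < L * r0" using \<rho> L by simp
        then have 1: "L * \<rho> < \<gamma>" using r0(4) by (simp add: mult.commute)
        have "\<rho> \<le> L * \<rho>" using L \<rho> by simp
        then show ?thesis using 1 that unfolding Q_iff \<gamma>_def by linarith
      qed
      have inX: "(v * (a + u), v * b) \<in> Q \<and> (v * (a + u), v * b) \<in> X" if v: "v \<in> K" and u: "\<bar>u\<bar> \<le> \<rho>" for v u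
        using inQ[OF near[OF v u] lev(2)[OF v]] boxQ lev(1)[OF v] by simp
      \<comment> \<open>The factor \<open>v1\<close> is a fallback: if the segment meets
        \<open>Disc\<close> nowhere, the motion stops at the level \<open>y\<close>, where
        \<open>(x, y)\<close> itself lies in \<open>Disc\<close>.\<close>
      define T0 where "T0 = insert v1 (fst ` {z \<in> K \<times> {-\<rho>..\<rho>}. (fst z * (a + snd z), fst z * b) \<in> Disc})"
      have T0K: "T0 \<subseteq> K" by (auto simp: T0_def K_def)
      have "closed T0"
      proof -
        have eq: "{z \<in> K \<times> {-\<rho>..\<rho>}. (fst z * (a + snd z), fst z * b) \<in> Disc}
           = (K \<times> {-\<rho>..\<rho>}) \<inter> ((\<lambda>z. (fst z * (a + snd z), fst z * b)) -` closure Disc)"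
        proof (rule set_eqI)
          fix z :: "real \<times> real"
          have "(fst z * (a + snd z), fst z * b) \<in> X" if "z \<in> K \<times> {-\<rho>..\<rho>}"
            using inX[of "fst z" "snd z"] that by (cases z) (simp add: abs_le_iff)
          then show "z \<in> {z \<in> K \<times> {-\<rho>..\<rho>}. (fst z * (a + snd z), fst z * b) \<in> Disc} \<longleftrightarrow>
              z \<in> (K \<times> {-\<rho>..\<rho>}) \<inter> ((\<lambda>z. (fst z * (a + snd z), fst z * b)) -` closure Disc)"
            using Disc_limit closure_subset[of Disc] by blast
        qed
        have "closed ((\<lambda>z::real\<times>real. (fst z * (a + snd z), fst z * b)) -` closure Disc)"
          by (intro closed_vimage continuous_intros) auto
        then have "compact ((K \<times> {-\<rho>..\<rho>}) \<inter> ((\<lambda>z. (fst z * (a + snd z), fst z * b)) -` closure Disc))"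
          by (intro compact_Int_closed compact_Times) (auto simp: K_def)
        then have "compact (fst ` {z \<in> K \<times> {-\<rho>..\<rho>}. (fst z * (a + snd z), fst z * b) \<in> Disc})"
          unfolding eq by (intro compact_continuous_image continuous_intros)
        then show ?thesis unfolding T0_def by (intro closed_insert compact_imp_closed)
      qed
      then obtain v where v: "v \<in> T0" "\<And>t. t \<in> T0 \<Longrightarrow> dist 1 v \<le> dist 1 t"
        using distance_attains_inf[of T0 1] unfolding T0_def by blast
      have vK: "v \<in> K" using v(1) T0K by blast
      have v0: "v \<ge> 1/2" using lev(3)[OF vK] half by linarith
      have step1: "\<bar>F (v * a, v * b) - F (a, b)\<bar> \<le> M * \<bar>ln v\<bar>"
      proof (rule flow_increment_limit[OF bq lev(1)[OF vK] _ \<rho>(1) abX])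
        show "v > 0" using v0 by simp
        show "(v * a, v * b) \<in> X" using inX[OF vK, of 0] \<rho> by simp
        fix t u assume t: "t \<in> closed_segment 1 v" "t \<noteq> v" and u: "\<bar>u\<bar> \<le> \<rho>"
        have tK: "t \<in> K"
          using t vK unfolding K_def by (auto simp: closed_segment_eq_real_ivl split: if_splits)
        have "dist 1 t < dist 1 v"
          using t by (auto simp: dist_real_def closed_segment_eq_real_ivl split: if_splits)
        then have "t \<notin> T0" using v(2)[of t] by auto
        have "(t * (a + u), t * b) \<notin> Disc"
        proof
          assume "(t * (a + u), t * b) \<in> Disc"
          then have "(t, u) \<in> {z \<in> K \<times> {-\<rho>..\<rho>}. (fst z * (a + snd z), fst z * b) \<in> Disc}"
            using tK u by (auto simp: abs_le_iff)
          then have "t \<in> T0" unfolding T0_def by (metis (no_types, lifting) fst_conv image_eqI insertI2)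
          with \<open>t \<notin> T0\<close> show False ..
        qed
        with inX[OF tK u] show "(t * (a + u), t * b) \<in> X \<and> continuous (at (t * (a + u), t * b) within X) F"
          using not_Disc_continuous by blast
      qed
      have "\<exists>x'. (x', v * b) \<in> Disc \<and> \<bar>x' - x\<bar> \<le> L * \<rho>"
      proof (cases "v = v1")
        case True
        then show ?thesis using v1b e(1) L \<rho> by (intro exI[of _ x]) auto
      next
        case False
        with v(1) obtain u where "u \<in> {-\<rho>..\<rho>}" "(v * (a + u), v * b) \<in> Disc"
          unfolding T0_def by auto
        then have "\<bar>u\<bar> \<le> \<rho>" "(v * (a + u), v * b) \<in> Disc" by auto
        then show ?thesis using near[OF vK] by blast
      qed
      then obtain x' where x': "(x', v * b) \<in> Disc" "\<bar>x' - x\<bar> \<le> L * \<rho>" by blast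
      have x'Q: "(x', v * b) \<in> Q" using inQ[OF x'(2) lev(2)[OF vK]] .
      have vaQ: "(v * a, v * b) \<in> Q" "\<bar>v * a - x\<bar> \<le> L * \<rho>" 
        using inX[OF vK, of 0] near[OF vK, of 0] \<rho> by auto
      have "\<bar>F (v * a, v * b) - F (x', v * b)\<bar> \<le> N * \<bar>v * a - x'\<bar>"
        by (rule c[OF x'(1) x'Q vaQ(1)])
      also have "\<dots> \<le> N * (2 * L * \<rho>)"
        using vaQ(2) x'(2) N by (intro mult_left_mono) auto
      finally have step2: "\<bar>F (v * a, v * b) - F (x', v * b)\<bar> \<le> N * (2 * L * \<rho>)" .
      have "\<bar>F (x', v * b) - F (x, y)\<bar> \<le> N * (\<bar>x' - x\<bar> + \<bar>v * b - y\<bar>)"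
        by (rule b[OF x'(1) e(1) x'Q e(2)])
      also have "\<dots> \<le> N * (L * \<rho> + \<rho>)"
        using x'(2) lev(2)[OF vK] N by (intro mult_left_mono add_mono) auto
      finally have step3: "\<bar>F (x', v * b) - F (x, y)\<bar> \<le> N * (L * \<rho> + \<rho>)" .
      have "\<bar>ln v\<bar> \<le> 2 * \<bar>v - 1\<bar>"
      proof -
        have "ln v \<le> v - 1" using v0 by (intro ln_le_minus_one) auto
        moreover have "ln (1/v) \<le> 1/v - 1" using v0 by (intro ln_le_minus_one) auto
        then have "- ln v \<le> (1 - v) / v" using v0 by (simp add: ln_div diff_divide_distrib)
        moreover have "(1 - v) / v \<le> 2 * \<bar>1 - v\<bar>"
          using v0 mult_right_mono[of "1" "2 * v" "\<bar>1 - v\<bar>"] by (simp add: field_simps)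
        ultimately have "- ln v \<le> 2 * \<bar>v - 1\<bar>" "ln v \<le> \<bar>v - 1\<bar>"
          unfolding abs_minus_commute[of 1 v] by (blast intro: order_trans, linarith)
        then show ?thesis using abs_ge_zero[of "v - 1"] by (intro abs_leI) auto
      qed
      also have "\<dots> \<le> 2 * (\<rho> / q0)" using lev(3)[OF vK] by simp
      finally have "M * \<bar>ln v\<bar> \<le> M * (2 * (\<rho> / q0))" using M by (intro mult_left_mono)
      with step1 step2 step3
      have "\<bar>F (a, b) - F (x, y)\<bar> \<le> M * (2 * (\<rho> / q0)) + N * (2 * L * \<rho>) + N * (L * \<rho> + \<rho>)"
        by linarith
      also have "\<dots> = (2 * M / q0 + N * (3 * L + 1)) * \<rho>" by (simp add: algebra_simps)
      finally show ?thesis by (simp add: \<rho>_def)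
    qed
    with r0(1) show ?thesis by blast
  qed
  have contE: "continuous (at (x, y) within X) F" if e: "(x, y) \<in> Disc" "(x, y) \<in> Q" for x y
  proof -
    from d[OF e] obtain C r0 where r0: "r0 > 0"
      and C: "\<And>a b. (a, b) \<in> X \<Longrightarrow> \<bar>a - x\<bar> + \<bar>b - y\<bar> < r0 \<Longrightarrow> \<bar>F (a, b) - F (x, y)\<bar> \<le> C * (\<bar>a - x\<bar> + \<bar>b - y\<bar>)"
      by blast
    define D where "D z = \<bar>fst z - x\<bar> + \<bar>snd z - y\<bar>" for z :: "real \<times> real"
    have lim: "(D \<longlongrightarrow> \<bar>fst (x, y) - x\<bar> + \<bar>snd (x, y) - y\<bar>) (at (x, y) within X)"
      unfolding D_def by (intro tendsto_intros)
    then have D0: "(D \<longlongrightarrow> 0) (at (x, y) within X)" by simp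
    have "((\<lambda>z. F z - F (x, y)) \<longlongrightarrow> 0) (at (x, y) within X)"
    proof (rule Lim_null_comparison)
      have "\<forall>\<^sub>F z in at (x, y) within X. D z < r0" using D0 r0 by (rule order_tendstoD)
      moreover have "\<forall>\<^sub>F z in at (x, y) within X. z \<in> X" by (simp add: eventually_at_filter)
      ultimately show "\<forall>\<^sub>F z in at (x, y) within X. norm (F z - F (x, y)) \<le> C * D z"
      proof eventually_elim
        case (elim z)
        then show ?case using C[of "fst z" "snd z"] by (simp add: D_def)
      qed
      show "((\<lambda>z. C * D z) \<longlongrightarrow> 0) (at (x, y) within X)"
        using tendsto_mult_right_zero[OF D0] .
    qed
    then show ?thesis unfolding continuous_within by (simp add: LIM_zero_iff)
  qed
  from Disc_D[OF z0 \<delta>(1)] obtain z' where z': "z' \<in> X" "dist z' z0 < \<delta>" "\<not> continuous (at z' within X) F"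
    by blast
  have "(fst z', snd z') \<in> Q" unfolding Q_iff
    using z'(2) dist_fst_le[of z' z0] dist_snd_le[of z' z0] by (auto simp: dist_real_def)
  with z' not_Disc_continuous contE[of "fst z'" "snd z'"] show False by (cases "z' \<in> Disc") auto
qed

lemma continuous_on_X: "continuous_on X F"
  unfolding continuous_on_eq_continuous_within using not_Disc_continuous Disc_empty by blast

lemma bound_near_diagonal:
  assumes diag: "\<And>y. q0 \<le> y \<Longrightarrow> F (y + d, y) = 0"
    and hyd: "\<And>y. q0 \<le> y \<Longrightarrow> continuous (at y within {y..}) (\<lambda>t. F (y + d, t))"
    and ab: "q0 \<le> b" "b < a" "a < b + d"
  shows "\<bar>F (a, b)\<bar> \<le> M * ln (d / (a - b))"
proof -
  define v where "v = d / (a - b)"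
  have v: "v > 1" and va: "v * a = v * b + d" using ab by (auto simp: v_def field_simps)
  have b0: "b > 0" using ab q0 by simp
  have vb: "q0 \<le> v * b" using v ab b0 mult_right_mono[of 1 v b] by linarith
  \<comment> \<open>With \<open>t\<close> slightly above \<open>v\<close> and the start moved to
    \<open>v a / t\<close>, the end \<open>(v a, t b)\<close> lies strictly inside
    \<open>X\<close>.\<close>
  have le: "\<forall>\<^sub>F t in at_right v. \<bar>F (v * a, t * b) - F (v * a / t, b)\<bar> \<le> M * ln t"
    using eventually_at_right_less[of v]
  proof eventually_elim
    case (elim t)
    have t1: "t > 1" using elim v by simp
    define \<eta> where "\<eta> = (d / t - (v * a / t - b)) / 2"
    have "t * b > v * b" using elim b0 by simp
    then have eta: "\<eta> > 0" unfolding \<eta>_def using t1 va by (simp add: field_simps)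
    have "\<bar>F (t * (v * a / t), t * b) - F (v * a / t, b)\<bar> \<le> M * ln t"
    proof (rule flow_increment[OF ab(1) _ eta _ order_refl continuous_on_X])
      show "1 \<le> t" using t1 by simp
      fix w u assume w: "1 \<le> w" "w \<le> t" and u: "\<bar>u\<bar> \<le> \<eta>"
      have "u < 2 * \<eta>" using u eta by linarith
      moreover have "\<eta> + \<eta> = d / t - (v * a / t - b)"
        unfolding \<eta>_def by (rule field_sum_of_halves)
      ultimately have "v * a / t + u - b < d / t" by linarith
      also have "d / t \<le> d / w" using w ab t1 by (intro divide_left_mono) auto
      finally have "w * (v * a / t + u - b) < w * (d / w)" using w by (intro mult_strict_left_mono) auto
      then have "w * (v * a / t + u) < w * b + d" using w by (simp add: algebra_simps)
      moreover have "q0 \<le> w * b" using w(1) ab(1) b0 mult_right_mono[of 1 w b] by linarith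
      ultimately show "(w * (v * a / t + u), w * b) \<in> X" by simp
    qed
    then show ?case using t1 by simp
  qed
  have l1: "((\<lambda>t. F (v * a, t * b)) \<longlongrightarrow> 0) (at_right v)"
  proof -
    have c: "((\<lambda>t. F (v * b + d, t)) \<longlongrightarrow> 0) (at (v * b) within {v * b..})"
      using hyd[OF vb] diag[OF vb] by (simp add: continuous_within)
    have "filterlim (\<lambda>t. t * b) (at (v * b) within {v * b..}) (at_right v)"
      unfolding filterlim_at
    proof
      show "\<forall>\<^sub>F t in at_right v. t * b \<in> {v * b..} \<and> t * b \<noteq> v * b"
        using eventually_at_right_less[of v] by eventually_elim (use b0 in auto)
      show "((\<lambda>t. t * b) \<longlongrightarrow> v * b) (at_right v)" by (intro tendsto_intros)
    qed
    from filterlim_compose[OF c this] show ?thesis by (simp add: va)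
  qed
  have l2: "((\<lambda>t. F (v * a / t, b)) \<longlongrightarrow> F (a, b)) (at_right v)"
  proof -
    have "isCont (\<lambda>t. F (t, b)) a" using hx[of b a] ab by (auto intro: DERIV_isCont)
    moreover have "((\<lambda>t. v * a / t) \<longlongrightarrow> v * a / v) (at_right v)" using v by (intro tendsto_intros) auto
    ultimately show ?thesis using isCont_tendsto_compose[of a "\<lambda>t. F (t, b)" "\<lambda>t. v * a / t" "at_right v"] v by simp
  qed
  have l3: "((\<lambda>t. M * ln t) \<longlongrightarrow> M * ln v) (at_right v)" using v by (intro tendsto_intros) auto
  have "\<bar>0 - F (a, b)\<bar> \<le> M * ln v"
    by (rule tendsto_le[OF _ l3 _ le]) (simp, intro tendsto_intros l1 l2)
  then show ?thesis by (simp add: v_def)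
qed

end

section \<open>Uniqueness by the maximum principle\<close>

text \<open>\<open>I\<close> stands for the integral term belonging to the difference
  \<open>w\<close> of two solutions. Only its bounds by \<open>\<rho> m\<close> are kept: in the
  application the kernel has mass \<open>\<rho>\<close>, and \<open>w\<close> vanishes below the
  edge \<open>y = q0\<close>, which is why \<open>m \<ge> 0\<close> is asked for. The strict
  inequality \<open>\<rho> < \<kappa>\<close> comes from the discount rate.\<close>

locale separate_ide =
  fixes w D1 D2 I :: "real \<times> real \<Rightarrow> real" and q0 d \<kappa> \<rho> B :: real
  assumes q0: "q0 > 0" and d: "d > 0" and rho: "0 \<le> \<rho>" "\<rho> < \<kappa>"
    and dx: "\<And>x y. q0 \<le> y \<Longrightarrow> x \<le> y + d \<Longrightarrow> ((\<lambda>t. w (t, y)) has_real_derivative D1 (x, y)) (at x within {..y + d})"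
    and dy: "\<And>x y. q0 \<le> y \<Longrightarrow> x \<le> y + d \<Longrightarrow>
               ((\<lambda>t. w (x, t)) has_real_derivative D2 (x, y)) (at y within {max q0 (x - d)..})"
    and eq: "\<And>x y. q0 \<le> y \<Longrightarrow> x \<le> y + d \<Longrightarrow> x * D1 (x, y) + y * D2 (x, y) = \<kappa> * w (x, y) - I (x, y)"
    and I: "\<And>x y m. q0 \<le> y \<Longrightarrow> x \<le> y + d \<Longrightarrow> (\<And>x y. q0 \<le> y \<Longrightarrow> x \<le> y + d \<Longrightarrow> w (x, y) \<le> m) \<Longrightarrow> m \<ge> 0 \<Longrightarrow>
               I (x, y) \<le> \<rho> * m"
    and I': "\<And>x y m. q0 \<le> y \<Longrightarrow> x \<le> y + d \<Longrightarrow> (\<And>x y. q0 \<le> y \<Longrightarrow> x \<le> y + d \<Longrightarrow> - m \<le> w (x, y)) \<Longrightarrow> m \<ge> 0 \<Longrightarrow>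
               - (\<rho> * m) \<le> I (x, y)"
    and B: "\<And>x y. q0 \<le> y \<Longrightarrow> x \<le> y + d \<Longrightarrow> \<bar>w (x, y)\<bar> \<le> B"
    and diag: "\<And>y. q0 \<le> y \<Longrightarrow> w (y + d, y) = 0"
begin

lemma within_x: "x < y + d \<Longrightarrow> at x within {..y + d} = at x" for x y :: real
  by (intro at_within_interior) simp

lemma within_y: "x < y + d \<Longrightarrow> at y within {max q0 (x - d)..} = at y within {q0..}"
  by (rule at_within_nhd[of _ "{x - d<..}"]) auto

lemma B0: "B \<ge> 0"
  using B[of q0 q0] d by auto

lemma flow_pde: "flow_pde w D1 D2 q0 d ((\<kappa> + \<rho>) * B)"
proof
  show "0 < q0" by (fact q0)
  show "0 \<le> (\<kappa> + \<rho>) * B" using B0 rho by simp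
  fix x y :: real assume xy: "q0 \<le> y" "x < y + d"
  then have xy': "q0 \<le> y" "x \<le> y + d" by auto
  show "((\<lambda>t. w (t, y)) has_real_derivative D1 (x, y)) (at x)"
    using dx[OF xy'] within_x[OF xy(2)] by simp
  show "((\<lambda>t. w (x, t)) has_real_derivative D2 (x, y)) (at y within {q0..})"
    using dy[OF xy'] within_y[OF xy(2)] by simp
  have "I (x, y) \<le> \<rho> * B" "- (\<rho> * B) \<le> I (x, y)"
    using I[OF xy', of B] I'[OF xy', of B] B B0 by (force simp: abs_le_iff)+
  moreover have "\<bar>\<kappa> * w (x, y)\<bar> \<le> \<kappa> * B"
    using B[OF xy'] rho by (simp add: abs_mult mult_left_mono)
  ultimately show "\<bar>x * D1 (x, y) + y * D2 (x, y)\<bar> \<le> (\<kappa> + \<rho>) * B"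
    unfolding eq[OF xy'] distrib_right by linarith
qed

sublocale flow_pde w D1 D2 q0 d "(\<kappa> + \<rho>) * B" by (fact flow_pde)

definition S :: "(real \<times> real) set" where "S = {(x, y). q0 \<le> y \<and> x \<le> y + d}"

text \<open>Off the line \<open>x = y + d\<close> this is the category argument. Near the line
  \<open>w\<close> is bounded by a multiple of \<open>ln (d / (x - y))\<close>, which tends to
  0.\<close>

lemma continuous_on_S: "continuous_on S w"
  unfolding continuous_on_eq_continuous_within
proof
  fix z assume z: "z \<in> S"
  obtain x y where xy: "z = (x, y)" "q0 \<le> y" "x \<le> y + d" using z by (auto simp: S_def)
  show "continuous (at z within S) w"
  proof (cases "x < y + d")
    case True
    have "at z within S = at z within X"
    proof (rule at_within_nhd)
      show "z \<in> {z. fst z < snd z + d}" using True xy by simp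
      show "open {z::real\<times>real. fst z < snd z + d}" by (intro open_Collect_less continuous_intros)
    qed (auto simp: S_def X_def)
    then show ?thesis using continuous_on_X xy True by (simp add: continuous_on_eq_continuous_within)
  next
    case False
    then have x: "x = y + d" using xy by simp
    have lim: "((\<lambda>z. fst z - snd z) \<longlongrightarrow> fst (x, y) - snd (x, y)) (at z within S)"
      unfolding xy(1) by (intro tendsto_intros)
    then have lim: "((\<lambda>z. fst z - snd z) \<longlongrightarrow> d) (at z within S)" by (simp add: x)
    have "(w \<longlongrightarrow> 0) (at z within S)"
    proof (rule Lim_null_comparison)
      have "\<forall>\<^sub>F z in at z within S. fst z - snd z > 0" using lim d by (rule order_tendstoD)
      moreover have "\<forall>\<^sub>F z in at z within S. z \<in> S" by (simp add: eventually_at_filter)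
      ultimately show "\<forall>\<^sub>F z in at z within S. norm (w z) \<le> ((\<kappa> + \<rho>) * B) * ln (d / (fst z - snd z))"
      proof eventually_elim
        case (elim z)
        obtain a b where ab: "z = (a, b)" by (cases z)
        show ?case
        proof (cases "a = b + d")
          case True
          then show ?thesis using elim diag[of b] d by (auto simp: ab S_def)
        next
          case False
          have "continuous (at y within {y..}) (\<lambda>t. w (y + d, t))" if "q0 \<le> y" for y
            using DERIV_continuous[OF dy[of y "y + d"]] that by (simp add: max_absorb2)
          from bound_near_diagonal[OF diag this] elim False show ?thesis by (auto simp: ab S_def)
        qed
      qed
      have "((\<lambda>z. ((\<kappa> + \<rho>) * B) * ln (d / (fst z - snd z))) \<longlongrightarrow> ((\<kappa> + \<rho>) * B) * ln (d / d)) (at z within S)"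
        by (intro tendsto_intros lim) (use d in auto)
      then show "((\<lambda>z. ((\<kappa> + \<rho>) * B) * ln (d / (fst z - snd z))) \<longlongrightarrow> 0) (at z within S)"
        using d by simp
    qed
    then show ?thesis using diag[OF xy(2)] by (simp add: continuous_within xy(1) x)
  qed
qed

text \<open>The function \<open>h = ln (1 + x^2 + y^2)\<close> changes along the flow at a rate
  below 2, so at a maximum of \<open>w - \<epsilon> h\<close> the derivatives give
  \<open>x D1 + y D2 \<le> 2 \<epsilon>\<close>, and the equation bounds \<open>\<kappa> w\<close>
  there by \<open>\<rho> sup w\<close> up to a small error. Growth of \<open>h\<close> at infinity
  ensures that the maximum is attained.\<close>

lemma nonpos:
  assumes xy: "q0 \<le> y" "x \<le> y + d"
  shows "w (x, y) \<le> 0"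
proof (rule ccontr)
  assume pos: "\<not> w (x, y) \<le> 0"
  define s where "s = Sup (w ` S)"
  have bdd: "bdd_above (w ` S)" using B by (intro bdd_aboveI2[of _ _ B]) (force simp: S_def abs_le_iff)
  have ws: "w (x, y) \<le> s" if "q0 \<le> y" "x \<le> y + d" for x y
    unfolding s_def by (rule cSup_upper[OF _ bdd]) (use that in \<open>auto simp: S_def\<close>)
  have s0: "s > 0" using pos ws[OF xy] by simp
  \<comment> \<open>The equation at the maximum will give
    \<open>(\<kappa> - \<rho>) s \<le> 2 \<eta> (\<kappa> + 1)\<close>; with this choice the
    right-hand side is only half of the left-hand side.\<close>
  define \<eta> where "\<eta> = (\<kappa> - \<rho>) * s / (4 * (\<kappa> + 1))"
  have k1: "\<kappa> + 1 > 0" using rho by simp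
  have eta: "\<eta> > 0" "4 * \<eta> * (\<kappa> + 1) = (\<kappa> - \<rho>) * s"
  proof -
    show "\<eta> > 0" using rho s0 k1 by (simp add: \<eta>_def)
    have "4 * (\<kappa> + 1) \<noteq> 0" using k1 by simp
    then have "\<eta> * (4 * (\<kappa> + 1)) = (\<kappa> - \<rho>) * s" unfolding \<eta>_def by (rule nonzero_eq_divide_eq[THEN iffD1]) simp
    then show "4 * \<eta> * (\<kappa> + 1) = (\<kappa> - \<rho>) * s" by (simp only: mult.commute mult.left_commute)
  qed
  have "(x, y) \<in> S" using xy by (simp add: S_def)
  then have "\<exists>z\<in>w ` S. s - \<eta> < z" unfolding s_def using eta less_cSup_iff[OF _ bdd, of "s - \<eta>"] 
    by (auto simp: s_def)
  then obtain z0 where z0: "z0 \<in> S" "w z0 > s - \<eta>" by blast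
  define h where "h z = ln (1 + (fst z)^2 + (snd z)^2)" for z :: "real \<times> real"
  have pos1: "1 + (fst z)^2 + (snd z)^2 > 0" for z :: "real \<times> real"
    by (simp add: add_pos_nonneg)
  have h0: "h z \<ge> 0" for z unfolding h_def by (intro ln_ge_zero) simp
  define \<epsilon> where "\<epsilon> = \<eta> / (1 + h z0)"
  have eps: "\<epsilon> > 0" "\<epsilon> * h z0 \<le> \<eta>" "\<epsilon> \<le> \<eta>"
    using eta h0[of z0] by (auto simp: \<epsilon>_def field_simps add_pos_nonneg)
  \<comment> \<open>Beyond norm \<open>sqrt R\<close> the penalty \<open>\<epsilon> h\<close> is at
    least \<open>2 B + \<eta> + 1\<close>, more than the oscillation \<open>2 B\<close> of
    \<open>w\<close> plus the penalty at \<open>z0\<close>.\<close>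
  define R where "R = exp ((2 * B + \<eta> + 1) / \<epsilon>) "
  define K where "K = S \<inter> cball 0 (sqrt R)"
  have "closed S"
  proof -
    have "S = {z. q0 \<le> snd z} \<inter> {z. fst z \<le> snd z + d}" by (auto simp: S_def)
    then show ?thesis by (auto intro!: closed_Int closed_Collect_le continuous_intros)
  qed
  then have compK: "compact K" unfolding K_def by (intro closed_Int_compact compact_cball)
  have far: "w z - \<epsilon> * h z < w z0 - \<epsilon> * h z0" if "z \<in> S" "z \<notin> K" for z
  proof -
    have "norm z > sqrt R" using that by (simp add: K_def)
    moreover have "norm z = sqrt ((fst z)^2 + (snd z)^2)" by (simp add: norm_prod_def)
    ultimately have "R < (fst z)^2 + (snd z)^2" by simp
    then have "ln R \<le> h z" unfolding h_def by (intro ln_mono) (auto simp: R_def)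
    then have "(2 * B + \<eta> + 1) / \<epsilon> \<le> h z" by (simp add: R_def)
    then have "2 * B + \<eta> + 1 \<le> \<epsilon> * h z" using eps by (simp add: field_simps)
    moreover have "w z \<le> B" "- B \<le> w z0"
      using B[of "snd z" "fst z"] B[of "snd z0" "fst z0"] that z0 by (auto simp: S_def)
    ultimately show ?thesis using eps by linarith
  qed
  have z0K: "z0 \<in> K" using far[OF z0(1)] by fastforce
  have "continuous_on K (\<lambda>z. w z - \<epsilon> * h z)"
    unfolding h_def by (intro continuous_intros continuous_on_subset[OF continuous_on_S]) (use pos1 in \<open>auto simp: K_def less_le\<close>)
  then obtain z where z: "z \<in> K" "\<And>z'. z' \<in> K \<Longrightarrow> w z' - \<epsilon> * h z' \<le> w z - \<epsilon> * h z"
    using continuous_attains_sup[OF compK] z0K by blast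
  have max: "w z' - \<epsilon> * h z' \<le> w z - \<epsilon> * h z" if "z' \<in> S" for z'
    using far[OF that] z(2)[of z'] z(2)[OF z0K] by (cases "z' \<in> K") auto
  obtain a b where ab: "z = (a, b)" by (cases z)
  have inS: "q0 \<le> b" "a \<le> b + d" using z(1) by (auto simp: K_def S_def ab)
  have b0: "b > 0" using inS q0 by simp
  have wz: "w z \<ge> s - 2 * \<eta>"
    using max[OF z0(1)] z0(2) eps h0[of z] mult_nonneg_nonneg[of \<epsilon> "h z"] by linarith
  have "2 * \<eta> < s"
  proof -
    have "2 * \<eta> * 1 \<le> 2 * \<eta> * (\<kappa> + 1)" using eta rho by (intro mult_left_mono) auto
    moreover have "(\<kappa> - \<rho>) * s \<le> (\<kappa> + 1) * s" using rho s0 by (intro mult_right_mono) auto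
    moreover have "2 * (2 * \<eta>) * (\<kappa> + 1) \<le> s * (\<kappa> + 1)" using eta(2) calculation(2) by (simp add: algebra_simps)
    then have "2 * (2 * \<eta>) \<le> s" using k1 by (simp add: mult_le_cancel_right)
    ultimately show ?thesis using s0 eta by linarith
  qed
  then have wpos: "w z > 0" using wz by simp
  have lt: "a < b + d"
  proof (rule ccontr)
    assume "\<not> a < b + d"
    with inS have "a = b + d" by simp
    with diag[OF inS(1)] wpos show False by (simp add: ab)
  qed
  define P where "P = 1 + a^2 + b^2"
  have P: "P > 0" using pos1[of "(a,b)"] by (simp add: P_def)
  have d1: "((\<lambda>t. w (t, b) - \<epsilon> * h (t, b)) has_real_derivative D1 (a, b) - \<epsilon> * (2 * a / P)) (at a)"
    unfolding h_def P_def using P 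
    by (auto intro!: derivative_eq_intros hx[OF inS(1) lt] simp: inS P_def)
  have d2: "((\<lambda>t. w (a, t) - \<epsilon> * h (a, t)) has_real_derivative D2 (a, b) - \<epsilon> * (2 * b / P)) (at b within {q0..})"
    unfolding h_def P_def using P
    by (auto intro!: derivative_eq_intros hy[OF inS(1) lt] simp: inS P_def)
  have e1: "D1 (a, b) - \<epsilon> * (2 * a / P) = 0"
  proof (rule DERIV_local_max[OF d1])
    show "0 < b + d - a" using lt by simp
    show "\<forall>t. \<bar>a - t\<bar> < b + d - a \<longrightarrow> w (t, b) - \<epsilon> * h (t, b) \<le> w (a, b) - \<epsilon> * h (a, b)"
      using max by (auto simp: S_def ab inS)
  qed
  \<comment> \<open>The maximum may lie on the lower edge \<open>y = q0\<close>, so only larger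
    values of \<open>y\<close> can be compared; since \<open>b > 0\<close>, this inequality
    suffices.\<close>
  have e2: "D2 (a, b) - \<epsilon> * (2 * b / P) \<le> 0"
  proof (rule ccontr)
    assume "\<not> ?thesis"
    then have neg: "0 < D2 (a, b) - \<epsilon> * (2 * b / P)" by simp
    from has_real_derivative_pos_inc_right[OF d2 neg]
    obtain e where e: "e > 0" "\<And>k. 0 < k \<Longrightarrow> b + k \<in> {q0..} \<Longrightarrow> k < e \<Longrightarrow> w (a, b) - \<epsilon> * h (a, b) < w (a, b + k) - \<epsilon> * h (a, b + k)"
      by blast
    have "(a, b + e / 2) \<in> S" using inS e(1) by (simp add: S_def)
    from max[OF this] e(2)[of "e/2"] e(1) inS show False by (simp add: ab)
  qed
  have "b * D2 (a, b) \<le> b * (\<epsilon> * (2 * b / P))" using e2 b0 by (intro mult_left_mono) linarith+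
  then have "a * D1 (a, b) + b * D2 (a, b) \<le> \<epsilon> * (2 * (a^2 + b^2) / P)"
    using e1 by (simp add: power2_eq_square algebra_simps add_divide_distrib)
  also have "\<dots> \<le> \<epsilon> * 2"
    using eps P by (intro mult_left_mono) (auto simp: P_def divide_le_eq)
  also have "\<dots> \<le> 2 * \<eta>" using eps by simp
  finally have "\<kappa> * w (a, b) \<le> I (a, b) + 2 * \<eta>" using eq[OF inS] by simp
  also have "I (a, b) \<le> \<rho> * s" using I[OF inS ws] s0 by simp
  finally have "\<kappa> * w z \<le> \<rho> * s + 2 * \<eta>" by (simp add: ab)
  moreover have "\<kappa> * (s - 2 * \<eta>) \<le> \<kappa> * w z" using wz rho by (intro mult_left_mono) auto
  ultimately have "(\<kappa> - \<rho>) * s \<le> 2 * \<eta> * (\<kappa> + 1)" by (simp add: algebra_simps)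
  moreover have "4 * \<eta> * (\<kappa> + 1) > 2 * \<eta> * (\<kappa> + 1)"
    using eta(1) k1 by (intro mult_strict_right_mono) auto
  ultimately show False using eta(2) by linarith
qed

end

theorem (in separate_ide) unique:
  assumes xy: "q0 \<le> y" "x \<le> y + d"
  shows "w (x, y) = 0"
proof -
  interpret neg: separate_ide "\<lambda>z. - w z" "\<lambda>z. - D1 z" "\<lambda>z. - D2 z" "\<lambda>z. - I z" q0 d \<kappa> \<rho> B
  proof
    fix x y m :: real assume xy: "q0 \<le> y" "x \<le> y + d" and m: "0 \<le> m"
    { assume "\<And>x y. q0 \<le> y \<Longrightarrow> x \<le> y + d \<Longrightarrow> - w (x, y) \<le> m"
      then show "- I (x, y) \<le> \<rho> * m" using I'[OF xy _ m] by (simp add: minus_le_iff) }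
    { assume "\<And>x y. q0 \<le> y \<Longrightarrow> x \<le> y + d \<Longrightarrow> - m \<le> - w (x, y)"
      then show "- (\<rho> * m) \<le> - I (x, y)" using I[OF xy _ m] by simp }
  next
    fix x y assume xy: "q0 \<le> y" "x \<le> y + d"
    show "x * - D1 (x, y) + y * - D2 (x, y) = \<kappa> * - w (x, y) - - I (x, y)"
      using eq[OF xy] by simp
  qed (use q0 d rho dx dy B diag in \<open>auto intro!: derivative_intros\<close>)
  from nonpos[OF xy] neg.nonpos[OF xy] show ?thesis by simp
qed

section \<open>Smoothness of solutions of the renewal equation\<close>

lemma continuous_within_integral:
  fixes g :: "'b::metric_space \<Rightarrow> 'c \<Rightarrow> real"
  assumes meas: "\<And>x. x \<in> S \<Longrightarrow> g x \<in> borel_measurable N" and x0: "x0 \<in> S"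
    and bnd: "\<And>x. x \<in> S \<Longrightarrow> AE z in N. \<bar>g x z\<bar> \<le> w z" and w: "integrable N w"
    and cont: "AE z in N. continuous (at x0 within S) (\<lambda>x. g x z)"
  shows "continuous (at x0 within S) (\<lambda>x. \<integral>z. g x z \<partial>N)"
  unfolding continuous_within_sequentially
proof (intro allI impI)
  fix u assume u: "(\<forall>n. u n \<in> S) \<and> u \<longlonglongrightarrow> x0"
  have "(\<lambda>n. \<integral>z. g (u n) z \<partial>N) \<longlonglongrightarrow> (\<integral>z. g x0 z \<partial>N)"
  proof (rule integral_dominated_convergence[where w = w])
    show "AE z in N. (\<lambda>n. g (u n) z) \<longlonglongrightarrow> g x0 z"
      using cont by eventually_elim (use u in \<open>auto simp: continuous_within_sequentially o_def\<close>)
    show "AE z in N. norm (g (u n) z) \<le> w z" for n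
      using bnd[of "u n"] u by simp
  qed (use meas x0 u w in auto)
  then show "((\<lambda>x. \<integral>z. g x z \<partial>N) \<circ> u) \<longlonglongrightarrow> (\<integral>z. g x0 z \<partial>N)" by (simp add: o_def)
qed

lemma isCont_integral:
  fixes g :: "'b::metric_space \<Rightarrow> 'c \<Rightarrow> real"
  assumes "\<And>x. g x \<in> borel_measurable N" "\<And>x. AE z in N. \<bar>g x z\<bar> \<le> w z" "integrable N w"
    and "AE z in N. isCont (\<lambda>x. g x z) x0"
  shows "isCont (\<lambda>x. \<integral>z. g x z \<partial>N) x0"
  using continuous_within_integral[of UNIV g N x0 w] assms by auto

text \<open>\<open>p0\<close> and \<open>q0\<close> are the ruin levels in the coordinates
  \<open>p\<close> and \<open>q\<close>, to be instantiated with \<open>c1 / (\<delta>1 r)\<close>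
  and \<open>c2 / (\<delta>2 r)\<close>; \<open>p0 > q0\<close> is then the assumption on the
  premium rates.\<close>

locale risk_params =
  fixes r lam s p0 q0 :: real and f :: "real \<Rightarrow> real"
  assumes r: "r > 0" and lam: "lam > 0" and s: "s > 0" and q0: "q0 > 0" and p0: "p0 > q0"
    and f0: "\<And>z. f z \<ge> 0"
    and f_meas [measurable]: "f \<in> borel_measurable borel"
    and f_int: "integrable lborel f" and f1: "(LBINT z. f z) = 1"
begin

definition \<mu> where "\<mu> = lam + s"
definition d where "d = p0 - q0"

lemma d: "d > 0" and d_eq: "p0 = q0 + d"
  using p0 by (auto simp: d_def)

lemma mu: "\<mu> > 0" "lam < \<mu>" using lam s by (auto simp: \<mu>_def)

text \<open>The density of the first claim time multiplied by the discount
  \<open>exp (- s t)\<close>: the kernel of the renewal equation, with mass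
  \<open>lam / \<mu> < 1\<close>.\<close>

definition E :: "real \<Rightarrow> real" where "E t = indicator {0..} t * (lam * exp (- (\<mu> * t)))"

lemma E0: "E t \<ge> 0" using lam by (simp add: E_def)

lemma E_meas [measurable]: "E \<in> borel_measurable borel"
  unfolding E_def by measurable

lemma E_integrable: "integrable lborel E" and E_integral: "(LBINT t. E t) = lam / \<mu>"
proof -
  have eq: "E = (\<lambda>t. (lam / \<mu>) * exponential_density \<mu> t)"
    using mu by (auto simp: E_def exponential_density_def fun_eq_iff indicator_def mult.commute)
  have n: "(\<integral>\<^sup>+t. ennreal (exponential_density \<mu> t) \<partial>lborel) = 1"
    using prob_space.emeasure_space_1[OF prob_space_exponential_density[OF mu(1)]]
    by (simp add: emeasure_density)
  have nn: "0 \<le> exponential_density \<mu> t" for t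
    using mu by (simp add: exponential_density_def)
  have i: "integrable lborel (exponential_density \<mu>)"
    by (rule integrableI_nonneg) (use n nn in auto)
  show "integrable lborel E" unfolding eq using i by simp
  have "(LBINT t. exponential_density \<mu> t) = 1"
    by (subst integral_eq_nn_integral) (use n nn in auto)
  then show "(LBINT t. E t) = lam / \<mu>" unfolding eq by simp
qed

lemma integrable_E_bounded:
  assumes [measurable]: "k \<in> borel_measurable borel" and "\<And>t. \<bar>k t\<bar> \<le> B"
  shows "integrable lborel (\<lambda>t. E t * k t)"
proof (rule Bochner_Integration.integrable_bound[where f = "\<lambda>t. B * E t"])
  show "integrable lborel (\<lambda>t. B * E t)" using E_integrable by simp
  have "\<bar>E t * k t\<bar> \<le> B * E t" for t
    using mult_left_mono[OF assms(2)[of t] E0[of t]] E0[of t] by (simp add: abs_mult mult.commute)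
  then show "AE t in lborel. norm (E t * k t) \<le> norm (B * E t)"
    using order_trans[OF _ abs_ge_self] by (auto simp: real_norm_def intro!: AE_I2)
qed simp

lemma integrable_f_bounded:
  assumes [measurable]: "k \<in> borel_measurable borel" and "\<And>t. \<bar>k t\<bar> \<le> B"
  shows "integrable lborel (\<lambda>t. k t * f t)"
proof (rule Bochner_Integration.integrable_bound[where f = "\<lambda>t. B * f t"])
  show "integrable lborel (\<lambda>t. B * f t)" using f_int by simp
  have "\<bar>k t * f t\<bar> \<le> B * f t" for t
    using mult_right_mono[OF assms(2)[of t] f0[of t]] f0[of t] by (simp add: abs_mult)
  then show "AE t in lborel. norm (k t * f t) \<le> norm (B * f t)"
    using order_trans[OF _ abs_ge_self] by (auto simp: real_norm_def intro!: AE_I2)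
qed simp

lemma f_integral_bound:
  assumes [measurable]: "k \<in> borel_measurable borel" and "\<And>t. \<bar>k t\<bar> \<le> B"
  shows "\<bar>LBINT t. k t * f t\<bar> \<le> B"
proof -
  have "norm (LBINT t. k t * f t) \<le> (LBINT t. B * f t)"
  proof (rule Bochner_Integration.integral_norm_bound_integral)
    fix t show "norm (k t * f t) \<le> B * f t"
      using mult_right_mono[OF assms(2)[of t] f0[of t]] f0[of t] by (simp add: abs_mult)
  qed (use integrable_f_bounded[OF assms] f_int in auto)
  then show ?thesis by (simp add: f1)
qed

text \<open>The renewal integral read along a single flow line parametrised by time. The argument
  \<open>t\<close> is the starting point on that line, so differentiability along the flow becomes
  differentiability of \<open>G k\<close>.\<close>

definition G :: "(real \<Rightarrow> real) \<Rightarrow> real \<Rightarrow> real" where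
  "G k t = (LBINT u. E u * k (t + u))"

text \<open>The substitution \<open>v = t + u\<close> moves \<open>t\<close> out of the argument of
  \<open>k\<close>, which need not be continuous, into the limit of integration and an exponential
  factor.\<close>

lemma G_eq_tail: "G k t = exp (\<mu> * t) * (LBINT v. indicator {t..} v * (lam * exp (- (\<mu> * v)) * k v))"
proof -
  have "G k t = (LBINT u. exp (\<mu> * t) * (indicator {t..} (t + 1 * u) * (lam * exp (- (\<mu> * (t + 1 * u))) * k (t + 1 * u))))"
    unfolding G_def E_def
    by (intro Bochner_Integration.integral_cong) (auto simp: indicator_def exp_add exp_minus field_simps exp_diff)
  then show ?thesis
    using lborel_integral_real_affine[of 1 "\<lambda>v. indicator {t..} v * (lam * exp (- (\<mu> * v)) * k v)" t] by simp
qed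

text \<open>Absence of memory of the exponential law: what remains after time \<open>t\<close> is a
  fresh copy started at \<open>t\<close>, discounted by \<open>exp (- \<mu> t)\<close>.\<close>

lemma G_split:
  assumes [measurable]: "k \<in> borel_measurable borel" and B: "\<And>t. \<bar>k t\<bar> \<le> B" and t: "t \<ge> 0"
  shows "G k 0 = (LBINT u. indicator {0..t} u * (lam * exp (- (\<mu> * u)) * k u)) + exp (- (\<mu> * t)) * G k t"
proof -
  have i: "integrable lborel (\<lambda>u. E u * k u)" using integrable_E_bounded[OF assms(1) B] .
  have i1: "integrable lborel (\<lambda>u. indicator {0..t} u * (E u * k u))"
    using integrable_mult_indicator[OF _ i, of "{0..t}"] by simp
  have i2: "integrable lborel (\<lambda>u. indicator {t..} u * (E u * k u))"
    using integrable_mult_indicator[OF _ i, of "{t..}"] by simp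
  have "G k 0 = (LBINT u. indicator {0..t} u * (E u * k u) + indicator {t..} u * (E u * k u))"
    unfolding G_def
  proof (rule integral_cong_AE)
    show "AE u in lborel. E u * k (0 + u) = indicator {0..t} u * (E u * k u) + indicator {t..} u * (E u * k u)"
      using AE_lborel_singleton[of t] by eventually_elim (auto simp: indicator_def E_def)
  qed auto
  also have "\<dots> = (LBINT u. indicator {0..t} u * (E u * k u)) + (LBINT u. indicator {t..} u * (E u * k u))"
    by (rule Bochner_Integration.integral_add[OF i1 i2])
  also have "(LBINT u. indicator {t..} u * (E u * k u)) = exp (- (\<mu> * t)) * G k t"
    unfolding G_eq_tail mult.assoc[symmetric] using t
    by (auto simp: exp_minus E_def indicator_def intro!: Bochner_Integration.integral_cong)
  also have "(LBINT u. indicator {0..t} u * (E u * k u)) = (LBINT u. indicator {0..t} u * (lam * exp (- (\<mu> * u)) * k u))"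
    by (auto simp: E_def indicator_def intro!: Bochner_Integration.integral_cong)
  finally show ?thesis .
qed

lemma isCont_G:
  assumes [measurable]: "k \<in> borel_measurable borel" and B: "\<And>t. \<bar>k t\<bar> \<le> B"
  shows "isCont (G k) t"
proof -
  define T where "T = (\<lambda>t. LBINT v. indicator {t..} v * (lam * exp (- (\<mu> * v)) * k v))"
  \<comment> \<open>The restriction to arguments \<open>x \<ge> t - 1\<close> provides one
    dominating function for all the tails near \<open>t\<close>.\<close>
  have "continuous (at t within {t - 1..}) T"
    unfolding T_def
  proof (rule continuous_within_integral)
    show "integrable lborel (\<lambda>v. B * exp (- (\<mu> * (t - 1))) * E (v - (t - 1)))"
    proof -
      have "(\<lambda>v. E (v - (t - 1))) = (\<lambda>v. E (- (t - 1) + 1 * v))" by (simp add: algebra_simps)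
      then have "integrable lborel (\<lambda>v. E (v - (t - 1)))"
        using lborel_integrable_real_affine[OF E_integrable, of 1 "- (t - 1)"] by argo
      then show ?thesis by (rule integrable_mult_right)
    qed
    fix x assume x: "x \<in> {t - 1..}"
    have "B \<ge> 0" using B[of 0] by linarith
    show "AE v in lborel. \<bar>indicator {x..} v * (lam * exp (- (\<mu> * v)) * k v)\<bar> \<le> B * exp (- (\<mu> * (t - 1))) * E (v - (t - 1))"
    proof (rule AE_I2)
      fix v
      have e: "exp (- (\<mu> * (t - 1))) * exp (- (\<mu> * (v - (t - 1)))) = exp (- (\<mu> * v))"
        by (simp add: exp_add[symmetric] algebra_simps)
      show "\<bar>indicator {x..} v * (lam * exp (- (\<mu> * v)) * k v)\<bar> \<le> B * exp (- (\<mu> * (t - 1))) * E (v - (t - 1))"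
      proof (cases "v \<ge> x")
        case True
        have "B * exp (- (\<mu> * (t - 1))) * E (v - (t - 1)) = B * (lam * (exp (- (\<mu> * (t - 1))) * exp (- (\<mu> * (v - (t - 1))))))"
          using True x by (simp add: E_def)
        also have "\<dots> = lam * exp (- (\<mu> * v)) * B" unfolding e by simp
        finally have eq: "B * exp (- (\<mu> * (t - 1))) * E (v - (t - 1)) = lam * exp (- (\<mu> * v)) * B" .
        show ?thesis unfolding eq using True lam B[of v] by (simp add: abs_mult)
      qed (use \<open>B \<ge> 0\<close> E0 in simp)
    qed
  next
    show "AE v in lborel. continuous (at t within {t - 1..}) (\<lambda>x. indicator {x..} v * (lam * exp (- (\<mu> * v)) * k v))"
      using AE_lborel_singleton[of t]
    proof eventually_elim
      case (elim v)
      have "((\<lambda>x. indicator {x..} v :: real) \<longlongrightarrow> indicator {t..} v) (at t)"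
      proof (rule tendsto_eventually)
        have "open (if v < t then {v<..} else {..<v})" "t \<in> (if v < t then {v<..} else {..<v})" using elim by auto
        from eventually_at_topological[THEN iffD2, OF exI, OF conjI, OF this(1) conjI, OF this(2)]
        show "\<forall>\<^sub>F x in at t. (indicator {x..} v :: real) = indicator {t..} v"
          by (auto simp: indicator_def split: if_splits)
      qed
      then have "isCont (\<lambda>x. indicator {x..} v * (lam * exp (- (\<mu> * v)) * k v)) t"
        unfolding isCont_def by (intro tendsto_intros)
      then show ?case by (rule continuous_at_imp_continuous_at_within)
    qed
  qed auto
  moreover have "at t within {t - 1..} = at t" by (rule at_within_interior) simp
  ultimately have "isCont T t" by simp
  then have "isCont (\<lambda>t. exp (\<mu> * t) * T t) t" by (intro continuous_intros)
  then show ?thesis unfolding T_def by (simp add: G_eq_tail[abs_def])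
qed

text \<open>Near \<open>t\<close> the tail integral is a constant minus the integral of a continuous
  function from \<open>a\<close>, so the fundamental theorem applies although \<open>k\<close> is
  merely bounded and measurable elsewhere. This locality is needed for rays of which only a segment
  lies in the domain.\<close>

lemma G_derivative:
  assumes [measurable]: "k \<in> borel_measurable borel" and B: "\<And>t. \<bar>k t\<bar> \<le> B"
    and ab: "a < t" "t < b" and k: "continuous_on {a..b} k"
  shows "(G k has_real_derivative \<mu> * G k t - lam * k t) (at t)"
proof -
  define g where "g = (\<lambda>v. lam * exp (- (\<mu> * v)) * k v)"
  have gc: "continuous_on {a..b} g" unfolding g_def by (intro continuous_intros k)
  have eq: "G k x = exp (\<mu> * x) * (exp (- (\<mu> * a)) * G k a - integral {a..x} g)" if x: "x \<in> {a..b}" for x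
  proof -
    define k' where "k' = (\<lambda>u. k (a + u))"
    have [measurable]: "k' \<in> borel_measurable borel" unfolding k'_def by simp
    have Gk': "G k' u = G k (a + u)" for u by (simp add: G_def k'_def add.assoc)
    have "G k' 0 = (LBINT u. indicator {0..x-a} u * (lam * exp (- (\<mu> * u)) * k' u)) + exp (- (\<mu> * (x-a))) * G k' (x-a)"
      by (rule G_split[where B = B]) (use x B in \<open>auto simp: k'_def\<close>)
    moreover have "(LBINT u. indicator {0..x-a} u * (lam * exp (- (\<mu> * u)) * k' u)) = exp (\<mu> * a) * (LBINT u. indicator {a..x} u * g u)"
    proof -
      have "(LBINT u. indicator {0..x-a} u * (lam * exp (- (\<mu> * u)) * k' u))
          = (LBINT u. exp (\<mu> * a) * (indicator {a..x} (a + 1 * u) * g (a + 1 * u)))"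
        by (intro Bochner_Integration.integral_cong)
           (auto simp: indicator_def g_def k'_def exp_add exp_minus exp_diff field_simps)
      then show ?thesis
        using lborel_integral_real_affine[of 1 "\<lambda>u. indicator {a..x} u * g u" a] by simp
    qed
    moreover have "(LBINT u. indicator {a..x} u * g u) = integral {a..x} g"
    proof -
      have "set_integrable lborel {a..x} g"
        by (rule borel_integrable_atLeastAtMost') (use x in \<open>auto intro!: continuous_on_subset[OF gc]\<close>)
      from set_borel_integral_eq_integral(2)[OF this] show ?thesis by (simp add: set_lebesgue_integral_def)
    qed
    ultimately have "G k a = exp (\<mu> * a) * integral {a..x} g + exp (- (\<mu> * (x-a))) * G k x"
      by (simp add: Gk')
    then have "exp (\<mu> * x) * (exp (- (\<mu> * a)) * G k a) = exp (\<mu> * x) * integral {a..x} g * (exp (- (\<mu> * a)) * exp (\<mu> * a)) 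
        + (exp (\<mu> * x) * exp (- (\<mu> * a)) * exp (- (\<mu> * (x-a)))) * G k x" by (simp add: algebra_simps)
    moreover have "exp (\<mu> * x) * exp (- (\<mu> * a)) * exp (- (\<mu> * (x-a))) = 1"
      by (simp add: exp_add[symmetric] algebra_simps)
    moreover have "exp (- (\<mu> * a)) * exp (\<mu> * a) = 1" by (simp add: exp_add[symmetric])
    ultimately show ?thesis by (simp add: algebra_simps)
  qed
  have "((\<lambda>x. integral {a..x} g) has_real_derivative g t) (at t within {a..b})"
    by (rule integral_has_real_derivative[OF gc]) (use ab in auto)
  then have dI: "((\<lambda>x. integral {a..x} g) has_real_derivative g t) (at t)"
    unfolding at_within_Icc_at[OF ab] .
  define c where "c = exp (- (\<mu> * a)) * G k a"
  have eqt: "G k t = exp (\<mu> * t) * (c - integral {a..t} g)" using eq[of t] ab by (simp add: c_def)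
  have "exp (\<mu> * t) * exp (- (\<mu> * t)) = 1" by (simp add: exp_add[symmetric])
  then have gt: "exp (\<mu> * t) * g t = lam * k t" by (simp add: g_def)
  have d1: "((\<lambda>x. exp (\<mu> * x)) has_real_derivative \<mu> * exp (\<mu> * t)) (at t)"
    by (auto intro!: derivative_eq_intros)
  have d2: "((\<lambda>x. c - integral {a..x} g) has_real_derivative 0 - g t) (at t)"
    by (rule DERIV_diff[OF DERIV_const dI])
  have "((\<lambda>x. exp (\<mu> * x) * (c - integral {a..x} g)) has_real_derivative
       \<mu> * (exp (\<mu> * t) * (c - integral {a..t} g)) - exp (\<mu> * t) * g t) (at t)"
    using DERIV_mult[OF d1 d2] by (simp add: mult_ac)
  then have D: "((\<lambda>x. exp (\<mu> * x) * (exp (- (\<mu> * a)) * G k a - integral {a..x} g)) has_real_derivative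
       \<mu> * G k t - lam * k t) (at t)"
    by (simp only: eqt gt c_def)
  show ?thesis
  proof (rule has_field_derivative_transform_within_open[OF D])
    show "open {a<..<b}" "t \<in> {a<..<b}" using ab by auto
    show "exp (\<mu> * x) * (exp (- (\<mu> * a)) * G k a - integral {a..x} g) = G k x" if "x \<in> {a<..<b}" for x
      by (rule eq[symmetric]) (use that in auto)
  qed
qed

end

lemma isCont_indicator_atMost:
  fixes a :: real
  assumes "v \<noteq> a" shows "isCont (\<lambda>x. indicator {..x} v :: real) a"
proof (cases "v < a")
  case True
  have "\<forall>\<^sub>F x in nhds a. (indicator {..x} v :: real) = 1"
    using eventually_nhds_in_open[of "{v<..}" a] True by (auto elim!: eventually_mono)
  then have "isCont (\<lambda>x. indicator {..x} v :: real) a \<longleftrightarrow> isCont (\<lambda>x. 1 :: real) a" by (rule isCont_cong)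
  then show ?thesis by simp
next
  case False
  have "\<forall>\<^sub>F x in nhds a. (indicator {..x} v :: real) = 0"
    using eventually_nhds_in_open[of "{..<v}" a] False assms by (auto elim!: eventually_mono)
  then have "isCont (\<lambda>x. indicator {..x} v :: real) a \<longleftrightarrow> isCont (\<lambda>x. 0 :: real) a" by (rule isCont_cong)
  then show ?thesis by simp
qed

lemma integral_lborel_swap:
  fixes h :: "real \<Rightarrow> real \<Rightarrow> real"
  assumes [measurable]: "case_prod h \<in> borel_measurable (lborel \<Otimes>\<^sub>M lborel)"
    and a: "integrable lborel a" and b: "integrable lborel b"
    and bnd: "\<And>x y. \<bar>h x y\<bar> \<le> a x * b y"
  shows "(LBINT x. (LBINT y. h x y)) = (LBINT y. (LBINT x. h x y))"
proof -
  have [measurable]: "a \<in> borel_measurable lborel" "b \<in> borel_measurable lborel" using a b by auto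
  have "integrable (lborel \<Otimes>\<^sub>M lborel) (\<lambda>(x, y). a x * b y)"
  proof (rule lborel_pair.Fubini_integrable)
    show "integrable lborel (\<lambda>x. LBINT y. norm (case (x, y) of (x, y) \<Rightarrow> a x * b y))"
      using a b by (simp add: abs_mult)
    show "AE x in lborel. integrable lborel (\<lambda>y. case (x, y) of (x, y) \<Rightarrow> a x * b y)"
      using b by simp
  qed simp
  then have "integrable (lborel \<Otimes>\<^sub>M lborel) (case_prod h)"
    by (rule Bochner_Integration.integrable_bound)
       (use bnd in \<open>auto intro!: AE_I2 intro: order_trans[OF _ abs_ge_self]\<close>)
  then show ?thesis by (rule lborel_pair.Fubini_integral[symmetric])
qed

context risk_params
begin

definition conv :: "(real \<Rightarrow> real) \<Rightarrow> real \<Rightarrow> real" where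
  "conv \<phi> x = (LBINT z. \<phi> (x - z) * f z)"

lemma integrable_E_bound:
  assumes "k \<in> borel_measurable borel" and "\<And>t. \<bar>k t\<bar> \<le> B * E t"
  shows "integrable lborel k"
  by (rule Bochner_Integration.integrable_bound[where f = "\<lambda>t. B * E t"])
     (use E_integrable assms in \<open>auto intro!: AE_I2 intro: order_trans[OF _ abs_ge_self]\<close>)

lemma E_integral_bound:
  assumes [measurable]: "k \<in> borel_measurable borel" and b: "\<And>t. \<bar>k t\<bar> \<le> B * E t"
  shows "\<bar>LBINT t. k t\<bar> \<le> B * (lam / \<mu>)"
proof -
  have "norm (LBINT t. k t) \<le> (LBINT t. B * E t)"
    by (rule Bochner_Integration.integral_norm_bound_integral)
       (use integrable_E_bound[OF assms] E_integrable b in auto)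
  then show ?thesis by (simp add: E_integral)
qed

end

section \<open>The renewal equation in one variable\<close>

text \<open>To be used twice: for the values on the line \<open>p = q + d\<close>, where ruin is
  that of the first process and \<open>x0 = p0\<close>, and for the values on \<open>p = q\<close>,
  where it is that of the second and \<open>x0 = q0\<close>.\<close>

locale risk_1d = risk_params +
  fixes \<phi> :: "real \<Rightarrow> real" and x0 :: real
  assumes \<phi>_meas [measurable]: "\<phi> \<in> borel_measurable borel" and \<phi>_bound: "\<And>x. \<bar>\<phi> x\<bar> \<le> 1"
    and x0: "x0 > 0" and \<phi>_ruin: "\<And>x. x < x0 \<Longrightarrow> \<phi> x = 1"
    and \<phi>_renewal: "\<And>x. x \<ge> x0 \<Longrightarrow> \<phi> x = (LBINT t. E t * conv \<phi> (exp (r * t) * x))"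
begin

definition h where "h = conv \<phi>"
text \<open>The solution \<open>\<phi>\<close> may jump at \<open>x0\<close>. The renewal integral
  taken for every \<open>x\<close> agrees with \<open>\<phi>\<close> from \<open>x0\<close> on and
  is differentiable on \<open>x > 0\<close>, so the ruin level needs no one-sided
  derivatives.\<close>

definition F where "F x = (LBINT t. E t * h (exp (r * t) * x))"
text \<open>The one-dimensional equation \<open>r x F' = \<mu> F - lam h\<close> solved for
  \<open>F'\<close>.\<close>

definition dF where "dF x = (\<mu> * F x - lam * h x) / (r * x)"

lemma h_meas [measurable]: "h \<in> borel_measurable borel"
  unfolding h_def conv_def by measurable

lemma h_bound: "\<bar>h x\<bar> \<le> 1"
  unfolding h_def conv_def using f_integral_bound[of "\<lambda>z. \<phi> (x - z)" 1] \<phi>_bound by simp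

lemma \<phi>_eq_F: "x \<ge> x0 \<Longrightarrow> \<phi> x = F x"
  using \<phi>_renewal by (simp add: F_def h_def)

lemma F_bound: "\<bar>F x\<bar> \<le> 1"
proof -
  have "\<bar>F x\<bar> \<le> 1 * (lam / \<mu>)"
    unfolding F_def
  proof (rule E_integral_bound)
    show "\<bar>E t * h (exp (r * t) * x)\<bar> \<le> 1 * E t" for t
      using mult_left_mono[OF h_bound E0] E0 by (simp add: abs_mult)
  qed simp
  also have "\<dots> \<le> 1" using mu by simp
  finally show ?thesis .
qed

lemma F_eq_G: "x > 0 \<Longrightarrow> F x = G (\<lambda>t. h (exp (r * t))) (ln x / r)"
  unfolding F_def G_def using r by (simp add: distrib_left exp_add mult.commute)

lemma isCont_F: "x > 0 \<Longrightarrow> isCont F x"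
proof -
  assume x: "x > 0"
  have "isCont (\<lambda>x. G (\<lambda>t. h (exp (r * t))) (ln x / r)) x"
    by (rule isCont_o2[OF _ isCont_G[where B = 1]]) (use x r h_bound in \<open>auto intro!: continuous_intros\<close>)
  moreover have "\<forall>\<^sub>F y in nhds x. F y = G (\<lambda>t. h (exp (r * t))) (ln y / r)"
    using eventually_nhds_in_open[of "{0<..}" x] x by (auto elim!: eventually_mono simp: F_eq_G)
  ultimately show ?thesis using isCont_cong[of F _ x] by simp
qed

lemma isCont_\<phi>: "x \<noteq> x0 \<Longrightarrow> isCont \<phi> x"
proof (cases "x < x0")
  case True
  have "\<forall>\<^sub>F y in nhds x. \<phi> y = 1"
    using eventually_nhds_in_open[of "{..<x0}" x] True by (auto elim!: eventually_mono simp: \<phi>_ruin)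
  then have "isCont \<phi> x \<longleftrightarrow> isCont (\<lambda>x. 1 :: real) x" by (rule isCont_cong)
  then show ?thesis by simp
next
  case False
  assume "x \<noteq> x0"
  with False have x: "x > x0" by simp
  have "\<forall>\<^sub>F y in nhds x. \<phi> y = F y"
    using eventually_nhds_in_open[of "{x0<..}" x] x by (auto elim!: eventually_mono simp: \<phi>_eq_F)
  then have "isCont \<phi> x \<longleftrightarrow> isCont F x" by (rule isCont_cong)
  then show ?thesis using isCont_F x x0 by simp
qed

text \<open>The only possible discontinuity of \<open>\<phi>\<close> is at \<open>x0\<close>, and
  averaging over a claim with a density removes it.\<close>

lemma isCont_h: "isCont h x"
  unfolding h_def conv_def
proof (rule isCont_integral)
  show "integrable lborel (\<lambda>z. f z)" by (fact f_int)
  show "AE z in lborel. \<bar>\<phi> (y - z) * f z\<bar> \<le> f z" for y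
    using mult_right_mono[OF \<phi>_bound f0] f0 by (auto simp: abs_mult)
  show "AE z in lborel. isCont (\<lambda>x. \<phi> (x - z) * f z) x"
    using AE_lborel_singleton[of "x - x0"]
  proof eventually_elim
    case (elim z)
    have "isCont (\<lambda>x. \<phi> (x - z)) x"
      by (rule isCont_o2[OF _ isCont_\<phi>]) (use elim in \<open>auto intro!: continuous_intros\<close>)
    then show ?case by (intro continuous_intros)
  qed
qed simp

lemma F_derivative: "x > 0 \<Longrightarrow> (F has_real_derivative dF x) (at x)"
proof -
  assume x: "x > 0"
  define k where "k = (\<lambda>t. h (exp (r * t)))"
  have kc: "continuous_on A k" for A
    unfolding k_def by (intro continuous_at_imp_continuous_on ballI isCont_o2[OF _ isCont_h] continuous_intros)
  have "(G k has_real_derivative \<mu> * G k (ln x / r) - lam * k (ln x / r)) (at (ln x / r))"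
    by (rule G_derivative[of _ 1 "ln x / r - 1" _ "ln x / r + 1"]) (use h_bound kc in \<open>auto simp: k_def\<close>)
  moreover have "((\<lambda>x. ln x / r) has_real_derivative 1 / (r * x)) (at x)"
    using x r by (auto intro!: derivative_eq_intros simp: field_simps)
  ultimately have "((\<lambda>x. G k (ln x / r)) has_real_derivative (\<mu> * G k (ln x / r) - lam * k (ln x / r)) * (1 / (r * x))) (at x)"
    by (rule DERIV_chain2)
  then have D: "((\<lambda>x. G k (ln x / r)) has_real_derivative dF x) (at x)"
    unfolding dF_def using x r by (simp add: F_eq_G k_def)
  show ?thesis
    by (rule has_field_derivative_transform_within_open[OF D, of "{0<..}"]) (use x in \<open>auto simp: F_eq_G k_def\<close>)
qed

lemma isCont_dF: "x > 0 \<Longrightarrow> isCont dF x"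
  unfolding dF_def using r by (intro continuous_intros isCont_F isCont_h) auto

lemma dF_bound: "x \<ge> x0 \<Longrightarrow> \<bar>dF x\<bar> \<le> (\<mu> + lam) / (r * x0)"
proof -
  assume x: "x \<ge> x0"
  have "\<bar>\<mu> * F x - lam * h x\<bar> \<le> \<bar>\<mu> * F x\<bar> + \<bar>lam * h x\<bar>" by (rule abs_triangle_ineq4)
  also have "\<dots> \<le> \<mu> * 1 + lam * 1"
    using F_bound[of x] h_bound[of x] mu lam by (auto simp: abs_mult intro!: add_mono mult_left_mono)
  finally have "\<bar>\<mu> * F x - lam * h x\<bar> \<le> \<mu> + lam" by simp
  moreover have "r * x0 \<le> r * x" "r * x0 > 0" using x r x0 by auto
  ultimately show ?thesis unfolding dF_def abs_divide using mu lam by (intro frac_le) auto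
qed

end

section \<open>The renewal equation differentiated in the meeting time\<close>

locale risk_switch = risk_1d r lam s p0 q0 f \<phi> p0 for r lam s p0 q0 f \<phi>
begin

text \<open>\<open>C = U C + src\<close> is what the renewal equation \<open>Gam_renewal\<close> becomes when it is differentiated
  in \<open>\<tau>\<close>: at \<open>t = \<tau>\<close> the terms with \<open>h\<close> cancel by \<open>F_derivative\<close>, only \<open>src\<close> is left.\<close>

definition K :: "(real \<times> real \<Rightarrow> real) \<Rightarrow> real \<times> real \<Rightarrow> real" where
  "K c x = (LBINT z. indicator {..snd x - q0} z * c (fst x, snd x - z) * f z)"

text \<open>The part with a first claim before the meeting time: when it arrives, the time left is
  \<open>\<tau> - t\<close> and \<open>q\<close> has grown to \<open>exp (r t) q\<close>.\<close>

definition U :: "(real \<times> real \<Rightarrow> real) \<Rightarrow> real \<times> real \<Rightarrow> real" where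
  "U c x = (LBINT t. indicator {..fst x} t * (E t * K c (fst x - t, exp (r * t) * snd x)))"

definition src :: "real \<times> real \<Rightarrow> real" where
  "src x = - (r * d * exp (- (\<mu> * fst x)) * dF (d + exp (r * fst x) * snd x))"

text \<open>A retraction onto \<open>\<tau> \<ge> 0\<close>, \<open>q \<ge> q0\<close>, so that the
  fixed-point problem can be posed on the whole plane, in the complete space of bounded continuous
  functions.\<close>

definition clip :: "real \<times> real \<Rightarrow> real \<times> real" where
  "clip x = (max 0 (fst x), max q0 (snd x))"

lemma continuous_measurable: "continuous_on UNIV c \<Longrightarrow> c \<in> borel_measurable borel" for c :: "real \<times> real \<Rightarrow> real"
  by (rule borel_measurable_continuous_onI)

lemma K_bound:
  assumes c: "continuous_on UNIV c" and B: "\<And>x. \<bar>c x\<bar> \<le> B"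
  shows "\<bar>K c x\<bar> \<le> B"
proof -
  have [measurable]: "c \<in> borel_measurable borel" using c by (rule continuous_measurable)
  have "B \<ge> 0" using B[of undefined] by linarith
  then show ?thesis unfolding K_def
    by (intro f_integral_bound) (auto simp: abs_mult indicator_def B)
qed

lemma isCont_K:
  assumes c: "continuous_on UNIV c" and B: "\<And>x. \<bar>c x\<bar> \<le> B"
  shows "isCont (K c) x"
  unfolding K_def
proof (rule isCont_integral)
  have [measurable]: "c \<in> borel_measurable borel" using c by (rule continuous_measurable)
  have B0: "B \<ge> 0" using B[of undefined] by linarith
  show "integrable lborel (\<lambda>z. B * f z)" using f_int by simp
  show "AE z in lborel. \<bar>indicator {..snd x - q0} z * c (fst x, snd x - z) * f z\<bar> \<le> B * f z" for x
    using mult_right_mono[OF B f0] B0 f0 by (auto simp: abs_mult indicator_def)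
  show "(\<lambda>z. indicator {..snd x - q0} z * c (fst x, snd x - z) * f z) \<in> borel_measurable lborel" for x
    by measurable
  have cc: "isCont c x" for x using c by (simp add: continuous_on_eq_continuous_at del: split_paired_All)
  show "AE z in lborel. isCont (\<lambda>x. indicator {..snd x - q0} z * c (fst x, snd x - z) * f z) x"
    using AE_lborel_singleton[of "snd x - q0"]
  proof eventually_elim
    case (elim z)
    show ?case
      by (intro continuous_intros isCont_o2[OF _ cc] isCont_o2[OF _ isCont_indicator_atMost] elim)
  qed
qed

lemma isCont_U:
  assumes c: "continuous_on UNIV c" and B: "\<And>x. \<bar>c x\<bar> \<le> B"
  shows "isCont (U c) x"
  unfolding U_def
proof (rule isCont_integral)
  have Kc: "isCont (K c) x" for x using isCont_K[OF c B] .
  then have [measurable]: "K c \<in> borel_measurable borel"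
    by (intro continuous_measurable) (simp add: continuous_on_eq_continuous_at)
  have B0: "B \<ge> 0" using B[of undefined] by linarith
  show "integrable lborel (\<lambda>t. B * E t)" using E_integrable by simp
  show "AE t in lborel. \<bar>indicator {..fst x} t * (E t * K c (fst x - t, exp (r * t) * snd x))\<bar> \<le> B * E t" for x
    using mult_right_mono[OF K_bound[OF c B] E0] B0 E0 by (auto simp: abs_mult indicator_def mult.commute)
  show "(\<lambda>t. indicator {..fst x} t * (E t * K c (fst x - t, exp (r * t) * snd x))) \<in> borel_measurable lborel" for x
    by measurable
  show "AE t in lborel. isCont (\<lambda>x. indicator {..fst x} t * (E t * K c (fst x - t, exp (r * t) * snd x))) x"
    using AE_lborel_singleton[of "fst x"]
  proof eventually_elim
    case (elim t)
    show ?case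
      by (intro continuous_intros isCont_o2[OF _ Kc] isCont_o2[OF _ isCont_indicator_atMost] elim)
  qed
qed

lemma U_diff_bound:
  assumes c: "continuous_on UNIV c" "\<And>x. \<bar>c x\<bar> \<le> B" and c': "continuous_on UNIV c'" "\<And>x. \<bar>c' x\<bar> \<le> B'"
    and D: "\<And>x. \<bar>c x - c' x\<bar> \<le> D"
  shows "\<bar>U c x - U c' x\<bar> \<le> D * (lam / \<mu>)"
proof -
  have D0: "D \<ge> 0" using D[of undefined] by linarith
  have [measurable]: "c \<in> borel_measurable borel" "c' \<in> borel_measurable borel"
    using c c' by (auto intro: continuous_measurable)
  have Km[measurable]: "K c \<in> borel_measurable borel" "K c' \<in> borel_measurable borel"
    using isCont_K[OF c] isCont_K[OF c'] by (auto intro!: continuous_measurable simp: continuous_on_eq_continuous_at)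
  have Kd: "\<bar>K c y - K c' y\<bar> \<le> D" for y
  proof -
    have i: "integrable lborel (\<lambda>z. indicator {..snd y - q0} z * c (fst y, snd y - z) * f z)"
      "integrable lborel (\<lambda>z. indicator {..snd y - q0} z * c' (fst y, snd y - z) * f z)"
      using c c' order_trans[OF abs_ge_zero c(2)] order_trans[OF abs_ge_zero c'(2)]
      by (intro integrable_f_bounded[where B = B] integrable_f_bounded[where B = B'];
          force simp: indicator_def)+
    have "K c y - K c' y = (LBINT z. (indicator {..snd y - q0} z * (c (fst y, snd y - z) - c' (fst y, snd y - z))) * f z)"
      unfolding K_def by (subst Bochner_Integration.integral_diff[OF i, symmetric]) (simp add: algebra_simps)
    also have "\<bar>\<dots>\<bar> \<le> D"
      by (rule f_integral_bound) (use D D0 in \<open>auto simp: indicator_def\<close>)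
    finally show ?thesis .
  qed
  have i: "integrable lborel (\<lambda>t. indicator {..fst x} t * (E t * K c (fst x - t, exp (r * t) * snd x)))"
    by (rule integrable_E_bound[where B = B])
       (use mult_right_mono[OF K_bound[OF c] E0] E0 order_trans[OF abs_ge_zero c(2)] in \<open>auto simp: abs_mult indicator_def mult.commute\<close>)
  have i': "integrable lborel (\<lambda>t. indicator {..fst x} t * (E t * K c' (fst x - t, exp (r * t) * snd x)))"
    by (rule integrable_E_bound[where B = B'])
       (use mult_right_mono[OF K_bound[OF c'] E0] E0 order_trans[OF abs_ge_zero c'(2)] in \<open>auto simp: abs_mult indicator_def mult.commute\<close>)
  have "U c x - U c' x = (LBINT t. indicator {..fst x} t * (E t * (K c (fst x - t, exp (r * t) * snd x) - K c' (fst x - t, exp (r * t) * snd x))))"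
    unfolding U_def by (subst Bochner_Integration.integral_diff[OF i i', symmetric]) (simp add: algebra_simps)
  also have "\<bar>\<dots>\<bar> \<le> D * (lam / \<mu>)"
    by (rule E_integral_bound)
       (use mult_right_mono[OF Kd E0] E0 D0 in \<open>auto simp: abs_mult indicator_def mult.commute\<close>)
  finally show ?thesis .
qed

lemma exists_C:
  "\<exists>c B. continuous_on UNIV c \<and> (\<forall>x. \<bar>c x\<bar> \<le> B) \<and>
     (\<forall>\<tau> q. \<tau> \<ge> 0 \<longrightarrow> q \<ge> q0 \<longrightarrow> c (\<tau>, q) = U c (\<tau>, q) + src (\<tau>, q))"
proof -
  define T :: "((real \<times> real) \<Rightarrow>\<^sub>C real) \<Rightarrow> real \<times> real \<Rightarrow> real" where
    "T c x = U (apply_bcontfun c) (clip x) + src (clip x)" for c x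
  have nb: "\<bar>apply_bcontfun c x\<bar> \<le> norm c" for c :: "(real \<times> real) \<Rightarrow>\<^sub>C real" and x
    using norm_bounded[of c x] by simp
  have cl: "isCont clip x" for x
    unfolding clip_def by (intro continuous_intros)
  \<comment> \<open>Here the clipping matters: it keeps the argument of \<open>dF\<close> at or
    above the ruin level \<open>p0\<close>, where \<open>dF\<close> is continuous and
    bounded.\<close>
  have arg: "d + exp (r * fst (clip x)) * snd (clip x) \<ge> p0" for x
  proof -
    have "1 * q0 \<le> exp (r * fst (clip x)) * snd (clip x)"
      using r q0 by (intro mult_mono) (auto simp: clip_def)
    then show ?thesis by (simp add: d_def)
  qed
  have src_cont: "isCont (\<lambda>x. src (clip x)) x" for x
    unfolding src_def
    by (intro continuous_intros isCont_o2[OF _ isCont_dF] isCont_o2[OF cl] ) (use arg[of x] x0 in auto)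
  define Bs where "Bs = r * d * ((\<mu> + lam) / (r * p0))"
  have src_bound: "\<bar>src (clip x)\<bar> \<le> Bs" for x
  proof -
    have "exp (- (\<mu> * fst (clip x))) * \<bar>dF (d + exp (r * fst (clip x)) * snd (clip x))\<bar> \<le> 1 * ((\<mu> + lam) / (r * p0))"
      using dF_bound[OF arg[of x]] mu by (intro mult_mono) (auto simp: clip_def)
    then have "r * d * (exp (- (\<mu> * fst (clip x))) * \<bar>dF (d + exp (r * fst (clip x)) * snd (clip x))\<bar>) \<le> Bs"
      unfolding Bs_def using r d by (intro mult_left_mono) auto
    then show ?thesis using r d by (simp add: src_def abs_mult mult.assoc)
  qed
  have Tb: "T c \<in> bcontfun" for c
  proof (rule bcontfun_normI)
    show "continuous_on UNIV (T c)"
      unfolding T_def continuous_on_eq_continuous_at[OF open_UNIV]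
      by (intro ballI continuous_intros src_cont isCont_o2[OF cl isCont_U[OF _ nb]]) simp
    fix x
    have "\<bar>U (apply_bcontfun c) (clip x) - U (\<lambda>x. 0) (clip x)\<bar> \<le> norm c * (lam / \<mu>)"
      by (rule U_diff_bound[where B = "norm c" and B' = 0]) (use nb in auto)
    moreover have "U (\<lambda>x. 0) (clip x) = 0" by (simp add: U_def K_def)
    ultimately show "norm (T c x) \<le> norm c * (lam / \<mu>) + Bs"
      unfolding T_def real_norm_def using src_bound[of x] by (auto intro!: order_trans[OF abs_triangle_ineq] add_mono)
  qed
  define S where "S c = Bcontfun (T c)" for c
  have S: "apply_bcontfun (S c) = T c" for c
    unfolding S_def by (rule Bcontfun_inverse[OF Tb])
  have "\<exists>!c. S c = c"
  proof (rule banach_fix_type)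
    show "0 \<le> lam / \<mu>" "lam / \<mu> < 1" using lam mu by auto
    show "\<forall>c c'. dist (S c) (S c') \<le> lam / \<mu> * dist c c'"
    proof (intro allI dist_bound)
      fix c c' :: "(real \<times> real) \<Rightarrow>\<^sub>C real" and x
      have "\<bar>U (apply_bcontfun c) (clip x) - U (apply_bcontfun c') (clip x)\<bar> \<le> dist c c' * (lam / \<mu>)"
        by (rule U_diff_bound[where B = "norm c" and B' = "norm c'"])
           (use nb dist_bounded[of c _ c'] in \<open>auto simp: dist_real_def\<close>)
      then show "dist (apply_bcontfun (S c) x) (apply_bcontfun (S c') x) \<le> lam / \<mu> * dist c c'"
        by (simp add: S T_def dist_real_def mult.commute)
    qed
  qed
  then obtain c where c: "S c = c" by blast
  have "apply_bcontfun c x = T c x" for x using S[of c] c by simp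
  then have "apply_bcontfun c (\<tau>, q) = U (apply_bcontfun c) (\<tau>, q) + src (\<tau>, q)" if "\<tau> \<ge> 0" "q \<ge> q0" for \<tau> q
    using that by (simp add: T_def clip_def max_absorb2)
  then show ?thesis using nb[of c] by (intro exI[of _ "apply_bcontfun c"] exI[of _ "norm c"]) auto
qed

definition C :: "real \<times> real \<Rightarrow> real" where
  "C = (SOME c. \<exists>B. continuous_on UNIV c \<and> (\<forall>x. \<bar>c x\<bar> \<le> B) \<and>
     (\<forall>\<tau> q. \<tau> \<ge> 0 \<longrightarrow> q \<ge> q0 \<longrightarrow> c (\<tau>, q) = U c (\<tau>, q) + src (\<tau>, q)))"

lemma C_ex: "\<exists>B. continuous_on UNIV C \<and> (\<forall>x. \<bar>C x\<bar> \<le> B) \<and>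
     (\<forall>\<tau> q. \<tau> \<ge> 0 \<longrightarrow> q \<ge> q0 \<longrightarrow> C (\<tau>, q) = U C (\<tau>, q) + src (\<tau>, q))"
  unfolding C_def by (rule someI_ex[OF exists_C])

lemma C_cont: "continuous_on UNIV C"
  and C_eq: "\<tau> \<ge> 0 \<Longrightarrow> q \<ge> q0 \<Longrightarrow> C (\<tau>, q) = U C (\<tau>, q) + src (\<tau>, q)"
  using C_ex by auto

definition CB where "CB = (SOME B. \<forall>x. \<bar>C x\<bar> \<le> B)"

lemma C_bound: "\<bar>C x\<bar> \<le> CB"
  unfolding CB_def using C_ex someI_ex[of "\<lambda>B. \<forall>x. \<bar>C x\<bar> \<le> B"] by blast

lemma C_meas [measurable]: "C \<in> borel_measurable borel"
  by (rule continuous_measurable[OF C_cont])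

lemma F_meas [measurable]: "F \<in> borel_measurable borel"
  unfolding F_def by measurable

lemma KC_meas [measurable]: "K C \<in> borel_measurable borel"
  by (intro continuous_measurable)
     (simp add: continuous_on_eq_continuous_at isCont_K[OF C_cont C_bound] del: split_paired_All)

lemma CB0: "CB \<ge> 0" using C_bound[of undefined] by linarith

text \<open>The candidate for \<open>\<Phi> (q + d exp (- r \<tau>)) q\<close>: the value at meeting
  time 0, which is the one-dimensional \<open>F\<close>, plus the integral of the candidate
  \<open>C\<close> for its derivative. Differentiability in \<open>\<tau>\<close> is built in; the
  renewal equation is what has to be verified.\<close>

definition Gam :: "real \<Rightarrow> real \<Rightarrow> real" where
  "Gam \<tau> q = F (q + d) + (LBINT u. indicator {0..\<tau>} u * C (u, q))"

text \<open>Before the meeting time ruin is decided by the second process alone, so the condition on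
  the claim involves only \<open>q\<close>.\<close>

definition HGam :: "(real \<Rightarrow> real \<Rightarrow> real) \<Rightarrow> real \<Rightarrow> real \<Rightarrow> real" where
  "HGam g \<tau> q = (LBINT z. (if z \<le> q - q0 then g \<tau> (q - z) else 1) * f z)"

lemma indicator_Icc: "indicator {a..b} x = (if a \<le> x \<and> x \<le> b then 1 else 0 :: real)" for a b x :: real
  by (simp add: indicator_def)

lemma indicator_atMost: "indicator {..b} x = (if x \<le> b then 1 else 0 :: real)" for b x :: real
  by (simp add: indicator_def)

lemma integrable_indicator_Icc: "integrable lborel (indicator {a..b} :: real \<Rightarrow> real)"
  using borel_integrable_atLeastAtMost'[of a b "\<lambda>_. 1 :: real"] by (simp add: set_integrable_def)

lemma indicator_integral_bound:
  fixes k :: "real \<Rightarrow> real"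
  assumes k: "integrable lborel (\<lambda>u. indicator {0..x} u * k u)" and b: "\<And>u. \<bar>k u\<bar> \<le> B" and x: "x \<ge> 0"
  shows "\<bar>LBINT u. indicator {0..x} u * k u\<bar> \<le> x * B"
proof -
  have "norm (LBINT u. indicator {0..x} u * k u) \<le> (LBINT u. B * indicator {0..x} u)"
  proof (rule Bochner_Integration.integral_norm_bound_integral[OF k])
    show "integrable lborel (\<lambda>u. B * indicator {0..x} u)"
      by (rule integrable_mult_right) (rule integrable_indicator_Icc)
    show "norm (indicator {0..x} u * k u) \<le> B * indicator {0..x} u" for u
      using b[of u] by (cases "u \<in> {0..x}") simp_all
  qed
  then show ?thesis using x by (simp add: mult.commute)
qed

lemma C_meas_pair [measurable]: "C \<in> borel_measurable (borel \<Otimes>\<^sub>M borel)"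
  "K C \<in> borel_measurable (borel \<Otimes>\<^sub>M borel)"
  by (simp_all add: borel_prod)

declare C_meas [measurable del] KC_meas [measurable del]

lemma Gam_meas [measurable]: "(\<lambda>x. Gam (fst x) (snd x)) \<in> borel_measurable borel"
proof -
  have "(\<lambda>x. Gam (fst x) (snd x)) \<in> borel_measurable (borel \<Otimes>\<^sub>M borel)"
    unfolding Gam_def indicator_Icc by measurable
  then show ?thesis by (simp add: borel_prod)
qed

lemma integrable_indicator_C: "integrable lborel (\<lambda>u. indicator {0..\<tau>} u * C (u, q))"
proof (rule Bochner_Integration.integrable_bound[where f = "\<lambda>u. CB * indicator {0..\<tau>} u"])
  show "AE u in lborel. norm (indicator {0..\<tau>} u * C (u, q)) \<le> norm (CB * indicator {0..\<tau>} u)"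
    using C_bound order_trans[OF C_bound abs_ge_self] by (auto simp: indicator_def)
qed (auto simp: integrable_indicator_Icc)

lemma Gam_bound: "\<tau> \<ge> 0 \<Longrightarrow> \<bar>Gam \<tau> q\<bar> \<le> 1 + \<tau> * CB"
proof -
  assume \<tau>: "\<tau> \<ge> 0"
  have "\<bar>LBINT u. indicator {0..\<tau>} u * C (u, q)\<bar> \<le> \<tau> * CB"
    by (rule indicator_integral_bound[OF integrable_indicator_C C_bound \<tau>])
  then show ?thesis using F_bound[of "q + d"] unfolding Gam_def by auto
qed

lemma Gam_derivative:
  assumes "\<tau> \<ge> 0"
  shows "((\<lambda>\<tau>. Gam \<tau> q) has_real_derivative C (\<tau>, q)) (at \<tau> within {0..})"
proof -
  have cc: "continuous_on A (\<lambda>u. C (u, q))" for A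
    by (rule continuous_on_compose2[OF C_cont]) (auto intro!: continuous_intros)
  have eq: "Gam x q = F (q + d) + integral {0..x} (\<lambda>u. C (u, q))" for x
  proof -
    have "set_integrable lborel {0..x} (\<lambda>u. C (u, q))" by (rule borel_integrable_atLeastAtMost'[OF cc])
    from set_borel_integral_eq_integral(2)[OF this] show ?thesis
      by (simp add: Gam_def set_lebesgue_integral_def)
  qed
  have "((\<lambda>x. integral {0..x} (\<lambda>u. C (u, q))) has_real_derivative C (\<tau>, q)) (at \<tau> within {0..\<tau> + 1})"
    by (rule integral_has_real_derivative[OF cc]) (use assms in auto)
  moreover have "at \<tau> within {0..\<tau> + 1} = at \<tau> within {0..}"
    by (rule at_within_nhd[of _ "{..<\<tau> + 1}"]) auto
  ultimately have "((\<lambda>x. integral {0..x} (\<lambda>u. C (u, q))) has_real_derivative C (\<tau>, q)) (at \<tau> within {0..})" by simp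
  from DERIV_add[OF DERIV_const this, of "F (q + d)"] show ?thesis by (simp add: eq)
qed

lemma Gam_continuous:
  assumes "q + d > 0"
  shows "isCont (\<lambda>x. Gam (fst x) (snd x)) (\<tau>, q)"
proof -
  let ?S = "{x :: real \<times> real. fst x \<le> \<tau> + 1}"
  have cC: "isCont C x" for x using C_cont by (simp add: continuous_on_eq_continuous_at del: split_paired_All)
  have "continuous (at (\<tau>, q) within ?S) (\<lambda>x. LBINT u. indicator {0..fst x} u * C (u, snd x))"
  proof (rule continuous_within_integral[where w = "\<lambda>u. CB * indicator {0..\<tau> + 1} u"])
    show "AE u in lborel. \<bar>indicator {0..fst x} u * C (u, snd x)\<bar> \<le> CB * indicator {0..\<tau> + 1} u" if "x \<in> ?S" for x
      using that C_bound CB0 by (auto simp: indicator_def)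
    show "AE u in lborel. continuous (at (\<tau>, q) within ?S) (\<lambda>x. indicator {0..fst x} u * C (u, snd x))"
      using AE_lborel_singleton[of \<tau>]
    proof eventually_elim
      case (elim u)
      have c: "isCont (\<lambda>x. indicator {0..} u * indicator {..fst x} u * C (u, snd x)) (\<tau>, q)"
        by (intro continuous_intros isCont_o2[OF _ cC] isCont_o2[OF _ isCont_indicator_atMost]) (use elim in auto)
      have eq: "(\<lambda>x. indicator {0..fst x} u * C (u, snd x)) = (\<lambda>x. indicator {0..} u * indicator {..fst x} u * C (u, snd x))"
        by (auto simp: indicator_def)
      show ?case unfolding eq by (rule continuous_at_imp_continuous_at_within[OF c])
    qed
  qed (auto simp: integrable_indicator_Icc)
  moreover have "at (\<tau>, q) within ?S = at (\<tau>, q)"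
    by (rule at_within_nhd[of _ "{x. fst x < \<tau> + 1}"]) (auto intro!: open_Collect_less continuous_intros)
  ultimately have "isCont (\<lambda>x. LBINT u. indicator {0..fst x} u * C (u, snd x)) (\<tau>, q)" by simp
  moreover have "isCont (\<lambda>x. F (snd x + d)) (\<tau>, q)"
    by (rule isCont_o2[OF _ isCont_F]) (use assms in \<open>auto intro!: continuous_intros\<close>)
  ultimately show ?thesis unfolding Gam_def by (rule continuous_add[rotated])
qed

text \<open>Averaging over the claim commutes with the integral of \<open>C\<close>. The remaining
  part of \<open>Gam\<close>, together with the value 1 at ruin, is exactly
  \<open>\<phi> (q + d - z)\<close>, whose average is \<open>h (q + d)\<close>.\<close>

lemma HGam_Gam:
  assumes "\<tau> \<ge> 0"
  shows "HGam Gam \<tau> q = h (q + d) + (LBINT u. indicator {0..\<tau>} u * K C (u, q))"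
proof -
  have i1: "integrable lborel (\<lambda>z. \<phi> (q + d - z) * f z)"
    using \<phi>_bound by (intro integrable_f_bounded) auto
  let ?J = "\<lambda>q. LBINT u. indicator {0..\<tau>} u * C (u, q)"
  have Jm [measurable]: "?J \<in> borel_measurable borel" by measurable
  have Jb: "\<bar>?J x\<bar> \<le> \<tau> * CB" for x
    by (rule indicator_integral_bound[OF integrable_indicator_C C_bound assms])
  have i2: "integrable lborel (\<lambda>z. (indicator {..q - q0} z * ?J (q - z)) * f z)"
  proof (rule integrable_f_bounded)
    show "\<bar>indicator {..q - q0} z * ?J (q - z)\<bar> \<le> \<tau> * CB" for z
      using Jb assms CB0 by (auto simp: indicator_def)
  qed measurable
  have "HGam Gam \<tau> q = (LBINT z. \<phi> (q + d - z) * f z + (indicator {..q - q0} z * ?J (q - z)) * f z)"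
    unfolding HGam_def
  proof (rule Bochner_Integration.integral_cong)
    fix z
    show "(if z \<le> q - q0 then Gam \<tau> (q - z) else 1) * f z = \<phi> (q + d - z) * f z + (indicator {..q - q0} z * ?J (q - z)) * f z"
    proof (cases "z \<le> q - q0")
      case True
      then have "\<phi> (q + d - z) = F (q - z + d)"
        using \<phi>_eq_F[of "q + d - z"] by (simp add: d_def algebra_simps)
      then show ?thesis using True by (simp add: Gam_def algebra_simps)
    next
      case False
      then show ?thesis using \<phi>_ruin[of "q + d - z"] by (simp add: d_def)
    qed
  qed simp
  also have "\<dots> = h (q + d) + (LBINT z. (indicator {..q - q0} z * ?J (q - z)) * f z)"
    unfolding h_def conv_def by (rule Bochner_Integration.integral_add[OF i1 i2])
  also have "(LBINT z. (indicator {..q - q0} z * ?J (q - z)) * f z)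
      = (LBINT z. (LBINT u. indicator {0..\<tau>} u * (indicator {..q - q0} z * C (u, q - z) * f z)))"
  proof (rule Bochner_Integration.integral_cong)
    fix z
    have "(indicator {..q - q0} z * ?J (q - z)) * f z = (indicator {..q - q0} z * f z) * ?J (q - z)" by simp
    also have "\<dots> = (LBINT u. (indicator {..q - q0} z * f z) * (indicator {0..\<tau>} u * C (u, q - z)))"
      by (rule integral_mult_right_zero[symmetric])
    finally show "(indicator {..q - q0} z * ?J (q - z)) * f z = (LBINT u. indicator {0..\<tau>} u * (indicator {..q - q0} z * C (u, q - z) * f z))"
      by (simp add: mult_ac)
  qed simp
  also have "\<dots> = (LBINT u. (LBINT z. indicator {0..\<tau>} u * (indicator {..q - q0} z * C (u, q - z) * f z)))"
  proof (rule integral_lborel_swap[where a = "\<lambda>z. CB * f z" and b = "indicator {0..\<tau>}"])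
    show "\<bar>indicator {0..\<tau>} u * (indicator {..q - q0} z * C (u, q - z) * f z)\<bar> \<le> CB * f z * indicator {0..\<tau>} u" for z u
      using mult_right_mono[OF C_bound f0] f0 CB0 by (auto simp: indicator_def abs_mult)
  qed (use f_int integrable_indicator_Icc in auto)
  also have "\<dots> = (LBINT u. indicator {0..\<tau>} u * K C (u, q))"
    by (simp add: K_def)
  finally show ?thesis .
qed

text \<open>The function \<open>exp (- \<mu> t) F (d + exp (r t) q)\<close> is differentiated and
  integrated over \<open>[0, \<tau>]\<close>. Its argument does not follow the flow: the velocity
  falls short of the flow by \<open>r d\<close>, and this defect times the derivative of
  \<open>F\<close>, discounted, is \<open>src\<close>.\<close>

lemma src_integral:
  assumes \<tau>: "\<tau> \<ge> 0" and q: "q \<ge> q0"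
  shows "(LBINT t. indicator {..\<tau>} t * (E t * h (exp (r * t) * q + d))) + exp (- (\<mu> * \<tau>)) * F (d + exp (r * \<tau>) * q)
     = F (q + d) + (LBINT t. indicator {0..\<tau>} t * src (t, q))"
proof -
  define w where "w t = exp (- (\<mu> * t)) * F (d + exp (r * t) * q)" for t
  have P: "d + exp (r * t) * q > 0" for t using d q q0 by (intro add_pos_pos) auto
  define a where "a t = lam * exp (- (\<mu> * t)) * h (exp (r * t) * q + d)" for t
  have ac: "isCont a t" for t
    unfolding a_def by (intro continuous_intros isCont_o2[OF _ isCont_h])
  have bc: "isCont (\<lambda>t. src (t, q)) t" for t
    unfolding src_def fst_conv snd_conv by (intro continuous_intros isCont_o2[OF _ isCont_dF] P)
  have dw: "(w has_real_derivative src (t, q) - a t) (at t)" for t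
  proof -
    have "((\<lambda>t. F (d + exp (r * t) * q)) has_real_derivative dF (d + exp (r * t) * q) * (r * exp (r * t) * q)) (at t)"
      by (rule DERIV_chain2[where f = F and g = "\<lambda>t. d + exp (r * t) * q", OF F_derivative[OF P]]) (auto intro!: derivative_eq_intros)
    moreover have "((\<lambda>t. exp (- (\<mu> * t))) has_real_derivative - \<mu> * exp (- (\<mu> * t))) (at t)"
      by (auto intro!: derivative_eq_intros)
    ultimately have D: "(w has_real_derivative - \<mu> * exp (- (\<mu> * t)) * F (d + exp (r * t) * q) + dF (d + exp (r * t) * q) * (r * exp (r * t) * q) * exp (- (\<mu> * t))) (at t)"
      unfolding w_def by (rule DERIV_mult[rotated])
    have "r * (d + exp (r * t) * q) * dF (d + exp (r * t) * q) = \<mu> * F (d + exp (r * t) * q) - lam * h (d + exp (r * t) * q)"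
      using P[of t] r by (simp add: dF_def)
    then have "dF (d + exp (r * t) * q) * (r * exp (r * t) * q) = \<mu> * F (d + exp (r * t) * q) - lam * h (d + exp (r * t) * q) - r * d * dF (d + exp (r * t) * q)"
      by (simp add: algebra_simps)
    note * = this
    have "- \<mu> * exp (- (\<mu> * t)) * F (d + exp (r * t) * q) + dF (d + exp (r * t) * q) * (r * exp (r * t) * q) * exp (- (\<mu> * t))
        = exp (- (\<mu> * t)) * (dF (d + exp (r * t) * q) * (r * exp (r * t) * q) - \<mu> * F (d + exp (r * t) * q))"
      by (simp add: algebra_simps)
    also have "\<dots> = src (t, q) - a t"
      unfolding * by (simp add: src_def a_def algebra_simps)
    finally have eq: "- \<mu> * exp (- (\<mu> * t)) * F (d + exp (r * t) * q) + dF (d + exp (r * t) * q) * (r * exp (r * t) * q) * exp (- (\<mu> * t)) = src (t, q) - a t" .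
    show ?thesis using D unfolding eq .
  qed
  have i: "integrable lborel (\<lambda>t. indicator {0..\<tau>} t * src (t, q))" "integrable lborel (\<lambda>t. indicator {0..\<tau>} t * a t)"
    using borel_integrable_atLeastAtMost'[of 0 \<tau> "\<lambda>t. src (t, q)"] borel_integrable_atLeastAtMost'[of 0 \<tau> a] bc ac
    by (auto simp: set_integrable_def continuous_at_imp_continuous_on)
  have "(LBINT t. (src (t, q) - a t) * indicator {0..\<tau>} t) = w \<tau> - w 0"
    by (rule integral_FTC_Icc_real[OF \<tau> dw]) (intro continuous_intros ac bc)
  moreover have "(LBINT t. (src (t, q) - a t) * indicator {0..\<tau>} t)
     = (LBINT t. indicator {0..\<tau>} t * src (t, q)) - (LBINT t. indicator {0..\<tau>} t * a t)"
    by (subst Bochner_Integration.integral_diff[OF i, symmetric]) (simp add: algebra_simps)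
  moreover have "(LBINT t. indicator {0..\<tau>} t * a t) = (LBINT t. indicator {..\<tau>} t * (E t * h (exp (r * t) * q + d)))"
    by (auto intro!: Bochner_Integration.integral_cong simp: indicator_def E_def a_def)
  ultimately show ?thesis by (simp add: w_def add.commute)
qed

text \<open>This is \<open>C = U C + src\<close> integrated in \<open>\<tau>\<close>. By the
  substitution \<open>y = t + u\<close> and Fubini, \<open>U C\<close> becomes the double integral
  of \<open>K C\<close> over the claim time and the remaining meeting time; \<open>src\<close>
  contributes the terms with \<open>h\<close> and \<open>F\<close>.\<close>

lemma Gam_renewal:
  assumes \<tau>: "\<tau> \<ge> 0" and q: "q \<ge> q0"
  shows "Gam \<tau> q = (LBINT t. indicator {..\<tau>} t * (E t * HGam Gam (\<tau> - t) (exp (r * t) * q)))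
      + exp (- (\<mu> * \<tau>)) * F (d + exp (r * \<tau>) * q)"
proof -
  define J where "J t = (LBINT u. indicator {0..\<tau> - t} u * K C (u, exp (r * t) * q))" for t
  have KCb: "\<bar>K C x\<bar> \<le> CB" for x by (rule K_bound[OF C_cont C_bound])
  have iK: "integrable lborel (\<lambda>u. indicator {0..x} u * K C (u, y))" for x y
  proof (rule Bochner_Integration.integrable_bound[where f = "\<lambda>u. CB * indicator {0..x} u"])
    show "AE u in lborel. norm (indicator {0..x} u * K C (u, y)) \<le> norm (CB * indicator {0..x} u)"
      using KCb order_trans[OF KCb abs_ge_self] by (auto simp: indicator_def)
  qed (auto simp: integrable_indicator_Icc)
  have [measurable]: "J \<in> borel_measurable borel"
    unfolding J_def indicator_Icc by measurable
  have Jb: "\<bar>J t\<bar> \<le> \<tau> * CB" if "0 \<le> t" "t \<le> \<tau>" for t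
  proof -
    have "\<bar>J t\<bar> \<le> (\<tau> - t) * CB"
      unfolding J_def by (rule indicator_integral_bound[OF iK KCb]) (use that in simp)
    also have "\<dots> \<le> \<tau> * CB" using that CB0 by (intro mult_right_mono) auto
    finally show ?thesis by simp
  qed
  have i1: "integrable lborel (\<lambda>t. indicator {..\<tau>} t * (E t * h (exp (r * t) * q + d)))"
    by (rule integrable_E_bound[where B = 1])
       (use mult_right_mono[OF h_bound E0] E0 in \<open>auto simp: indicator_def abs_mult mult.commute\<close>)
  have i2: "integrable lborel (\<lambda>t. indicator {..\<tau>} t * (E t * J t))"
  proof (rule integrable_E_bound[where B = "\<tau> * CB"])
    fix t
    show "\<bar>indicator {..\<tau>} t * (E t * J t)\<bar> \<le> \<tau> * CB * E t"
    proof (cases "0 \<le> t \<and> t \<le> \<tau>")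
      case True
      then show ?thesis using mult_right_mono[OF Jb E0, of t t] E0[of t] by (simp add: abs_mult mult.commute)
    next
      case False
      then have z: "indicator {..\<tau>} t * (E t * J t) = 0" by (auto simp: E_def indicator_def)
      show ?thesis unfolding z using E0[of t] \<tau> CB0 by simp
    qed
  qed measurable
  have "(LBINT t. indicator {..\<tau>} t * (E t * HGam Gam (\<tau> - t) (exp (r * t) * q)))
     = (LBINT t. indicator {..\<tau>} t * (E t * h (exp (r * t) * q + d)) + indicator {..\<tau>} t * (E t * J t))"
    by (rule Bochner_Integration.integral_cong) (auto simp: indicator_def HGam_Gam J_def algebra_simps)
  also have "\<dots> = (LBINT t. indicator {..\<tau>} t * (E t * h (exp (r * t) * q + d))) + (LBINT t. indicator {..\<tau>} t * (E t * J t))"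
    by (rule Bochner_Integration.integral_add[OF i1 i2])
  also have "(LBINT t. indicator {..\<tau>} t * (E t * J t))
     = (LBINT t. (LBINT y. indicator {0..\<tau>} y * (indicator {..y} t * (E t * K C (y - t, exp (r * t) * q)))))"
  proof (rule Bochner_Integration.integral_cong)
    fix t :: real
    have "J t = (LBINT y. indicator {0..\<tau> - t} (- t + 1 * y) * K C (- t + 1 * y, exp (r * t) * q))"
      using lborel_integral_real_affine[of 1 "\<lambda>u. indicator {0..\<tau> - t} u * K C (u, exp (r * t) * q)" "- t"]
      by (simp add: J_def)
    then have "indicator {..\<tau>} t * (E t * J t) = (LBINT y. (indicator {..\<tau>} t * E t) * (indicator {0..\<tau> - t} (- t + 1 * y) * K C (- t + 1 * y, exp (r * t) * q)))"
      by (simp add: mult.assoc)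
    also have "\<dots> = (LBINT y. indicator {0..\<tau>} y * (indicator {..y} t * (E t * K C (y - t, exp (r * t) * q))))"
      by (rule Bochner_Integration.integral_cong) (auto simp: indicator_def E_def)
    finally show "indicator {..\<tau>} t * (E t * J t) = (LBINT y. indicator {0..\<tau>} y * (indicator {..y} t * (E t * K C (y - t, exp (r * t) * q))))" .
  qed simp
  also have "\<dots> = (LBINT y. (LBINT t. indicator {0..\<tau>} y * (indicator {..y} t * (E t * K C (y - t, exp (r * t) * q)))))"
  proof (rule integral_lborel_swap[where a = "\<lambda>t. CB * E t" and b = "indicator {0..\<tau>}"])
    show "(\<lambda>(t, y). indicator {0..\<tau>} y * (indicator {..y} t * (E t * K C (y - t, exp (r * t) * q)))) \<in> borel_measurable (lborel \<Otimes>\<^sub>M lborel)"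
      unfolding indicator_Icc indicator_atMost by measurable
    show "\<bar>indicator {0..\<tau>} y * (indicator {..y} t * (E t * K C (y - t, exp (r * t) * q)))\<bar> \<le> CB * E t * indicator {0..\<tau>} y" for t y
      using mult_right_mono[OF KCb E0] E0 CB0 by (auto simp: indicator_def abs_mult mult.commute)
  qed (use E_integrable integrable_indicator_Icc in auto)
  also have "\<dots> = (LBINT y. indicator {0..\<tau>} y * C (y, q) - indicator {0..\<tau>} y * src (y, q))"
  proof (rule Bochner_Integration.integral_cong)
    fix y
    show "(LBINT t. indicator {0..\<tau>} y * (indicator {..y} t * (E t * K C (y - t, exp (r * t) * q)))) = indicator {0..\<tau>} y * C (y, q) - indicator {0..\<tau>} y * src (y, q)"
      using C_eq[OF _ q, of y] by (auto simp: indicator_def U_def)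
  qed simp
  also have "\<dots> = (LBINT y. indicator {0..\<tau>} y * C (y, q)) - (LBINT y. indicator {0..\<tau>} y * src (y, q))"
  proof (rule Bochner_Integration.integral_diff[OF integrable_indicator_C])
    have P: "d + exp (r * t) * q > 0" for t using d q q0 by (intro add_pos_pos) auto
    have bc: "isCont (\<lambda>t. src (t, q)) t" for t
      unfolding src_def fst_conv snd_conv by (intro continuous_intros isCont_o2[OF _ isCont_dF] P)
    then show "integrable lborel (\<lambda>y. indicator {0..\<tau>} y * src (y, q))"
      using borel_integrable_atLeastAtMost'[of 0 \<tau> "\<lambda>t. src (t, q)"]
      by (auto simp: set_integrable_def continuous_at_imp_continuous_on)
  qed
  finally show ?thesis using src_integral[OF \<tau> q] unfolding Gam_def[of \<tau> q] by linarith
qed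

lemma HGam_meas:
  assumes "(\<lambda>x. g (fst x) (snd x)) \<in> borel_measurable borel"
  shows "(\<lambda>t. HGam g (a - t) (exp (r * t) * x)) \<in> borel_measurable borel"
proof -
  have [measurable]: "(\<lambda>x. g (fst x) (snd x)) \<in> borel_measurable (borel \<Otimes>\<^sub>M borel)" using assms by (simp add: borel_prod)
  have "(\<lambda>p. g (a - fst p) (exp (r * fst p) * x - snd p)) \<in> borel_measurable (borel \<Otimes>\<^sub>M borel)"
    using measurable_compose[of "\<lambda>p. (a - fst p, exp (r * fst p) * x - snd p)" "borel \<Otimes>\<^sub>M borel" "borel \<Otimes>\<^sub>M borel" "\<lambda>x. g (fst x) (snd x)" borel] by simp
  then show ?thesis unfolding HGam_def by measurable
qed

text \<open>The equation contracts differences by \<open>lam / \<mu>\<close> in the supremum norm.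
  \<open>Gam\<close> is bounded only by \<open>1 + \<tau> CB\<close>, so the supremum is taken over
  meeting times up to the given one; this is consistent because the remaining time only
  decreases.\<close>

lemma Gam_unique:
  assumes gm [measurable]: "(\<lambda>x. g (fst x) (snd x)) \<in> borel_measurable borel"
    and gb: "\<And>\<tau> q. \<bar>g \<tau> q\<bar> \<le> 1"
    and g: "\<And>\<tau> q. \<tau> \<ge> 0 \<Longrightarrow> q \<ge> q0 \<Longrightarrow> g \<tau> q =
        (LBINT t. indicator {..\<tau>} t * (E t * HGam g (\<tau> - t) (exp (r * t) * q)))
      + exp (- (\<mu> * \<tau>)) * F (d + exp (r * \<tau>) * q)"
    and \<tau>: "\<tau> \<ge> 0" and q: "q \<ge> q0"
  shows "g \<tau> q = Gam \<tau> q"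
proof -
  define A where "A = {(t, x). 0 \<le> t \<and> t \<le> \<tau> \<and> q0 \<le> x}"
  define D where "D = (SUP (t, x)\<in>A. \<bar>g t x - Gam t x\<bar>)"
  define B where "B = 2 + \<tau> * CB"
  have Gb: "\<bar>Gam t x\<bar> \<le> 1 + \<tau> * CB" if "0 \<le> t" "t \<le> \<tau>" for t x
    using Gam_bound[OF that(1), of x] mult_right_mono[OF that(2) CB0] by linarith
  have "\<bar>g t x - Gam t x\<bar> \<le> B" if "0 \<le> t" "t \<le> \<tau>" for t x
    using gb[of t x] Gb[OF that, of x] unfolding B_def by linarith
  then have bdd: "bdd_above ((\<lambda>(t, x). \<bar>g t x - Gam t x\<bar>) ` A)"
    by (intro bdd_aboveI2[of _ _ B]) (auto simp: A_def)
  have D: "\<bar>g t x - Gam t x\<bar> \<le> D" if "0 \<le> t" "t \<le> \<tau>" "q0 \<le> x" for t x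
    unfolding D_def using cSUP_upper[OF _ bdd, of "(t, x)"] that by (simp add: A_def)
  have D0: "D \<ge> 0" using D[OF \<tau> order_refl q] by linarith
  have gm2 [measurable]: "(\<lambda>x. g t x) \<in> borel_measurable borel" "(\<lambda>x. Gam t x) \<in> borel_measurable borel" for t
    using measurable_compose[OF measurable_Pair1'[of t borel borel] gm[folded borel_prod]]
      measurable_compose[OF measurable_Pair1'[of t borel borel] Gam_meas[folded borel_prod]] by (auto simp: )
  have Hd: "\<bar>HGam g t x - HGam Gam t x\<bar> \<le> D" if t: "0 \<le> t" "t \<le> \<tau>" for t x
  proof -
    have i: "integrable lborel (\<lambda>z. (if z \<le> x - q0 then g t (x - z) else 1) * f z)"
      "integrable lborel (\<lambda>z. (if z \<le> x - q0 then Gam t (x - z) else 1) * f z)"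
      by (rule integrable_f_bounded[where B = 1], use gb in simp_all)
         (rule integrable_f_bounded[where B = "1 + \<tau> * CB"], use Gb[OF t] \<tau> CB0 in simp_all)
    have "HGam g t x - HGam Gam t x = (LBINT z. ((if z \<le> x - q0 then g t (x - z) else 1) - (if z \<le> x - q0 then Gam t (x - z) else 1)) * f z)"
      unfolding HGam_def by (subst Bochner_Integration.integral_diff[OF i, symmetric]) (simp add: algebra_simps)
    also have "\<bar>\<dots>\<bar> \<le> D" by (rule f_integral_bound) (use D[OF t] D0 in auto)
    finally show ?thesis .
  qed
  note HGm = HGam_meas[OF gm] and HGm' = HGam_meas[OF Gam_meas]
  have Hgb: "\<bar>HGam g t x\<bar> \<le> 1" for t x
    unfolding HGam_def by (rule f_integral_bound) (use gb in auto)
  have HGb: "\<bar>HGam Gam t x\<bar> \<le> 1 + \<tau> * CB" if "0 \<le> t" "t \<le> \<tau>" for t x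
    unfolding HGam_def by (rule f_integral_bound) (use Gb[OF that] \<tau> CB0 in auto)
  have step: "\<bar>g t x - Gam t x\<bar> \<le> D * (lam / \<mu>)" if t: "0 \<le> t" "t \<le> \<tau>" and x: "q0 \<le> x" for t x
  proof -
    have i1: "integrable lborel (\<lambda>u. indicator {..t} u * (E u * HGam g (t - u) (exp (r * u) * x)))"
      by (rule integrable_E_bound[where B = 1])
         (use HGm mult_right_mono[OF Hgb E0] E0 in \<open>auto simp: indicator_def abs_mult mult.commute\<close>)
    have i2: "integrable lborel (\<lambda>u. indicator {..t} u * (E u * HGam Gam (t - u) (exp (r * u) * x)))"
    proof (rule integrable_E_bound[where B = "1 + \<tau> * CB"])
      fix u
      show "\<bar>indicator {..t} u * (E u * HGam Gam (t - u) (exp (r * u) * x))\<bar> \<le> (1 + \<tau> * CB) * E u"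
      proof (cases "0 \<le> u \<and> u \<le> t")
        case True
        then show ?thesis using mult_right_mono[OF HGb E0, of "t - u" "exp (r * u) * x" u] E0[of u] t
          by (auto simp: abs_mult mult.commute)
      next
        case False
        then have z: "indicator {..t} u * (E u * HGam Gam (t - u) (exp (r * u) * x)) = 0" by (auto simp: E_def indicator_def)
        show ?thesis unfolding z using E0[of u] \<tau> CB0 by simp
      qed
    qed (use HGm' in measurable)
    have "g t x - Gam t x = (LBINT u. indicator {..t} u * (E u * (HGam g (t - u) (exp (r * u) * x) - HGam Gam (t - u) (exp (r * u) * x))))"
      unfolding g[OF t(1) x] Gam_renewal[OF t(1) x] 
      using Bochner_Integration.integral_diff[OF i1 i2] by (simp add: algebra_simps)
    also have "\<bar>\<dots>\<bar> \<le> D * (lam / \<mu>)"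
    proof (rule E_integral_bound)
      fix u
      show "\<bar>indicator {..t} u * (E u * (HGam g (t - u) (exp (r * u) * x) - HGam Gam (t - u) (exp (r * u) * x)))\<bar> \<le> D * E u"
      proof (cases "0 \<le> u \<and> u \<le> t")
        case True
        then show ?thesis using mult_right_mono[OF Hd E0, of "t - u" "exp (r * u) * x" u] E0[of u] t
          by (auto simp: abs_mult mult.commute)
      next
        case False
        then have z: "indicator {..t} u * (E u * (HGam g (t - u) (exp (r * u) * x) - HGam Gam (t - u) (exp (r * u) * x))) = 0" by (auto simp: E_def indicator_def)
        show ?thesis unfolding z using E0[of u] D0 by simp
      qed
    qed (use HGm HGm' in measurable)
    finally show ?thesis .
  qed
  have "D \<le> D * (lam / \<mu>)"
    unfolding D_def by (rule cSUP_least) (use \<tau> q step in \<open>auto simp: A_def D_def\<close>)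
  then have "D * (1 - lam / \<mu>) \<le> 0" by (simp add: algebra_simps)
  moreover have "1 - lam / \<mu> > 0" using mu by simp
  ultimately have "D \<le> 0" by (simp add: mult_le_0_iff)
  with D[OF \<tau> order_refl q] show ?thesis by simp
qed

end

section \<open>The renewal equation in two variables\<close>

locale risk_2d = risk_params +
  fixes \<Phi> :: "real \<Rightarrow> real \<Rightarrow> real"
  assumes \<Phi>_meas: "(\<lambda>x. \<Phi> (fst x) (snd x)) \<in> borel_measurable (borel \<Otimes>\<^sub>M borel)"
    and \<Phi>_bound: "\<And>p q. \<bar>\<Phi> p q\<bar> \<le> 1"
    and \<Phi>_ruin: "\<And>p q. p < p0 \<Longrightarrow> q < q0 \<Longrightarrow> \<Phi> p q = 1"
    and \<Phi>_renewal: "\<And>p q. p \<ge> p0 \<or> q \<ge> q0 \<Longrightarrow>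
       \<Phi> p q = (LBINT t. E t * (LBINT z. \<Phi> (exp (r * t) * p - z) (exp (r * t) * q - z) * f z))"
    and \<Phi>_diag: "\<And>p q. q + d \<le> p \<Longrightarrow> \<Phi> p q = \<Phi> p (p - d)"
    and \<Phi>_left: "\<And>p q. p \<le> q \<Longrightarrow> \<Phi> p q = \<Phi> q q"
    and \<Phi>_near: "\<exists>c \<alpha>. \<alpha> > 0 \<and> (\<forall>p q. q \<ge> q0 \<longrightarrow> q < p \<longrightarrow> p \<le> q + d \<longrightarrow>
       \<bar>\<Phi> p q - \<Phi> q q\<bar> \<le> c * (p - q) powr (1 + \<alpha>))"
begin

definition H :: "real \<Rightarrow> real \<Rightarrow> real" where
  "H p q = (LBINT z. \<Phi> (p - z) (q - z) * f z)"

lemma \<Phi>_comp_meas [measurable (raw)]: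
  assumes [measurable]: "a \<in> borel_measurable N" "b \<in> borel_measurable N"
  shows "(\<lambda>x. \<Phi> (a x) (b x)) \<in> borel_measurable N"
  using measurable_compose[OF measurable_Pair[OF assms] \<Phi>_meas] by simp

lemma H_meas [measurable (raw)]:
  assumes [measurable]: "a \<in> borel_measurable N" "b \<in> borel_measurable N"
  shows "(\<lambda>x. H (a x) (b x)) \<in> borel_measurable N"
  unfolding H_def by measurable

lemma H_bound: "\<bar>H p q\<bar> \<le> 1"
  unfolding H_def by (rule f_integral_bound) (use \<Phi>_bound in auto)

text \<open>Starting on the line \<open>p = q + d\<close> the gap can only grow, and by
  \<open>\<Phi>_diag\<close> the value then depends on \<open>p\<close> alone, so the equation
  closes in one variable.\<close>

sublocale one: risk_switch r lam s p0 q0 f "\<lambda>p. \<Phi> p (p - d)"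
proof unfold_locales
  show "(\<lambda>p. \<Phi> p (p - d)) \<in> borel_measurable borel" by measurable
  show "\<bar>\<Phi> x (x - d)\<bar> \<le> 1" for x by (rule \<Phi>_bound)
  show "0 < p0" using p0 q0 by simp
  show "\<Phi> x (x - d) = 1" if "x < p0" for x using that \<Phi>_ruin by (simp add: d_def)
  fix x assume x: "p0 \<le> x"
  show "\<Phi> x (x - d) = (LBINT t. E t * conv (\<lambda>p. \<Phi> p (p - d)) (exp (r * t) * x))"
    unfolding \<Phi>_renewal[OF disjI1[OF x]] conv_def
  proof (intro Bochner_Integration.integral_cong refl)
    fix t
    show "E t * (LBINT z. \<Phi> (exp (r * t) * x - z) (exp (r * t) * (x - d) - z) * f z) =
      E t * (LBINT z. \<Phi> (exp (r * t) * x - z) (exp (r * t) * x - z - d) * f z)"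
    proof (cases "t \<ge> 0")
      case True
      have "\<Phi> (exp (r * t) * x - z) (exp (r * t) * (x - d) - z) = \<Phi> (exp (r * t) * x - z) (exp (r * t) * x - z - d)" for z
      proof (rule \<Phi>_diag)
        have "1 * d \<le> exp (r * t) * d" using True r d by (intro mult_right_mono) auto
        then show "exp (r * t) * (x - d) - z + d \<le> exp (r * t) * x - z" by (simp add: algebra_simps)
      qed
      then show ?thesis by simp
    qed (simp add: E_def)
  qed
qed

sublocale two: risk_1d r lam s p0 q0 f "\<lambda>q. \<Phi> q q" q0
proof unfold_locales
  show "(\<lambda>q. \<Phi> q q) \<in> borel_measurable borel" by measurable
  show "\<bar>\<Phi> x x\<bar> \<le> 1" for x by (rule \<Phi>_bound)
  show "0 < q0" using q0 by simp
  show "\<Phi> x x = 1" if "x < q0" for x using that \<Phi>_ruin p0 by simp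
  show "\<Phi> x x = (LBINT t. E t * conv (\<lambda>q. \<Phi> q q) (exp (r * t) * x))" if "q0 \<le> x" for x
    using \<Phi>_renewal[of x x] that by (simp add: conv_def)
qed

lemma \<Phi>_eq_two: "p \<le> q \<Longrightarrow> q \<ge> q0 \<Longrightarrow> \<Phi> p q = two.F q"
  using \<Phi>_left[of p q] two.\<phi>_eq_F[of q] by simp

lemma \<Phi>_eq_G:
  assumes "exp (r * t) * p \<ge> p0 \<or> exp (r * t) * q \<ge> q0"
  shows "\<Phi> (exp (r * t) * p) (exp (r * t) * q) = G (\<lambda>t. H (exp (r * t) * p) (exp (r * t) * q)) t"
  unfolding \<Phi>_renewal[OF assms] G_def H_def by (simp add: distrib_left exp_add mult_ac)

text \<open>Both sides solve the equation in \<open>Gam_unique\<close>. Up to the meeting time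
  \<open>p - z \<le> q - z + d\<close>, so a claim that ruins the second process ruins the first as
  well; at the meeting time the point has reached the line \<open>p = q + d\<close>, where
  \<open>\<Phi>\<close> is the one-dimensional \<open>F\<close>.\<close>

lemma \<Phi>_eq_Gam':
  assumes \<tau>: "\<tau> \<ge> 0" and q: "q \<ge> q0"
  shows "\<Phi> (q + d * exp (- (r * \<tau>))) q = one.Gam \<tau> q"
proof (rule one.Gam_unique[OF _ _ _ \<tau> q, of "\<lambda>\<tau> q. \<Phi> (q + d * exp (- (r * \<tau>))) q"])
  show "(\<lambda>x. \<Phi> (snd x + d * exp (- (r * fst x))) (snd x)) \<in> borel_measurable borel"
    unfolding borel_prod[symmetric] by measurable
  show "\<bar>\<Phi> (q + d * exp (- (r * \<tau>))) q\<bar> \<le> 1" for \<tau> q by (rule \<Phi>_bound)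
  fix \<tau> q :: real assume \<tau>: "\<tau> \<ge> 0" and q: "q \<ge> q0"
  define p where "p = q + d * exp (- (r * \<tau>))"
  let ?k = "\<lambda>t. H (exp (r * t) * p) (exp (r * t) * q)"
  have q1: "exp (r * \<tau>) * q \<ge> q0"
    using mult_mono[of 1 "exp (r * \<tau>)" q0 q] q q0 \<tau> r by auto
  have ep: "exp (r * \<tau>) * p = d + exp (r * \<tau>) * q"
    by (simp add: p_def distrib_left exp_minus field_simps)
  have "\<Phi> p q = G ?k 0" using \<Phi>_eq_G[of 0 p q] q by simp
  also have "\<dots> = (LBINT u. indicator {0..\<tau>} u * (lam * exp (- (\<mu> * u)) * ?k u)) + exp (- (\<mu> * \<tau>)) * G ?k \<tau>"
    by (rule G_split[where B = 1]) (use \<tau> H_bound in auto)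
  also have "G ?k \<tau> = one.F (d + exp (r * \<tau>) * q)"
  proof -
    have "G ?k \<tau> = \<Phi> (exp (r * \<tau>) * p) (exp (r * \<tau>) * q)" using \<Phi>_eq_G[of \<tau> p q] q1 by simp
    also have "\<dots> = \<Phi> (d + exp (r * \<tau>) * q) (d + exp (r * \<tau>) * q - d)" unfolding ep by simp
    also have "\<dots> = one.F (d + exp (r * \<tau>) * q)" by (rule one.\<phi>_eq_F) (use q1 in \<open>simp add: d_def\<close>)
    finally show ?thesis .
  qed
  also have "(LBINT u. indicator {0..\<tau>} u * (lam * exp (- (\<mu> * u)) * ?k u))
     = (LBINT t. indicator {..\<tau>} t * (E t * one.HGam (\<lambda>\<tau> q. \<Phi> (q + d * exp (- (r * \<tau>))) q) (\<tau> - t) (exp (r * t) * q)))"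
  proof (intro Bochner_Integration.integral_cong refl)
    fix t
    show "indicator {0..\<tau>} t * (lam * exp (- (\<mu> * t)) * ?k t) =
      indicator {..\<tau>} t * (E t * one.HGam (\<lambda>\<tau> q. \<Phi> (q + d * exp (- (r * \<tau>))) q) (\<tau> - t) (exp (r * t) * q))"
    proof (cases "0 \<le> t \<and> t \<le> \<tau>")
      case True
      have "?k t = one.HGam (\<lambda>\<tau> q. \<Phi> (q + d * exp (- (r * \<tau>))) q) (\<tau> - t) (exp (r * t) * q)"
        unfolding H_def one.HGam_def
      proof (intro Bochner_Integration.integral_cong refl arg_cong2[where f = times])
        fix z
        have "exp (r * t) * exp (- (r * \<tau>)) = exp (- (r * (\<tau> - t)))"
          by (simp add: exp_add[symmetric] algebra_simps)
        then have e: "exp (r * t) * p - z = exp (r * t) * q - z + d * exp (- (r * (\<tau> - t)))"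
          by (simp add: p_def algebra_simps)
        have "d * exp (- (r * (\<tau> - t))) \<le> d * 1" using True r d by (intro mult_left_mono) auto
        then have le: "d * exp (- (r * (\<tau> - t))) \<le> d" by simp
        show "\<Phi> (exp (r * t) * p - z) (exp (r * t) * q - z) =
            (if z \<le> exp (r * t) * q - q0 then \<Phi> (exp (r * t) * q - z + d * exp (- (r * (\<tau> - t)))) (exp (r * t) * q - z) else 1)"
        proof (cases "z \<le> exp (r * t) * q - q0")
          case True
          then show ?thesis unfolding e by simp
        next
          case False
          then have "exp (r * t) * q - z < q0" by simp
          moreover have "exp (r * t) * p - z < p0" unfolding e using calculation le d_eq by linarith
          ultimately have "\<Phi> (exp (r * t) * p - z) (exp (r * t) * q - z) = 1" by (intro \<Phi>_ruin)
          then show ?thesis using False by (simp only: if_False)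
        qed
      qed
      then show ?thesis using True by (simp add: E_def)
    qed (auto simp: E_def indicator_def)
  qed
  finally show "\<Phi> (q + d * exp (- (r * \<tau>))) q = (LBINT t. indicator {..\<tau>} t * (E t * one.HGam (\<lambda>\<tau> q. \<Phi> (q + d * exp (- (r * \<tau>))) q) (\<tau> - t) (exp (r * t) * q))) + exp (- (\<mu> * \<tau>)) * one.F (d + exp (r * \<tau>) * q)"
    unfolding p_def .
qed

text \<open>The meeting time for the gap \<open>m\<close>, the solution \<open>t\<close> of
  \<open>m exp (r t) = d\<close>.\<close>

definition T :: "real \<Rightarrow> real" where "T m = ln (d / m) / r"

lemma T_nonneg: "0 < m \<Longrightarrow> m \<le> d \<Longrightarrow> T m \<ge> 0"
  using r by (simp add: T_def)

lemma \<Phi>_eq_Gam: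
  assumes "q \<ge> q0" "q < p" "p \<le> q + d"
  shows "\<Phi> p q = one.Gam (T (p - q)) q"
proof -
  have "d * exp (- (r * T (p - q))) = p - q"
    using assms r d by (simp add: T_def exp_minus)
  then show ?thesis using \<Phi>_eq_Gam'[OF T_nonneg assms(1), of "p - q"] assms by simp
qed

definition S :: "(real \<times> real) set" where "S = {(p, q). q0 \<le> q \<and> p \<le> q + d}"

text \<open>Left of \<open>p = q\<close> the value depends on \<open>q\<close> only, right of it
  \<open>\<Phi>\<close> is \<open>Gam\<close> at the meeting time, and \<open>\<Phi>_near\<close>,
  whose constants do not depend on \<open>q\<close>, joins the two across the line.\<close>

lemma \<Phi>_continuous:
  assumes "q0 \<le> q" "p \<le> q + d"
  shows "continuous (at (p, q) within S) (\<lambda>x. \<Phi> (fst x) (snd x))"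
proof -
  have evS: "\<forall>\<^sub>F x in at (p, q) within S. x \<in> S" by (simp add: eventually_at_filter)
  have q: "q > 0" using assms q0 by simp
  have lim: "((\<lambda>x. fst x - snd x) \<longlongrightarrow> fst (p, q) - snd (p, q)) (at (p, q) within S)" by (intro tendsto_intros)
  have F2: "((\<lambda>x. two.F (snd x)) \<longlongrightarrow> two.F q) (at (p, q) within S)"
    by (rule isCont_tendsto_compose[OF two.isCont_F[OF q]]) (rule tendsto_eq_intros, auto intro!: tendsto_eq_intros)
  consider "p < q" | "p = q" | "p > q" by linarith
  then have "((\<lambda>x. \<Phi> (fst x) (snd x)) \<longlongrightarrow> \<Phi> p q) (at (p, q) within S)"
  proof cases
    case 1
    then have "\<forall>\<^sub>F x in at (p, q) within S. fst x - snd x < 0" using lim by (intro order_tendstoD) auto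
    then have "\<forall>\<^sub>F x in at (p, q) within S. two.F (snd x) = \<Phi> (fst x) (snd x)"
      using evS by eventually_elim (auto simp: S_def \<Phi>_eq_two)
    from Lim_transform_eventually[OF F2 this] show ?thesis using 1 assms by (simp add: \<Phi>_eq_two)
  next
    case 2
    obtain c \<alpha> where \<alpha>: "\<alpha> > 0" and c: "\<And>p q. q \<ge> q0 \<Longrightarrow> q < p \<Longrightarrow> p \<le> q + d \<Longrightarrow> \<bar>\<Phi> p q - \<Phi> q q\<bar> \<le> c * (p - q) powr (1 + \<alpha>)"
      using \<Phi>_near by blast
    have "((\<lambda>x. \<Phi> (fst x) (snd x) - two.F (snd x)) \<longlongrightarrow> 0) (at (p, q) within S)"
    proof (rule Lim_null_comparison)
      show "\<forall>\<^sub>F x in at (p, q) within S. norm (\<Phi> (fst x) (snd x) - two.F (snd x)) \<le> \<bar>c\<bar> * (max 0 (fst x - snd x)) powr (1 + \<alpha>)"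
        using evS
      proof eventually_elim
        case (elim x)
        then have x: "snd x \<ge> q0" "fst x \<le> snd x + d" by (auto simp: S_def)
        show ?case
        proof (cases "fst x \<le> snd x")
          case True
          then show ?thesis using x by (simp add: \<Phi>_eq_two)
        next
          case False
          then have "\<bar>\<Phi> (fst x) (snd x) - two.F (snd x)\<bar> \<le> c * (fst x - snd x) powr (1 + \<alpha>)"
            using c[of "snd x" "fst x"] x two.\<phi>_eq_F[of "snd x"] by simp
          also have "\<dots> \<le> \<bar>c\<bar> * (fst x - snd x) powr (1 + \<alpha>)" by (intro mult_right_mono) auto
          finally show ?thesis using False by (simp add: max_absorb2)
        qed
      qed
      have m0: "((\<lambda>x. max 0 (fst x - snd x)) \<longlongrightarrow> max 0 (fst (p, q) - snd (p, q))) (at (p, q) within S)"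
        by (intro tendsto_intros)
      have "((\<lambda>x. \<bar>c\<bar> * (max 0 (fst x - snd x)) powr (1 + \<alpha>)) \<longlongrightarrow> \<bar>c\<bar> * (max 0 (fst (p, q) - snd (p, q))) powr (1 + \<alpha>)) (at (p, q) within S)"
        by (intro tendsto_mult tendsto_const tendsto_powr' m0) (use \<alpha> in auto)
      then show "((\<lambda>x. \<bar>c\<bar> * (max 0 (fst x - snd x)) powr (1 + \<alpha>)) \<longlongrightarrow> 0) (at (p, q) within S)"
        using 2 by simp
    qed
    from tendsto_add[OF this F2] show ?thesis using 2 assms by (simp add: \<Phi>_eq_two)
  next
    case 3
    then have "\<forall>\<^sub>F x in at (p, q) within S. fst x - snd x > 0" using lim by (intro order_tendstoD) auto
    then have ev: "\<forall>\<^sub>F x in at (p, q) within S. one.Gam (T (fst x - snd x)) (snd x) = \<Phi> (fst x) (snd x)"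
      using evS by eventually_elim (auto simp: S_def \<Phi>_eq_Gam)
    have "((\<lambda>x. (T (fst x - snd x), snd x)) \<longlongrightarrow> (T (fst (p, q) - snd (p, q)), snd (p, q))) (at (p, q) within S)"
      unfolding T_def by (intro tendsto_intros) (use 3 d r in auto)
    moreover have "isCont (\<lambda>x. one.Gam (fst x) (snd x)) (T (fst (p, q) - snd (p, q)), snd (p, q))"
      by (rule one.Gam_continuous) (use q d in simp)
    ultimately have "((\<lambda>x. one.Gam (T (fst x - snd x)) (snd x)) \<longlongrightarrow> one.Gam (T (p - q)) q) (at (p, q) within S)"
      using isCont_tendsto_compose[of "(T (fst (p, q) - snd (p, q)), snd (p, q))" "\<lambda>x. one.Gam (fst x) (snd x)"] by fastforce
    from Lim_transform_eventually[OF this ev] show ?thesis using 3 assms by (simp add: \<Phi>_eq_Gam)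
  qed
  then show ?thesis by (simp add: continuous_within)
qed

definition S' :: "(real \<times> real) set" where "S' = {(p, q). p \<le> q + d}"

text \<open>\<open>\<Phi>\<close> may jump at the level \<open>q0\<close>, but at a given point this
  concerns the single claim size \<open>z = q - q0\<close>, a null set. Hence continuity on
  \<open>S'\<close>, without the constraint \<open>q0 \<le> q\<close> of \<open>S\<close>.\<close>

lemma H_continuous:
  assumes pq: "p \<le> q + d"
  shows "continuous (at (p, q) within S') (\<lambda>x. H (fst x) (snd x))"
  unfolding H_def
proof (rule continuous_within_integral[where w = f])
  show "AE z in lborel. \<bar>\<Phi> (fst x - z) (snd x - z) * f z\<bar> \<le> f z" for x
    using mult_right_mono[OF \<Phi>_bound f0] f0 by (auto simp: abs_mult)
  show "AE z in lborel. continuous (at (p, q) within S') (\<lambda>x. \<Phi> (fst x - z) (snd x - z) * f z)"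
    using AE_lborel_singleton[of "q - q0"]
  proof eventually_elim
    case (elim z)
    have lim: "((\<lambda>x. snd x - z) \<longlongrightarrow> snd (p, q) - z) (at (p, q) within S')" by (intro tendsto_intros)
    have evS: "\<forall>\<^sub>F x in at (p, q) within S'. x \<in> S'" by (simp add: eventually_at_filter)
    have "((\<lambda>x. \<Phi> (fst x - z) (snd x - z)) \<longlongrightarrow> \<Phi> (p - z) (q - z)) (at (p, q) within S')"
    proof (cases "z < q - q0")
      case True
      then have "\<forall>\<^sub>F x in at (p, q) within S'. snd x - z > q0" using lim by (intro order_tendstoD) auto
      then have ev: "\<forall>\<^sub>F x in at (p, q) within S'. (fst x - z, snd x - z) \<in> S"
        using evS by eventually_elim (auto simp: S_def S'_def)
      have lim2: "((\<lambda>x. (fst x - z, snd x - z)) \<longlongrightarrow> (fst (p, q) - z, snd (p, q) - z)) (at (p, q) within S')" 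
        by (intro tendsto_intros)
      have c: "continuous (at (p - z, q - z) within S) (\<lambda>x. \<Phi> (fst x) (snd x))"
        by (rule \<Phi>_continuous) (use True pq in auto)
      from continuous_within_tendsto_compose[OF c ev] lim2 show ?thesis by simp
    next
      case False
      then have z: "q - z < q0" using elim by simp
      then have "\<forall>\<^sub>F x in at (p, q) within S'. snd x - z < q0" using lim by (intro order_tendstoD) auto
      then have "\<forall>\<^sub>F x in at (p, q) within S'. 1 = \<Phi> (fst x - z) (snd x - z)"
        using evS
      proof eventually_elim
        case (elim x)
        then have "fst x - z < p0" using d_eq by (auto simp: S'_def)
        with elim show ?case by (intro \<Phi>_ruin[symmetric])
      qed
      from Lim_transform_eventually[OF tendsto_const this]
      have ev1: "((\<lambda>x. \<Phi> (fst x - z) (snd x - z)) \<longlongrightarrow> 1) (at (p, q) within S')" .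
      have "p - z < p0" using z pq d_eq by linarith
      from \<Phi>_ruin[OF this z] show ?thesis using ev1 by simp
    qed
    then show ?case by (simp add: continuous_within) (intro tendsto_intros)
  qed
qed (use pq f_int in \<open>auto simp: S'_def\<close>)

text \<open>The chain rule for \<open>Gam (T (p - q)) q\<close>, where \<open>T\<close> has the
  derivative \<open>- 1 / (r m)\<close>. On \<open>p = q\<close> both one-sided derivatives are
  0.\<close>

definition A1 :: "real \<Rightarrow> real \<Rightarrow> real" where
  "A1 p q = (if p \<le> q then 0 else one.C (T (p - q), q) * (- 1 / (r * (p - q))))"

lemma \<Phi>_derivative_1:
  assumes q: "q0 \<le> q" and p: "p \<le> q + d"
  shows "((\<lambda>x. \<Phi> x q) has_real_derivative A1 p q) (at p within {..q + d})"
proof -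
  consider "p < q" | "p = q" | "p > q" by linarith
  then show ?thesis
  proof cases
    case 1
    have "((\<lambda>x. two.F q) has_real_derivative 0) (at p within {..q + d})" by simp
    then have "((\<lambda>x. \<Phi> x q) has_real_derivative 0) (at p within {..q + d})"
      by (rule has_field_derivative_transform_within[where d = "q - p"])
         (use 1 q p in \<open>auto simp: dist_real_def \<Phi>_eq_two\<close>)
    then show ?thesis using 1 by (simp add: A1_def)
  next
    case 2
    obtain c \<alpha> where \<alpha>: "\<alpha> > 0" and c: "\<And>p q. q \<ge> q0 \<Longrightarrow> q < p \<Longrightarrow> p \<le> q + d \<Longrightarrow> \<bar>\<Phi> p q - \<Phi> q q\<bar> \<le> c * (p - q) powr (1 + \<alpha>)"
      using \<Phi>_near by blast
    \<comment> \<open>Dividing the estimate of order \<open>1 + \<alpha>\<close> by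
      \<open>x - p\<close> leaves the power \<open>\<alpha> > 0\<close>, which tends to 0.\<close>
    have "((\<lambda>x. (\<Phi> x q - \<Phi> p q) / (x - p)) \<longlongrightarrow> 0) (at p within {..q + d})"
    proof (rule Lim_null_comparison)
      have "\<forall>\<^sub>F x in at p within {..q + d}. x \<in> {..q + d} \<and> x \<noteq> p" by (simp add: eventually_at_filter)
      then show "\<forall>\<^sub>F x in at p within {..q + d}. norm ((\<Phi> x q - \<Phi> p q) / (x - p)) \<le> \<bar>c\<bar> * (max 0 (x - p)) powr \<alpha>"
      proof eventually_elim
        case (elim x)
        show ?case
        proof (cases "x \<le> p")
          case True
          then show ?thesis using \<Phi>_left[of x q] 2 by simp
        next
          case False
          then have "\<bar>\<Phi> x q - \<Phi> p q\<bar> \<le> c * (x - p) powr (1 + \<alpha>)" using c[OF q, of x] elim 2 by simp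
          also have "\<dots> \<le> \<bar>c\<bar> * (x - p) powr (1 + \<alpha>)" by (intro mult_right_mono) auto
          also have "\<dots> = \<bar>c\<bar> * (x - p) powr \<alpha> * (x - p)" using False by (simp add: powr_add)
          finally show ?thesis using False by (simp add: abs_divide max_absorb2 divide_le_eq)
        qed
      qed
      have m0: "((\<lambda>x. max 0 (x - p)) \<longlongrightarrow> max 0 (p - p)) (at p within {..q + d})" by (intro tendsto_intros)
      have "((\<lambda>x. \<bar>c\<bar> * (max 0 (x - p)) powr \<alpha>) \<longlongrightarrow> \<bar>c\<bar> * (max 0 (p - p)) powr \<alpha>) (at p within {..q + d})"
        by (intro tendsto_mult tendsto_const tendsto_powr' m0) (use \<alpha> in auto)
      then show "((\<lambda>x. \<bar>c\<bar> * (max 0 (x - p)) powr \<alpha>) \<longlongrightarrow> 0) (at p within {..q + d})" by simp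
    qed
    then show ?thesis using 2 by (simp add: A1_def has_field_derivative_iff)
  next
    case 3
    let ?I = "{q<..q + d}"
    have "((\<lambda>x. T (x - q)) has_real_derivative - 1 / (r * (p - q))) (at p within ?I)"
    proof (rule has_field_derivative_transform_within[of "\<lambda>x. (ln d - ln (x - q)) / r" _ _ _ 1])
      show "((\<lambda>x. (ln d - ln (x - q)) / r) has_real_derivative - 1 / (r * (p - q))) (at p within ?I)"
        using 3 r by (auto intro!: derivative_eq_intros simp: field_simps)
    qed (use 3 p d in \<open>auto simp: T_def ln_div\<close>)
    moreover have "((\<lambda>\<tau>. one.Gam \<tau> q) has_real_derivative one.C (T (p - q), q)) (at (T (p - q)) within (\<lambda>x. T (x - q)) ` ?I)"
      by (rule has_field_derivative_subset[OF one.Gam_derivative]) (use 3 p T_nonneg in auto)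
    ultimately have "((\<lambda>\<tau>. one.Gam \<tau> q) \<circ> (\<lambda>x. T (x - q)) has_real_derivative one.C (T (p - q), q) * (- 1 / (r * (p - q)))) (at p within ?I)"
      by (rule DERIV_image_chain[rotated])
    then have D: "((\<lambda>x. one.Gam (T (x - q)) q) has_real_derivative A1 p q) (at p within ?I)"
      using 3 by (simp add: o_def A1_def)
    have "((\<lambda>x. \<Phi> x q) has_real_derivative A1 p q) (at p within ?I)"
      by (rule has_field_derivative_transform_within[OF D, of 1]) (use 3 p q in \<open>auto simp: \<Phi>_eq_Gam\<close>)
    moreover have "at p within ?I = at p within {..q + d}"
      by (rule at_within_nhd[of _ "{q<..}"]) (use 3 in auto)
    ultimately show ?thesis by simp
  qed
qed

text \<open>The time derivative of \<open>\<Phi>\<close> along the flow, obtained from the renewal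
  equation without any partial derivatives.\<close>

definition \<Psi> :: "real \<times> real \<Rightarrow> real" where
  "\<Psi> x = \<mu> * \<Phi> (fst x) (snd x) - lam * H (fst x) (snd x)"

lemma \<Psi>_continuous: 
  assumes "q0 \<le> q" "p \<le> q + d" shows "continuous (at (p, q) within S) \<Psi>"
proof -
  have "continuous (at (p, q) within S) (\<lambda>x. H (fst x) (snd x))"
    by (rule continuous_within_subset[OF H_continuous]) (use assms in \<open>auto simp: S_def S'_def\<close>)
  then show ?thesis unfolding \<Psi>_def by (intro continuous_intros \<Phi>_continuous assms)
qed

lemma ray_in_S:
  assumes "(p, q) \<in> S" "(v * p, v * q) \<in> S" "\<xi> \<in> closed_segment 1 v"
  shows "(\<xi> * p, \<xi> * q) \<in> S"
proof -
  obtain u where u: "0 \<le> u" "u \<le> 1" "\<xi> = (1 - u) * 1 + u * v"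
    using assms(3) by (auto simp: closed_segment_def)
  have "(1 - u) * q0 + u * q0 \<le> (1 - u) * q + u * (v * q)"
    using assms u by (intro add_mono mult_left_mono) (auto simp: S_def)
  moreover have "(1 - u) * p + u * (v * p) \<le> (1 - u) * (q + d) + u * (v * q + d)"
    using assms u by (intro add_mono mult_left_mono) (auto simp: S_def)
  ultimately show ?thesis by (simp add: S_def u(3) algebra_simps)
qed

text \<open>On a ray \<open>\<Phi>\<close> is the function \<open>G k\<close> of time, with
  derivative \<open>\<Psi>\<close>, and \<open>v = exp (r \<tau>)\<close> translates between scaling
  and time. Factors \<open>v < 1\<close> are included because a derivative in \<open>q\<close>
  approaches from both sides.\<close>

lemma flow_mean_value:
  assumes S: "(p, q) \<in> S" "(v * p, v * q) \<in> S" and v: "v > 0"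
  shows "\<exists>\<xi>\<in>closed_segment 1 v. \<Phi> (v * p) (v * q) - \<Phi> p q = ln v / r * \<Psi> (\<xi> * p, \<xi> * q)"
proof -
  define k where "k = (\<lambda>t. H (exp (r * t) * p) (exp (r * t) * q))"
  have km [measurable]: "k \<in> borel_measurable borel" unfolding k_def by measurable
  have kb: "\<bar>k t\<bar> \<le> 1" for t unfolding k_def by (rule H_bound)
  define \<tau> where "\<tau> = ln v / r"
  have ev: "exp (r * \<tau>) = v" using r v by (simp add: \<tau>_def)
  have seg: "exp (r * t) \<in> closed_segment 1 v" if "t \<in> closed_segment 0 \<tau>" for t
    proof (cases "0 \<le> \<tau>")
      case True
      then have t: "0 \<le> t" "t \<le> \<tau>" using that by (auto simp: closed_segment_eq_real_ivl)
      then have "1 \<le> exp (r * t)" "exp (r * t) \<le> exp (r * \<tau>)" using r by auto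
      then have "exp (r * t) \<in> {1..v}" "1 \<le> v" unfolding ev by (auto simp del: one_le_exp_iff intro: order_trans)
      then show ?thesis unfolding closed_segment_eq_real_ivl by (simp only: if_True)
    next
      case False
      then have t: "t \<le> 0" "\<tau> \<le> t" using that by (auto simp: closed_segment_eq_real_ivl split: if_splits)
      then have "exp (r * t) \<le> 1" "exp (r * \<tau>) \<le> exp (r * t)" using r by (auto simp: mult_nonneg_nonpos)
      then have "exp (r * t) \<in> {v..1}" "v \<le> 1" unfolding ev by (auto simp del: exp_le_one_iff intro: order_trans)
      then show ?thesis unfolding closed_segment_eq_real_ivl by (cases "v = 1") auto
    qed
  have inS: "(exp (r * t) * p, exp (r * t) * q) \<in> S" if "t \<in> closed_segment 0 \<tau>" for t
    by (rule ray_in_S[OF S seg[OF that]])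
  have \<Phi>G: "\<Phi> (exp (r * t) * p) (exp (r * t) * q) = G k t" if "t \<in> closed_segment 0 \<tau>" for t
    unfolding k_def using inS[OF that] by (intro \<Phi>_eq_G) (auto simp: S_def)
  have kc: "continuous_on (closed_segment 0 \<tau>) k"
    unfolding k_def continuous_on_def
  proof
    fix t assume t: "t \<in> closed_segment 0 \<tau>"
    have c: "continuous (at (exp (r * t) * p, exp (r * t) * q) within S') (\<lambda>x. H (fst x) (snd x))"
      by (rule H_continuous) (use inS[OF t] in \<open>auto simp: S_def\<close>)
    have "\<forall>\<^sub>F u in at t within closed_segment 0 \<tau>. u \<in> closed_segment 0 \<tau>" by (simp add: eventually_at_filter)
    then have ev: "\<forall>\<^sub>F u in at t within closed_segment 0 \<tau>. (exp (r * u) * p, exp (r * u) * q) \<in> S'"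
      by eventually_elim (use inS in \<open>auto simp: S_def S'_def\<close>)
    have "((\<lambda>u. (exp (r * u) * p, exp (r * u) * q)) \<longlongrightarrow> (exp (r * t) * p, exp (r * t) * q)) (at t within closed_segment 0 \<tau>)"
      by (intro tendsto_intros)
    from continuous_within_tendsto_compose[OF c ev this]
    show "((\<lambda>u. H (exp (r * u) * p) (exp (r * u) * q)) \<longlongrightarrow> H (exp (r * t) * p) (exp (r * t) * q)) (at t within closed_segment 0 \<tau>)"
      by simp
  qed
  have mvt: "\<exists>z. a < z \<and> z < b \<and> G k b - G k a = (b - a) * (\<mu> * G k z - lam * k z)"
    if ab: "a < b" "{a..b} = closed_segment 0 \<tau>" for a b
  proof -
    have der: "(G k has_real_derivative \<mu> * G k x - lam * k x) (at x)" if "a < x" "x < b" for x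
      by (rule G_derivative[OF km kb that]) (use kc ab in simp)
    have cG: "continuous_on {a..b} (G k)"
      using isCont_G[OF km kb] by (simp add: continuous_at_imp_continuous_on)
    have "G k differentiable (at x)" if "a < x" "x < b" for x
      using der[OF that] unfolding real_differentiable_def by blast
    from MVT[OF ab(1) cG this] obtain l z where
      lz: "a < z" "z < b" "DERIV (G k) z :> l" "G k b - G k a = (b - a) * l" by blast
    have "l = \<mu> * G k z - lam * k z" by (rule DERIV_unique[OF lz(3) der[OF lz(1,2)]])
    with lz show ?thesis by blast
  qed
  have "\<exists>z \<in> closed_segment 0 \<tau>. G k \<tau> - G k 0 = \<tau> * (\<mu> * G k z - lam * k z)"
  proof -
    consider "\<tau> = 0" | "\<tau> > 0" | "\<tau> < 0" by linarith
    then show ?thesis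
    proof cases
      case 2
      have e: "{0..\<tau>} = closed_segment 0 \<tau>" using 2 by (simp add: closed_segment_eq_real_ivl)
      from mvt[OF 2 e] obtain z where "0 < z" "z < \<tau>" "G k \<tau> - G k 0 = (\<tau> - 0) * (\<mu> * G k z - lam * k z)" by blast
      then have "z \<in> closed_segment 0 \<tau>" "G k \<tau> - G k 0 = \<tau> * (\<mu> * G k z - lam * k z)"
        unfolding e[symmetric] by auto
      then show ?thesis by blast
    next
      case 3
      have e: "{\<tau>..0} = closed_segment 0 \<tau>" using 3 by (simp add: closed_segment_eq_real_ivl)
      from mvt[OF 3 e] obtain z where "\<tau> < z" "z < 0" "G k 0 - G k \<tau> = (0 - \<tau>) * (\<mu> * G k z - lam * k z)" by blast
      then have "z \<in> closed_segment 0 \<tau>" "G k \<tau> - G k 0 = \<tau> * (\<mu> * G k z - lam * k z)"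
        unfolding e[symmetric] by auto
      then show ?thesis by blast
    next
      case 1
      then show ?thesis by (intro bexI[of _ 0]) simp_all
    qed
  qed
  then obtain z where z: "z \<in> closed_segment 0 \<tau>" "G k \<tau> - G k 0 = \<tau> * (\<mu> * G k z - lam * k z)" by blast
  have "\<Phi> (v * p) (v * q) - \<Phi> p q = ln v / r * \<Psi> (exp (r * z) * p, exp (r * z) * q)"
    using z(2) \<Phi>G[of \<tau>] \<Phi>G[of 0] \<Phi>G[OF z(1)] unfolding ev
    by (simp add: \<Psi>_def \<tau>_def k_def)
  then show ?thesis using seg[OF z(1)] by blast
qed

text \<open>From \<open>(p, q)\<close> to \<open>(p, y)\<close> one goes horizontally to \<open>(p q / y, q)\<close> and then along the flow, so
  the derivative in the second variable needs only the first partial derivative and the mean value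
  theorem along the flow.\<close>

lemma \<Phi>_derivative_2:
  assumes q: "q0 \<le> q" and p: "p \<le> q + d"
  shows "((\<lambda>y. \<Phi> p y) has_real_derivative \<Psi> (p, q) / (r * q) - A1 p q * (p / q)) (at q within {max q0 (p - d)..})"
proof -
  let ?Y = "{max q0 (p - d)..}"
  have qpos: "q > 0" using q q0 by simp
  have evY: "\<forall>\<^sub>F y in at q within ?Y. y \<in> ?Y \<and> y \<noteq> q" by (simp add: eventually_at_filter)
  obtain W where W: "open W" "q \<in> W" and Wsub: "\<And>y. y \<in> W \<Longrightarrow> y \<in> ?Y \<Longrightarrow> p * q / y \<le> q + d"
  proof (cases "p < q + d")
    case True
    have "((\<lambda>y. p * q / y) \<longlongrightarrow> p * q / q) (nhds q)" using qpos by (intro tendsto_intros) (auto intro: filterlim_ident)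
    then have "\<forall>\<^sub>F y in nhds q. p * q / y < q + d" using True qpos by (intro order_tendstoD) auto
    then obtain W where "open W" "q \<in> W" "\<forall>y\<in>W. p * q / y < q + d" unfolding eventually_nhds by blast
    then show ?thesis by (intro that[of W]) (auto intro: less_imp_le)
  next
    case False
    then have pe: "p = q + d" using p by simp
    show ?thesis
    proof (rule that[of UNIV])
      fix y assume "y \<in> ?Y"
      then have "q \<le> y" by (simp add: pe)
      then have "p * q / y \<le> p * q / q" using pe qpos d by (intro divide_left_mono) auto
      then show "p * q / y \<le> q + d" using pe qpos by simp
    qed auto
  qed
  have sec: "((\<lambda>y. \<Phi> (p * q / y) q) has_real_derivative A1 p q * - (p / q)) (at q within ?Y)"
  proof -
    have g: "((\<lambda>y. p * q / y) has_real_derivative - (p / q)) (at q within W \<inter> ?Y)"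
      using qpos by (auto intro!: derivative_eq_intros simp: field_simps)
    have "((\<lambda>x. \<Phi> x q) has_real_derivative A1 p q) (at (p * q / q) within (\<lambda>y. p * q / y) ` (W \<inter> ?Y))"
      by (rule has_field_derivative_subset[of _ _ _ "{..q + d}"]) (use \<Phi>_derivative_1[OF q p] Wsub qpos in auto)
    from DERIV_image_chain[OF this g] have "((\<lambda>y. \<Phi> (p * q / y) q) has_real_derivative A1 p q * - (p / q)) (at q within W \<inter> ?Y)"
      by (simp add: o_def)
    moreover have "at q within W \<inter> ?Y = at q within ?Y"
      by (rule at_within_nhd[OF W(2,1)]) auto
    ultimately show ?thesis by simp
  qed
  define R where "R y = \<Phi> p y - \<Phi> (p * q / y) q" for y
  have "\<exists>\<xi>. \<forall>y \<in> W \<inter> ?Y. \<xi> y \<in> closed_segment 1 (y / q) \<and> R y = ln (y / q) / r * \<Psi> (\<xi> y * (p * q / y), \<xi> y * q)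
     \<and> (\<xi> y * (p * q / y), \<xi> y * q) \<in> S"
  proof (intro bchoice ballI)
    fix y assume y: "y \<in> W \<inter> ?Y"
    have y0: "y > 0" using y q0 by auto
    have S1: "(p * q / y, q) \<in> S" using Wsub[of y] y q by (simp add: S_def)
    have e: "y / q * (p * q / y) = p" "y / q * q = y" using y0 qpos by auto
    have S2: "(y / q * (p * q / y), y / q * q) \<in> S" unfolding e using y by (auto simp: S_def)
    have "y / q > 0" using y0 qpos by simp
    from flow_mean_value[OF S1 S2 this] obtain \<xi> where \<xi>: "\<xi> \<in> closed_segment 1 (y / q)"
      "\<Phi> (y / q * (p * q / y)) (y / q * q) - \<Phi> (p * q / y) q = ln (y / q) / r * \<Psi> (\<xi> * (p * q / y), \<xi> * q)" by (elim bexE)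
    show "\<exists>\<xi>. \<xi> \<in> closed_segment 1 (y / q) \<and> R y = ln (y / q) / r * \<Psi> (\<xi> * (p * q / y), \<xi> * q) \<and> (\<xi> * (p * q / y), \<xi> * q) \<in> S"
    proof (intro exI conjI)
      show "\<xi> \<in> closed_segment 1 (y / q)" by (fact \<xi>(1))
      show "R y = ln (y / q) / r * \<Psi> (\<xi> * (p * q / y), \<xi> * q)" using \<xi>(2) unfolding e R_def .
      show "(\<xi> * (p * q / y), \<xi> * q) \<in> S" by (rule ray_in_S[OF S1 S2 \<xi>(1)])
    qed
  qed
  then obtain \<xi> where all: "\<forall>y \<in> W \<inter> ?Y. \<xi> y \<in> closed_segment 1 (y / q) \<and> R y = ln (y / q) / r * \<Psi> (\<xi> y * (p * q / y), \<xi> y * q)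
     \<and> (\<xi> y * (p * q / y), \<xi> y * q) \<in> S" by (rule exE)
  have \<xi>: "\<xi> y \<in> closed_segment 1 (y / q)" "R y = ln (y / q) / r * \<Psi> (\<xi> y * (p * q / y), \<xi> y * q)"
    "(\<xi> y * (p * q / y), \<xi> y * q) \<in> S" if "y \<in> W \<inter> ?Y" for y
    using bspec[OF all that] by simp_all
  have evW: "\<forall>\<^sub>F y in at q within ?Y. y \<in> W \<inter> ?Y \<and> y \<noteq> q"
  proof -
    have "\<forall>\<^sub>F y in at q within ?Y. y \<in> W"
      using eventually_nhds_in_open[OF W] by (rule filter_leD[OF at_le[of ?Y UNIV, THEN order_trans, OF _ at_within_le_nhds], rotated]) simp
    with evY show ?thesis by eventually_elim simp
  qed
  have lim\<xi>: "(\<xi> \<longlongrightarrow> 1) (at q within ?Y)"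
  proof -
    have "((\<lambda>y. \<xi> y - 1) \<longlongrightarrow> 0) (at q within ?Y)"
    proof (rule Lim_null_comparison)
      show "\<forall>\<^sub>F y in at q within ?Y. norm (\<xi> y - 1) \<le> \<bar>y / q - 1\<bar>"
        using evW
      proof eventually_elim
        case (elim y)
        then show ?case using \<xi>(1)[of y] by (auto simp: closed_segment_eq_real_ivl split: if_splits)
      qed
      have "((\<lambda>y. \<bar>y / q - 1\<bar>) \<longlongrightarrow> \<bar>q / q - 1\<bar>) (at q within ?Y)" using qpos by (intro tendsto_intros) auto
      then show "((\<lambda>y. \<bar>y / q - 1\<bar>) \<longlongrightarrow> 0) (at q within ?Y)" using qpos by simp
    qed
    then show ?thesis by (simp add: LIM_zero_iff)
  qed
  have lim\<Psi>: "((\<lambda>y. \<Psi> (\<xi> y * (p * q / y), \<xi> y * q)) \<longlongrightarrow> \<Psi> (p, q)) (at q within ?Y)"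
  proof (rule continuous_within_tendsto_compose[OF \<Psi>_continuous[OF q p]])
    show "\<forall>\<^sub>F y in at q within ?Y. (\<xi> y * (p * q / y), \<xi> y * q) \<in> S"
      using evW by eventually_elim (use \<xi>(3) in blast)
    have "((\<lambda>y. (\<xi> y * (p * q / y), \<xi> y * q)) \<longlongrightarrow> (1 * (p * q / q), 1 * q)) (at q within ?Y)"
      using qpos by (intro tendsto_intros lim\<xi>) auto
    then show "((\<lambda>y. (\<xi> y * (p * q / y), \<xi> y * q)) \<longlongrightarrow> (p, q)) (at q within ?Y)" using qpos by simp
  qed
  have limln: "((\<lambda>y. (ln y - ln q) / (y - q)) \<longlongrightarrow> 1 / q) (at q within ?Y)"
    using has_field_derivative_at_within[OF DERIV_ln_divide[OF qpos], of ?Y] by (simp add: has_field_derivative_iff)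
  have "((\<lambda>y. (ln y - ln q) / (y - q) / r * \<Psi> (\<xi> y * (p * q / y), \<xi> y * q)) \<longlongrightarrow> 1 / q / r * \<Psi> (p, q)) (at q within ?Y)"
    using r by (intro tendsto_intros limln lim\<Psi>) auto
  moreover have "\<forall>\<^sub>F y in at q within ?Y. (ln y - ln q) / (y - q) / r * \<Psi> (\<xi> y * (p * q / y), \<xi> y * q) = (R y - R q) / (y - q)"
    using evW
  proof eventually_elim
    case (elim y)
    then have "y > 0" using q0 by auto
    then show ?case using \<xi>(2)[of y] elim qpos by (simp add: R_def ln_div)
  qed
  ultimately have "((\<lambda>y. (R y - R q) / (y - q)) \<longlongrightarrow> 1 / q / r * \<Psi> (p, q)) (at q within ?Y)"
    by (rule Lim_transform_eventually)
  then have "(R has_real_derivative 1 / q / r * \<Psi> (p, q)) (at q within ?Y)" by (simp add: has_field_derivative_iff)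
  from DERIV_add[OF this sec] show ?thesis by (simp add: R_def mult.commute)
qed

text \<open>The terms with \<open>A1\<close> cancel, so that the sum is the flow derivative
  \<open>\<Psi> / r\<close>.\<close>

lemma \<Phi>_ide:
  assumes q: "q0 \<le> q"
  shows "p * A1 p q + q * (\<Psi> (p, q) / (r * q) - A1 p q * (p / q)) = (\<mu> / r) * \<Phi> p q - lam / r * H p q"
  using q q0 r by (simp add: \<Psi>_def field_simps)

end

section \<open>The sequence of claims\<close>

context risk_params
begin

definition D :: "(real \<times> real) measure" where
  "D = density lborel (\<lambda>t. ennreal (exponential_density lam t)) \<Otimes>\<^sub>M density lborel (\<lambda>z. ennreal (f z))"

lemma prob_space_claim: "prob_space (density lborel (\<lambda>z. ennreal (f z)))"
proof
  have "(\<integral>\<^sup>+z. ennreal (f z) \<partial>lborel) = ennreal (LBINT z. f z)"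
    by (rule nn_integral_eq_integral[OF f_int]) (simp add: f0)
  then show "emeasure (density lborel (\<lambda>z. ennreal (f z))) (space (density lborel (\<lambda>z. ennreal (f z)))) = 1"
    by (simp add: emeasure_density f1)
qed

lemma prob_space_D: "prob_space D"
proof -
  interpret A: prob_space "density lborel (\<lambda>t. ennreal (exponential_density lam t))"
    by (rule prob_space_exponential_density[OF lam])
  interpret B: prob_space "density lborel (\<lambda>z. ennreal (f z))" by (rule prob_space_claim)
  interpret pair_prob_space "density lborel (\<lambda>t. ennreal (exponential_density lam t))" "density lborel (\<lambda>z. ennreal (f z))" ..
  show ?thesis unfolding D_def by (rule prob_space_axioms)
qed

lemma sets_D [measurable_cong]: "sets D = sets (borel \<Otimes>\<^sub>M borel)"
  unfolding D_def by (intro sets_pair_measure_cong) auto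

lemma space_D [simp]: "space D = UNIV"
  using sets_eq_imp_space_eq[OF sets_D] by (simp add: space_pair_measure)

lemma nn_integral_D:
  assumes [measurable]: "g \<in> borel_measurable (borel \<Otimes>\<^sub>M borel)"
  shows "(\<integral>\<^sup>+x. g x \<partial>D) = (\<integral>\<^sup>+t. (\<integral>\<^sup>+z. ennreal (exponential_density lam t) * (ennreal (f z) * g (t, z)) \<partial>lborel) \<partial>lborel)"
proof -
  interpret B: prob_space "density lborel (\<lambda>z. ennreal (f z))" by (rule prob_space_claim)
  have "(\<integral>\<^sup>+x. g x \<partial>D) = (\<integral>\<^sup>+t. (\<integral>\<^sup>+z. g (t, z) \<partial>density lborel (\<lambda>z. ennreal (f z))) \<partial>density lborel (\<lambda>t. ennreal (exponential_density lam t)))"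
    unfolding D_def by (rule B.nn_integral_fst[symmetric]) measurable
  also have "\<dots> = (\<integral>\<^sup>+t. ennreal (exponential_density lam t) * (\<integral>\<^sup>+z. ennreal (f z) * g (t, z) \<partial>lborel) \<partial>lborel)"
    by (subst nn_integral_density) (auto simp: nn_integral_density)
  finally show ?thesis by (simp add: nn_integral_cmult)
qed

definition Sq :: "(nat \<Rightarrow> real \<times> real) measure" where "Sq = PiM UNIV (\<lambda>_. D)"

lemma sets_Sq [measurable_cong]: "sets Sq = sets (PiM UNIV (\<lambda>_. borel \<Otimes>\<^sub>M borel))"
  unfolding Sq_def by (intro sets_PiM_cong sets_D refl)

lemma space_Sq [simp]: "space Sq = UNIV"
  unfolding Sq_def by (simp add: space_PiM)

lemma prob_space_Sq: "prob_space Sq"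
  unfolding Sq_def by (intro prob_space_PiM prob_space_D)

text \<open>Conditioning on the first claim: \<open>case_nat x \<omega>\<close> puts the pair
  \<open>x\<close> in front of \<open>\<omega>\<close>, and the infinite product measure is
  preserved by this.\<close>

lemma nn_integral_Sq:
  assumes g: "g \<in> borel_measurable Sq"
  shows "(\<integral>\<^sup>+\<omega>. g \<omega> \<partial>Sq) = (\<integral>\<^sup>+x. (\<integral>\<^sup>+\<omega>. g (case_nat x \<omega>) \<partial>Sq) \<partial>D)"
proof -
  interpret d: prob_space D by (rule prob_space_D)
  interpret q: prob_space Sq by (rule prob_space_Sq)
  interpret s: sequence_space D ..
  have eq: "distr (D \<Otimes>\<^sub>M Sq) Sq (\<lambda>(x, \<omega>). case_nat x \<omega>) = Sq"
    using s.PiM_iter by (simp add: Sq_def)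
  have m: "(\<lambda>(x, \<omega>). case_nat x \<omega>) \<in> measurable (D \<Otimes>\<^sub>M Sq) Sq"
    unfolding Sq_def by measurable
  have "(\<integral>\<^sup>+\<omega>. g \<omega> \<partial>Sq) = (\<integral>\<^sup>+x. g (case x of (x, \<omega>) \<Rightarrow> case_nat x \<omega>) \<partial>(D \<Otimes>\<^sub>M Sq))"
    by (subst eq[symmetric], subst nn_integral_distr[OF m]) (simp_all add: g)
  also have "\<dots> = (\<integral>\<^sup>+x. (\<integral>\<^sup>+\<omega>. g (case_nat x \<omega>) \<partial>Sq) \<partial>D)"
    by (subst q.nn_integral_fst[symmetric]) (use measurable_compose[OF m g] in auto)
  finally show ?thesis .
qed

definition th :: "(nat \<Rightarrow> real \<times> real) \<Rightarrow> nat \<Rightarrow> real" where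
  "th \<omega> k = (\<Sum>i\<le>k. fst (\<omega> i))"

text \<open>The claims discounted to time 0. After division by \<open>exp (r t)\<close>, ruin of the
  first process at the claim with index \<open>k\<close> reads
  \<open>p < Dc + p0 exp (- r th)\<close>, and likewise with \<open>q\<close> and \<open>q0\<close>
  for the second.\<close>

definition Dc :: "(nat \<Rightarrow> real \<times> real) \<Rightarrow> nat \<Rightarrow> real" where
  "Dc \<omega> k = (\<Sum>i\<le>k. exp (- (r * th \<omega> i)) * snd (\<omega> i))"

definition rn :: "real \<Rightarrow> real \<Rightarrow> (nat \<Rightarrow> real \<times> real) \<Rightarrow> nat \<Rightarrow> bool" where
  "rn p q \<omega> k \<longleftrightarrow> p < Dc \<omega> k + p0 * exp (- (r * th \<omega> k)) \<and> q < Dc \<omega> k + q0 * exp (- (r * th \<omega> k))"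

definition Y :: "real \<Rightarrow> real \<Rightarrow> (nat \<Rightarrow> real \<times> real) \<Rightarrow> nat \<Rightarrow> ennreal" where
  "Y p q \<omega> k = (if rn p q \<omega> k then ennreal (exp (- (s * th \<omega> k))) else 0)"

text \<open>The supremum replaces the first ruin time: for nonnegative interarrival times
  \<open>exp (- s th)\<close> does not increase with the index, so the supremum is attained at the
  first claim that causes ruin. In this form measurability and monotonicity in the starting point
  need no stopping index.\<close>

definition J :: "real \<Rightarrow> real \<Rightarrow> (nat \<Rightarrow> real \<times> real) \<Rightarrow> ennreal" where
  "J p q \<omega> = (if p < p0 \<and> q < q0 then 1 else (SUP k. Y p q \<omega> k))"

lemma th_Suc: "th (case_nat x \<omega>) (Suc k) = fst x + th \<omega> k" and th_0: "th (case_nat x \<omega>) 0 = fst x"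
  unfolding th_def by (subst sum.atMost_Suc_shift, simp) simp

lemma Dc_Suc: "Dc (case_nat x \<omega>) (Suc k) = exp (- (r * fst x)) * (snd x + Dc \<omega> k)"
  and Dc_0: "Dc (case_nat x \<omega>) 0 = exp (- (r * fst x)) * snd x"
proof -
  show "Dc (case_nat x \<omega>) 0 = exp (- (r * fst x)) * snd x"
    by (simp add: Dc_def th_0)
  show "Dc (case_nat x \<omega>) (Suc k) = exp (- (r * fst x)) * (snd x + Dc \<omega> k)"
    unfolding Dc_def
    by (subst sum.atMost_Suc_shift)
       (simp add: th_0 th_Suc distrib_left exp_diff exp_minus sum_distrib_left divide_simps exp_add)
qed

lemma exp_scale_less: "(p < exp (- (r * w)) * a) \<longleftrightarrow> exp (r * w) * p < a"
  by (simp add: exp_minus field_simps)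

lemma rn_Suc: "rn p q (case_nat (w, z) \<omega>) (Suc k) \<longleftrightarrow> rn (exp (r * w) * p - z) (exp (r * w) * q - z) \<omega> k"
proof -
  have e: "exp (- (r * w)) * (z + Dc \<omega> k) + a * exp (- (r * (w + th \<omega> k)))
      = exp (- (r * w)) * (z + (Dc \<omega> k + a * exp (- (r * th \<omega> k))))" for a
    by (simp add: exp_add[symmetric] distrib_left algebra_simps)
  show ?thesis unfolding rn_def th_Suc Dc_Suc fst_conv snd_conv e exp_scale_less by (auto simp: algebra_simps)
qed

lemma rn_0: "rn p q (case_nat (w, z) \<omega>) 0 \<longleftrightarrow> exp (r * w) * p - z < p0 \<and> exp (r * w) * q - z < q0"
proof -
  have e: "exp (- (r * w)) * z + a * exp (- (r * w)) = exp (- (r * w)) * (z + a)" for a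
    by (simp add: algebra_simps)
  show ?thesis unfolding rn_def th_0 Dc_0 fst_conv snd_conv e exp_scale_less by (auto simp: algebra_simps)
qed

lemma SUP_nat_split: "(SUP k. g k) = sup (g 0) (SUP k. g (Suc k))" for g :: "nat \<Rightarrow> ennreal"
proof -
  have "range g = insert (g 0) (range (\<lambda>k. g (Suc k)))"
    by (auto simp: image_iff) (metis not0_implies_Suc)
  then show ?thesis by simp
qed

lemma Y_le_1: "(\<And>i. fst (\<omega> i) \<ge> 0) \<Longrightarrow> Y p q \<omega> k \<le> 1"
proof -
  assume "\<And>i. fst (\<omega> i) \<ge> 0"
  then have "th \<omega> k \<ge> 0" unfolding th_def by (intro sum_nonneg) auto
  then show ?thesis using s by (simp add: Y_def)
qed

lemma J_le_1: "(\<And>i. fst (\<omega> i) \<ge> 0) \<Longrightarrow> J p q \<omega> \<le> 1"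
  using Y_le_1 by (auto simp: J_def intro!: SUP_least)

text \<open>The renewal step on a single path. If the first claim causes ruin, the value 1 of
  \<open>J\<close> in the ruin quadrant accounts for it.\<close>

lemma J_shift:
  assumes nr: "\<not> (p < p0 \<and> q < q0)" and \<omega>: "\<And>i. fst (\<omega> i) \<ge> 0"
  shows "J p q (case_nat (w, z) \<omega>) = ennreal (exp (- (s * w))) * J (exp (r * w) * p - z) (exp (r * w) * q - z) \<omega>"
proof -
  let ?p = "exp (r * w) * p - z" and ?q = "exp (r * w) * q - z"
  have YS: "Y p q (case_nat (w, z) \<omega>) (Suc k) = ennreal (exp (- (s * w))) * Y ?p ?q \<omega> k" for k
    by (simp add: Y_def rn_Suc th_Suc distrib_left exp_diff exp_minus ennreal_mult[symmetric] divide_inverse exp_add)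
  have Y0: "Y p q (case_nat (w, z) \<omega>) 0 = (if ?p < p0 \<and> ?q < q0 then ennreal (exp (- (s * w))) else 0)"
    unfolding Y_def rn_0 th_0 fst_conv ..
  have S: "(SUP k. Y p q (case_nat (w, z) \<omega>) (Suc k)) = ennreal (exp (- (s * w))) * (SUP k. Y ?p ?q \<omega> k)"
    unfolding YS by (rule SUP_mult_left_ennreal[symmetric])
  have "J p q (case_nat (w, z) \<omega>) = sup (Y p q (case_nat (w, z) \<omega>) 0) (ennreal (exp (- (s * w))) * (SUP k. Y ?p ?q \<omega> k))"
    using nr unfolding J_def S[symmetric] by (subst SUP_nat_split) auto
  also have "\<dots> = ennreal (exp (- (s * w))) * J ?p ?q \<omega>"
  proof (cases "?p < p0 \<and> ?q < q0")
    case True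
    have "(SUP k. Y ?p ?q \<omega> k) \<le> 1" using Y_le_1[of \<omega>] \<omega> by (intro SUP_least) auto
    then have "ennreal (exp (- (s * w))) * (SUP k. Y ?p ?q \<omega> k) \<le> ennreal (exp (- (s * w))) * 1"
      by (intro mult_left_mono) auto
    then show ?thesis using True by (simp add: Y0 J_def sup_absorb1)
  next
    case False
    then have "Y p q (case_nat (w, z) \<omega>) 0 = 0" unfolding Y0 by simp
    moreover have "J ?p ?q \<omega> = (SUP k. Y ?p ?q \<omega> k)" unfolding J_def using False by (simp only: if_False)
    ultimately show ?thesis by (simp add: sup_absorb2)
  qed
  finally show ?thesis .
qed

lemma th_meas [measurable]: "(\<lambda>\<omega>. th \<omega> k) \<in> borel_measurable Sq"
  unfolding th_def by measurable

lemma Dc_meas [measurable]: "(\<lambda>\<omega>. Dc \<omega> k) \<in> borel_measurable Sq"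
  unfolding Dc_def by measurable

lemma J_meas [measurable (raw)]:
  assumes [measurable]: "a \<in> borel_measurable N" "b \<in> borel_measurable N" "c \<in> measurable N Sq"
  shows "(\<lambda>x. J (a x) (b x) (c x)) \<in> borel_measurable N"
proof -
  have [measurable]: "(\<lambda>x. th (c x) k) \<in> borel_measurable N" "(\<lambda>x. Dc (c x) k) \<in> borel_measurable N" for k
    using measurable_compose[OF assms(3) th_meas] measurable_compose[OF assms(3) Dc_meas] by auto
  show ?thesis unfolding J_def Y_def rn_def by measurable
qed

lemma AE_Sq_nonneg: "AE \<omega> in Sq. \<forall>i. fst (\<omega> i) \<ge> 0"
  unfolding AE_all_countable
proof
  fix i
  interpret A: prob_space "density lborel (\<lambda>t. ennreal (exponential_density lam t))"
    by (rule prob_space_exponential_density[OF lam])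
  interpret B: prob_space "density lborel (\<lambda>z. ennreal (f z))" by (rule prob_space_claim)
  interpret P: pair_prob_space "density lborel (\<lambda>t. ennreal (exponential_density lam t))" "density lborel (\<lambda>z. ennreal (f z))" ..
  have "AE x in density lborel (\<lambda>t. ennreal (exponential_density lam t)). 0 \<le> x"
    by (subst AE_density) (auto simp: exponential_density_def)
  then have "AE x in D. 0 \<le> fst x"
    unfolding D_def
  proof (intro P.AE_pair_measure)
    show "{x \<in> space (density lborel (\<lambda>t. ennreal (exponential_density lam t)) \<Otimes>\<^sub>M density lborel (\<lambda>z. ennreal (f z))). 0 \<le> fst x}
      \<in> sets (density lborel (\<lambda>t. ennreal (exponential_density lam t)) \<Otimes>\<^sub>M density lborel (\<lambda>z. ennreal (f z)))"
      by measurable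
  qed (auto elim!: eventually_mono)
  then show "AE \<omega> in Sq. 0 \<le> fst (\<omega> i)"
    unfolding Sq_def by (intro AE_PiM_component[where M = "\<lambda>_. D"] prob_space_D) auto
qed

definition \<Phi>E :: "real \<Rightarrow> real \<Rightarrow> ennreal" where "\<Phi>E p q = (\<integral>\<^sup>+\<omega>. J p q \<omega> \<partial>Sq)"

definition \<Phi> :: "real \<Rightarrow> real \<Rightarrow> real" where "\<Phi> p q = enn2real (\<Phi>E p q)"

lemma \<Phi>E_le_1: "\<Phi>E p q \<le> 1"
proof -
  interpret prob_space Sq by (rule prob_space_Sq)
  have "\<Phi>E p q \<le> (\<integral>\<^sup>+\<omega>. 1 \<partial>Sq)"
    unfolding \<Phi>E_def by (rule nn_integral_mono_AE) (use AE_Sq_nonneg in \<open>auto elim!: eventually_mono intro: J_le_1\<close>)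
  then show ?thesis using emeasure_space_1 by simp
qed

lemma \<Phi>E_eq: "\<Phi>E p q = ennreal (\<Phi> p q)"
  unfolding \<Phi>_def using le_less_trans[OF \<Phi>E_le_1 ennreal_one_less_top] by simp

lemma \<Phi>_nonneg: "\<Phi> p q \<ge> 0" and \<Phi>_le_1: "\<Phi> p q \<le> 1"
proof -
  show "\<Phi> p q \<ge> 0" by (simp add: \<Phi>_def)
  show "\<Phi> p q \<le> 1" using \<Phi>E_le_1[of p q] unfolding \<Phi>E_eq by simp
qed

lemma \<Phi>E_meas: "(\<lambda>x. \<Phi>E (fst x) (snd x)) \<in> borel_measurable (borel \<Otimes>\<^sub>M borel)"
proof -
  interpret prob_space Sq by (rule prob_space_Sq)
  show ?thesis unfolding \<Phi>E_def by measurable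
qed

lemma \<Phi>_meas0: "(\<lambda>x. \<Phi> (fst x) (snd x)) \<in> borel_measurable (borel \<Otimes>\<^sub>M borel)"
  unfolding \<Phi>_def using \<Phi>E_meas by measurable

lemma E_eq: "E t = exponential_density lam t * exp (- (s * t))"
  by (auto simp: E_def exponential_density_def \<mu>_def indicator_def exp_add[symmetric] algebra_simps)

lemma \<Phi>_meas_comp [measurable (raw)]:
  assumes "a \<in> borel_measurable N" "b \<in> borel_measurable N"
  shows "(\<lambda>x. \<Phi> (a x) (b x)) \<in> borel_measurable N"
  using measurable_compose[OF measurable_Pair[OF assms] \<Phi>_meas0] by simp

text \<open>The path identity \<open>J_shift\<close> is averaged over the first pair; the
  exponential density times \<open>exp (- s t)\<close> is the kernel \<open>E\<close>.\<close>

lemma \<Phi>_renewal0: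
  assumes nr: "p \<ge> p0 \<or> q \<ge> q0"
  shows "\<Phi> p q = (LBINT t. E t * (LBINT z. \<Phi> (exp (r * t) * p - z) (exp (r * t) * q - z) * f z))"
proof -
  let ?\<Phi> = "\<lambda>t z. \<Phi> (exp (r * t) * p - z) (exp (r * t) * q - z)"
  have b: "\<bar>\<Phi> a b\<bar> \<le> 1" for a b using \<Phi>_nonneg \<Phi>_le_1 by (simp add: abs_le_iff order_trans[of _ 0])
  define H where "H t = (LBINT z. ?\<Phi> t z * f z)" for t
  have H0: "H t \<ge> 0" for t unfolding H_def by (intro integral_nonneg_AE) (auto simp: \<Phi>_nonneg f0)
  have Hb: "\<bar>H t\<bar> \<le> 1" for t
    unfolding H_def by (rule f_integral_bound[OF _ b]) measurable
  have Hm [measurable]: "H \<in> borel_measurable borel" unfolding H_def by measurable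
  have inner: "(\<integral>\<^sup>+z. ennreal (f z) * ennreal (?\<Phi> t z) \<partial>lborel) = ennreal (H t)" for t
  proof -
    have "integrable lborel (\<lambda>z. ?\<Phi> t z * f z)" by (rule integrable_f_bounded[OF _ b]) measurable
    from nn_integral_eq_integral[OF this] show ?thesis
      by (simp add: H_def \<Phi>_nonneg f0 ennreal_mult[symmetric] mult.commute)
  qed
  have shift: "(\<integral>\<^sup>+\<omega>. J p q (case_nat (t, z) \<omega>) \<partial>Sq) = ennreal (exp (- (s * t))) * ennreal (?\<Phi> t z)" for t z
  proof -
    have "(\<integral>\<^sup>+\<omega>. J p q (case_nat (t, z) \<omega>) \<partial>Sq) = (\<integral>\<^sup>+\<omega>. ennreal (exp (- (s * t))) * J (exp (r * t) * p - z) (exp (r * t) * q - z) \<omega> \<partial>Sq)"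
      by (rule nn_integral_cong_AE) (use AE_Sq_nonneg nr in \<open>auto elim!: eventually_mono intro!: J_shift\<close>)
    also have "\<dots> = ennreal (exp (- (s * t))) * \<Phi>E (exp (r * t) * p - z) (exp (r * t) * q - z)"
      unfolding \<Phi>E_def by (rule nn_integral_cmult) measurable
    finally show ?thesis by (simp add: \<Phi>E_eq)
  qed
  have "ennreal (\<Phi> p q) = (\<integral>\<^sup>+\<omega>. J p q \<omega> \<partial>Sq)" by (simp add: \<Phi>E_eq[symmetric] \<Phi>E_def)
  also have "\<dots> = (\<integral>\<^sup>+x. (\<integral>\<^sup>+\<omega>. J p q (case_nat x \<omega>) \<partial>Sq) \<partial>D)"
    by (rule nn_integral_Sq) measurable
  also have "\<dots> = (\<integral>\<^sup>+x. ennreal (exp (- (s * fst x))) * ennreal (?\<Phi> (fst x) (snd x)) \<partial>D)"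
    by (rule nn_integral_cong) (metis shift prod.collapse)
  also have "\<dots> = (\<integral>\<^sup>+t. (\<integral>\<^sup>+z. ennreal (exponential_density lam t) * (ennreal (f z) * (ennreal (exp (- (s * t))) * ennreal (?\<Phi> t z))) \<partial>lborel) \<partial>lborel)"
    by (subst nn_integral_D) auto
  also have "\<dots> = (\<integral>\<^sup>+t. (\<integral>\<^sup>+z. ennreal (E t) * (ennreal (f z) * ennreal (?\<Phi> t z)) \<partial>lborel) \<partial>lborel)"
    by (intro nn_integral_cong) (simp add: E_eq ennreal_mult exponential_density_nonneg[OF lam] mult_ac)
  also have "\<dots> = (\<integral>\<^sup>+t. ennreal (E t * H t) \<partial>lborel)"
    by (subst nn_integral_cmult) (simp_all add: inner ennreal_mult E0 H0)
  also have "\<dots> = ennreal (LBINT t. E t * H t)"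
    by (rule nn_integral_eq_integral[OF integrable_E_bounded[OF Hm Hb]]) (simp add: E0 H0)
  finally have "\<Phi> p q = (LBINT t. E t * H t)"
    by (subst (asm) ennreal_inj) (auto simp: \<Phi>_nonneg E0 H0 intro!: integral_nonneg_AE)
  then show ?thesis by (simp add: H_def)
qed

section \<open>Sensitivity of ruin near the critical line \<open>p = q\<close>\<close>

abbreviation "expd \<equiv> density lborel (\<lambda>t. ennreal (exponential_density lam t))"
abbreviation "clm \<equiv> density lborel (\<lambda>z. ennreal (f z))"

lemma nn_integral_D_swap:
  assumes [measurable]: "g \<in> borel_measurable (borel \<Otimes>\<^sub>M borel)"
  shows "(\<integral>\<^sup>+x. g x \<partial>D) = (\<integral>\<^sup>+z. (\<integral>\<^sup>+t. g (t, z) \<partial>expd) \<partial>clm)"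
proof -
  interpret A: prob_space expd by (rule prob_space_exponential_density[OF lam])
  interpret B: prob_space clm by (rule prob_space_claim)
  interpret P: pair_sigma_finite expd clm ..
  show ?thesis unfolding D_def by (rule P.nn_integral_snd[symmetric]) measurable
qed

text \<open>The first interarrival time is integrated innermost, with everything else fixed, since
  the window estimate relies on its density alone.\<close>

lemma nn_integral_Sq_swap:
  assumes g: "g \<in> borel_measurable Sq"
  shows "(\<integral>\<^sup>+\<omega>. g \<omega> \<partial>Sq) = (\<integral>\<^sup>+\<omega>. (\<integral>\<^sup>+z. (\<integral>\<^sup>+t. g (case_nat (t, z) \<omega>) \<partial>expd) \<partial>clm) \<partial>Sq)"
proof -
  interpret d: prob_space D by (rule prob_space_D)
  interpret q: prob_space Sq by (rule prob_space_Sq)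
  interpret P: pair_sigma_finite D Sq ..
  interpret s: sequence_space D ..
  have m: "(\<lambda>(x, \<omega>). case_nat x \<omega>) \<in> measurable (D \<Otimes>\<^sub>M Sq) Sq"
    unfolding Sq_def by measurable
  have gm: "(\<lambda>(x, \<omega>). g (case_nat x \<omega>)) \<in> borel_measurable (D \<Otimes>\<^sub>M Sq)"
    using measurable_compose[OF m g] by (simp add: split_beta')
  have "(\<integral>\<^sup>+\<omega>. g \<omega> \<partial>Sq) = (\<integral>\<^sup>+\<omega>. (\<integral>\<^sup>+x. g (case_nat x \<omega>) \<partial>D) \<partial>Sq)"
    unfolding nn_integral_Sq[OF g] by (rule P.Fubini'[OF gm, symmetric])
  also have "\<dots> = (\<integral>\<^sup>+\<omega>. (\<integral>\<^sup>+z. (\<integral>\<^sup>+t. g (case_nat (t, z) \<omega>) \<partial>expd) \<partial>clm) \<partial>Sq)"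
  proof (rule nn_integral_cong)
    fix \<omega>
    have "(\<lambda>x. (x, \<omega>)) \<in> measurable D (D \<Otimes>\<^sub>M Sq)" by (rule measurable_Pair2') simp
    from measurable_compose[OF this gm] have "(\<lambda>x. g (case_nat x \<omega>)) \<in> borel_measurable D" by simp
    then show "(\<integral>\<^sup>+x. g (case_nat x \<omega>) \<partial>D) = (\<integral>\<^sup>+z. (\<integral>\<^sup>+t. g (case_nat (t, z) \<omega>) \<partial>expd) \<partial>clm)"
      by (intro nn_integral_D_swap) (simp add: measurable_cong_sets[OF sets_D refl])
  qed
  finally show ?thesis .
qed

definition hs where "hs = s / 2"

lemma hs: "hs > 0" using s by (auto simp: hs_def)

text \<open>The Laplace transform of an interarrival time at \<open>hs\<close>; it becomes the ratio
  of a geometric series over the claims.\<close>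

definition \<rho> where "\<rho> = lam / (lam + hs)"

lemma \<rho>: "0 < \<rho>" "\<rho> < 1" using lam hs by (auto simp: \<rho>_def)

lemma nn_integral_expd_half: "(\<integral>\<^sup>+t. ennreal (exp (- (hs * t))) \<partial>expd) = ennreal \<rho>"
proof -
  let ?l = "lam + hs"
  have l: "?l > 0" using lam hs by simp
  have lr: "lam = \<rho> * ?l" using l by (simp add: \<rho>_def)
  have "(\<integral>\<^sup>+t. ennreal (exp (- (hs * t))) \<partial>expd) = (\<integral>\<^sup>+t. ennreal (exponential_density lam t) * ennreal (exp (- (hs * t))) \<partial>lborel)"
    by (rule nn_integral_density) auto
  also have "\<dots> = (\<integral>\<^sup>+t. ennreal \<rho> * ennreal (exponential_density ?l t) \<partial>lborel)"
  proof (rule nn_integral_cong)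
    fix t
    have "exponential_density lam t * exp (- (hs * t)) = \<rho> * exponential_density ?l t"
    proof (cases "t < 0")
      case False
      have "exp (- t * lam) * exp (- (hs * t)) = exp (- t * ?l)"
        by (simp add: exp_add[symmetric] algebra_simps)
      then have "lam * exp (- t * lam) * exp (- (hs * t)) = (\<rho> * ?l) * exp (- t * ?l)"
        unfolding lr[symmetric] by (simp only: mult.assoc)
      then show ?thesis using False by (simp add: exponential_density_def mult.assoc)
    qed (simp add: exponential_density_def)
    then show "ennreal (exponential_density lam t) * ennreal (exp (- (hs * t))) = ennreal \<rho> * ennreal (exponential_density ?l t)"
      using \<rho> exponential_density_nonneg[OF lam] exponential_density_nonneg[OF l] by (simp add: ennreal_mult[symmetric])
  qed
  also have "\<dots> = ennreal \<rho> * (\<integral>\<^sup>+t. ennreal (exponential_density ?l t) \<partial>lborel)"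
    by (rule nn_integral_cmult) simp
  also have "(\<integral>\<^sup>+t. ennreal (exponential_density ?l t) \<partial>lborel) = 1"
    using prob_space.emeasure_space_1[OF prob_space_exponential_density[OF l]] by (simp add: emeasure_density)
  finally show ?thesis by simp
qed

lemma nn_integral_th: "(\<integral>\<^sup>+\<omega>. ennreal (exp (- (hs * th \<omega> k))) \<partial>Sq) = ennreal \<rho> ^ Suc k"
proof (induction k)
  case 0
  interpret B: prob_space clm by (rule prob_space_claim)
  interpret q: prob_space Sq by (rule prob_space_Sq)
  show ?case
    by (subst nn_integral_Sq_swap) 
       (use B.emeasure_space_1 q.emeasure_space_1 in \<open>simp_all add: th_0 nn_integral_expd_half\<close>)
next
  case (Suc k)
  interpret B: prob_space clm by (rule prob_space_claim)
  have inner: "(\<integral>\<^sup>+t. ennreal (exp (- (hs * th (case_nat (t, z) \<omega>) (Suc k)))) \<partial>expd)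
      = ennreal (exp (- (hs * th \<omega> k))) * ennreal \<rho>" for z \<omega>
  proof -
    have "(\<integral>\<^sup>+t. ennreal (exp (- (hs * th (case_nat (t, z) \<omega>) (Suc k)))) \<partial>expd)
      = (\<integral>\<^sup>+t. ennreal (exp (- (hs * th \<omega> k))) * ennreal (exp (- (hs * t))) \<partial>expd)"
      by (intro nn_integral_cong) (simp add: th_Suc ennreal_mult[symmetric] exp_add[symmetric] algebra_simps)
    also have "\<dots> = ennreal (exp (- (hs * th \<omega> k))) * ennreal \<rho>"
      by (subst nn_integral_cmult) (simp_all add: nn_integral_expd_half)
    finally show ?thesis .
  qed
  have "(\<integral>\<^sup>+\<omega>. ennreal (exp (- (hs * th \<omega> (Suc k)))) \<partial>Sq) = (\<integral>\<^sup>+\<omega>. ennreal (exp (- (hs * th \<omega> k))) * ennreal \<rho> \<partial>Sq)"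
    by (subst nn_integral_Sq_swap) (use B.emeasure_space_1 in \<open>simp_all add: inner\<close>)
  also have "\<dots> = (\<integral>\<^sup>+\<omega>. ennreal (exp (- (hs * th \<omega> k))) \<partial>Sq) * ennreal \<rho>"
    by (rule nn_integral_multc) measurable
  finally show ?case using Suc by (simp add: mult.commute)
qed

text \<open>As \<open>t\<close> varies, \<open>exp (- r t) R\<close> decreases at the relative rate
  \<open>r\<close>, so it stays in the window for a time interval of length
  \<open>ln (p / q) / r\<close>, on which the density is at most \<open>lam\<close>.\<close>

lemma window:
  assumes pq: "0 < q" "q < p"
  shows "(\<integral>\<^sup>+t. (if q < exp (- (r * t)) * R \<and> exp (- (r * t)) * R \<le> p then ennreal (exp (- (hs * t))) else 0) \<partial>expd)
    \<le> ennreal (lam / r * ln (p / q))"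
proof (cases "R > 0")
  case False
  then have "\<not> q < exp (- (r * t)) * R" for t
    using mult_nonneg_nonpos[of "exp (- (r * t))" R] pq by (auto simp: not_less)
  then show ?thesis by simp
next
  case True
  define a b where "a = ln (R / p) / r" and "b = ln (R / q) / r"
  have ab: "b - a = ln (p / q) / r" using True pq r by (simp add: a_def b_def ln_div diff_divide_distrib)
  have ln0: "ln (p / q) \<ge> 0" using pq by simp
  have "(\<integral>\<^sup>+t. (if q < exp (- (r * t)) * R \<and> exp (- (r * t)) * R \<le> p then ennreal (exp (- (hs * t))) else 0) \<partial>expd)
     = (\<integral>\<^sup>+t. ennreal (exponential_density lam t) * (if q < exp (- (r * t)) * R \<and> exp (- (r * t)) * R \<le> p then ennreal (exp (- (hs * t))) else 0) \<partial>lborel)"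
    by (rule nn_integral_density) auto
  also have "\<dots> \<le> (\<integral>\<^sup>+t. ennreal lam * indicator {a..b} t \<partial>lborel)"
  proof (rule nn_integral_mono)
    fix t
    show "ennreal (exponential_density lam t) * (if q < exp (- (r * t)) * R \<and> exp (- (r * t)) * R \<le> p then ennreal (exp (- (hs * t))) else 0)
        \<le> ennreal lam * indicator {a..b} t"
    proof (cases "t \<ge> 0 \<and> q < exp (- (r * t)) * R \<and> exp (- (r * t)) * R \<le> p")
      case cond: True
      have "ln q < ln (exp (- (r * t)) * R)" "ln (exp (- (r * t)) * R) \<le> ln p"
        using cond pq True by (auto intro!: ln_less_cancel_iff[THEN iffD2] ln_le_cancel_iff[THEN iffD2])
      then have "t \<in> {a..b}" using True pq r by (simp add: a_def b_def ln_mult ln_div field_simps)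
      moreover have "exponential_density lam t * exp (- (hs * t)) \<le> lam"
      proof -
        have "exponential_density lam t * exp (- (hs * t)) = lam * (exp (- (lam * t)) * exp (- (hs * t)))"
          using cond by (simp add: exponential_density_def mult.commute)
        also have "\<dots> \<le> lam * (1 * 1)"
          using cond lam hs by (intro mult_left_mono mult_mono) auto
        finally show ?thesis by simp
      qed
      ultimately show ?thesis using cond by (simp add: ennreal_mult[symmetric] exponential_density_nonneg[OF lam] ennreal_leI)
    next
      case False
      then show ?thesis by (auto simp: exponential_density_def)
    qed
  qed
  also have "\<dots> = ennreal lam * emeasure lborel {a..b}" by (rule nn_integral_cmult_indicator) simp
  also have "\<dots> = ennreal (lam / r * ln (p / q))"
  proof -
    have "0 \<le> b - a" unfolding ab using ln0 r by simp
    then show ?thesis using ab lam by (simp add: ennreal_mult[symmetric])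
  qed
  finally show ?thesis .
qed

text \<open>The event in which replacing the first coordinate \<open>q\<close> by \<open>p\<close>
  can matter at the claim with index \<open>k\<close>. It carries only half of the discount; the
  other half is spent on the power of \<open>p - q\<close>.\<close>

definition V :: "real \<Rightarrow> real \<Rightarrow> (nat \<Rightarrow> real \<times> real) \<Rightarrow> nat \<Rightarrow> ennreal" where
  "V p q \<omega> k = (if q < Dc \<omega> k + q0 * exp (- (r * th \<omega> k)) \<and> Dc \<omega> k + q0 * exp (- (r * th \<omega> k)) \<le> p
     then ennreal (exp (- (hs * th \<omega> k))) else 0)"

lemma V_meas [measurable]: "(\<lambda>\<omega>. V p q \<omega> k) \<in> borel_measurable Sq"
  unfolding V_def by measurable

text \<open>The first interarrival time scales the whole barrier by \<open>exp (- r t)\<close>, so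
  the window estimate applies for every index with all else fixed. The discount over the
  \<open>k\<close> later interarrival times supplies \<open>\<rho>^k\<close>.\<close>

lemma V_integral:
  assumes pq: "0 < q" "q < p"
  shows "(\<integral>\<^sup>+\<omega>. V p q \<omega> k \<partial>Sq) \<le> ennreal (lam / r * ln (p / q)) * ennreal \<rho> ^ k"
proof -
  interpret B: prob_space clm by (rule prob_space_claim)
  interpret q: prob_space Sq by (rule prob_space_Sq)
  let ?L = "ennreal (lam / r * ln (p / q))"
  define c where "c \<omega> = (case k of 0 \<Rightarrow> 1 | Suc j \<Rightarrow> ennreal (exp (- (hs * th \<omega> j))))" for \<omega>
  have cm [measurable]: "c \<in> borel_measurable Sq" unfolding c_def by (cases k) auto
  have inner: "(\<integral>\<^sup>+t. V p q (case_nat (t, z) \<omega>) k \<partial>expd) \<le> ?L * c \<omega>" for z \<omega>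
  proof (cases k)
    case 0
    have "Dc (case_nat (t, z) \<omega>) 0 + q0 * exp (- (r * th (case_nat (t, z) \<omega>) 0)) = exp (- (r * t)) * (z + q0)" for t
      by (simp add: Dc_0 th_0 algebra_simps)
    then show ?thesis using window[OF pq, of "z + q0"] by (simp add: V_def 0 c_def th_0 cong: if_cong)
  next
    case (Suc j)
    let ?R = "z + (Dc \<omega> j + q0 * exp (- (r * th \<omega> j)))"
    have e: "Dc (case_nat (t, z) \<omega>) (Suc j) + q0 * exp (- (r * th (case_nat (t, z) \<omega>) (Suc j))) = exp (- (r * t)) * ?R" for t
      by (simp add: Dc_Suc th_Suc exp_add[symmetric] distrib_left algebra_simps)
    have "(\<integral>\<^sup>+t. V p q (case_nat (t, z) \<omega>) (Suc j) \<partial>expd)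
       = (\<integral>\<^sup>+t. ennreal (exp (- (hs * th \<omega> j))) * (if q < exp (- (r * t)) * ?R \<and> exp (- (r * t)) * ?R \<le> p then ennreal (exp (- (hs * t))) else 0) \<partial>expd)"
      unfolding V_def e
      by (intro nn_integral_cong) (simp add: th_Suc ennreal_mult[symmetric] exp_add[symmetric] algebra_simps)
    also have "\<dots> = ennreal (exp (- (hs * th \<omega> j))) * (\<integral>\<^sup>+t. (if q < exp (- (r * t)) * ?R \<and> exp (- (r * t)) * ?R \<le> p then ennreal (exp (- (hs * t))) else 0) \<partial>expd)"
      by (rule nn_integral_cmult) simp
    also have "\<dots> \<le> ennreal (exp (- (hs * th \<omega> j))) * ?L"
      by (intro mult_left_mono window[OF pq]) simp
    finally show ?thesis by (simp add: Suc c_def mult.commute)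
  qed
  have "(\<integral>\<^sup>+\<omega>. V p q \<omega> k \<partial>Sq) = (\<integral>\<^sup>+\<omega>. (\<integral>\<^sup>+z. (\<integral>\<^sup>+t. V p q (case_nat (t, z) \<omega>) k \<partial>expd) \<partial>clm) \<partial>Sq)"
    by (rule nn_integral_Sq_swap) measurable
  also have "\<dots> \<le> (\<integral>\<^sup>+\<omega>. (\<integral>\<^sup>+z. ?L * c \<omega> \<partial>clm) \<partial>Sq)"
    by (intro nn_integral_mono inner)
  also have "\<dots> = (\<integral>\<^sup>+\<omega>. ?L * c \<omega> \<partial>Sq)" using B.emeasure_space_1 by simp
  also have "\<dots> = ?L * (\<integral>\<^sup>+\<omega>. c \<omega> \<partial>Sq)" by (rule nn_integral_cmult) measurable
  also have "(\<integral>\<^sup>+\<omega>. c \<omega> \<partial>Sq) = ennreal \<rho> ^ k"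
    unfolding c_def using q.emeasure_space_1 by (cases k) (simp_all add: nn_integral_th)
  finally show ?thesis .
qed

lemma th_nonneg: "(\<And>i. fst (\<omega> i) \<ge> 0) \<Longrightarrow> th \<omega> k \<ge> 0"
  unfolding th_def by (intro sum_nonneg) auto

text \<open>The two discounted ruin barriers differ by \<open>d exp (- r th)\<close>, a number
  between 0 and \<open>d\<close>. Hence for \<open>p \<le> q\<close> ruin of the second process
  implies ruin of the first, and for \<open>p \<ge> q + d\<close> it is the other way round.\<close>

lemma barrier_le:
  assumes "\<And>i. fst (\<omega> i) \<ge> 0"
  shows "Dc \<omega> k + q0 * exp (- (r * th \<omega> k)) \<le> Dc \<omega> k + p0 * exp (- (r * th \<omega> k))"
    and "Dc \<omega> k + p0 * exp (- (r * th \<omega> k)) \<le> Dc \<omega> k + q0 * exp (- (r * th \<omega> k)) + d"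
proof -
  have "d * exp (- (r * th \<omega> k)) \<le> d * 1" using th_nonneg[OF assms] r d by (intro mult_left_mono) auto
  then show "Dc \<omega> k + p0 * exp (- (r * th \<omega> k)) \<le> Dc \<omega> k + q0 * exp (- (r * th \<omega> k)) + d"
    by (simp add: d_def algebra_simps)
  have "0 \<le> d * exp (- (r * th \<omega> k))" using d by simp
  then show "Dc \<omega> k + q0 * exp (- (r * th \<omega> k)) \<le> Dc \<omega> k + p0 * exp (- (r * th \<omega> k))"
    by (simp add: d_def algebra_simps)
qed

lemma \<Phi>_cong_AE:
  assumes "\<And>\<omega>. (\<And>i. fst (\<omega> i) \<ge> 0) \<Longrightarrow> J p q \<omega> = J p' q' \<omega>"
  shows "\<Phi> p q = \<Phi> p' q'"
proof -
  have "\<Phi>E p q = \<Phi>E p' q'"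
    unfolding \<Phi>E_def by (rule nn_integral_cong_AE) (use AE_Sq_nonneg in \<open>auto elim!: eventually_mono intro: assms\<close>)
  then show ?thesis by (simp add: \<Phi>_def)
qed

lemma \<Phi>_diag0: "q + d \<le> p \<Longrightarrow> \<Phi> p q = \<Phi> p (p - d)"
proof (rule \<Phi>_cong_AE)
  fix \<omega> :: "nat \<Rightarrow> real \<times> real"
  assume pq: "q + d \<le> p" and \<omega>: "\<And>i. fst (\<omega> i) \<ge> 0"
  have "rn p q \<omega> k \<longleftrightarrow> rn p (p - d) \<omega> k" for k
    using pq barrier_le[of \<omega> k, OF \<omega>] unfolding rn_def by linarith
  moreover have "p < p0 \<and> q < q0 \<longleftrightarrow> p < p0 \<and> p - d < q0" using pq by (auto simp: d_def)
  ultimately show "J p q \<omega> = J p (p - d) \<omega>" unfolding J_def Y_def by simp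
qed

lemma \<Phi>_left0: "p \<le> q \<Longrightarrow> \<Phi> p q = \<Phi> q q"
proof (rule \<Phi>_cong_AE)
  fix \<omega> :: "nat \<Rightarrow> real \<times> real"
  assume pq: "p \<le> q" and \<omega>: "\<And>i. fst (\<omega> i) \<ge> 0"
  have "rn p q \<omega> k \<longleftrightarrow> rn q q \<omega> k" for k
    using pq barrier_le[of \<omega> k, OF \<omega>] unfolding rn_def by linarith
  moreover have "p < p0 \<and> q < q0 \<longleftrightarrow> q < p0 \<and> q < q0" using pq p0 by auto
  ultimately show "J p q \<omega> = J q q \<omega>" unfolding J_def Y_def by simp
qed

lemma \<Phi>_ruin0: "p < p0 \<Longrightarrow> q < q0 \<Longrightarrow> \<Phi> p q = 1"
proof -
  interpret q: prob_space Sq by (rule prob_space_Sq)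
  show "p < p0 \<Longrightarrow> q < q0 \<Longrightarrow> \<Phi> p q = 1"
    using q.emeasure_space_1 by (simp add: \<Phi>_def \<Phi>E_def J_def)
qed

lemma J_difference:
  assumes q: "q \<ge> q0" and pq: "q < p" "p \<le> q + d" and \<omega>: "\<And>i. fst (\<omega> i) \<ge> 0"
  shows "J q q \<omega> \<le> J p q \<omega> + ennreal (((p - q) / d) powr (s / (2 * r))) * (\<Sum>k. V p q \<omega> k)"
proof -
  let ?c = "((p - q) / d) powr (s / (2 * r))"
  have Jq: "J q q \<omega> = (SUP k. Y q q \<omega> k)" "J p q \<omega> = (SUP k. Y p q \<omega> k)" using q by (auto simp: J_def)
  show ?thesis unfolding Jq(1)
  proof (rule SUP_least)
    fix k
    let ?e = "exp (- (r * th \<omega> k))"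
    have "Y q q \<omega> k \<le> Y p q \<omega> k + ennreal ?c * V p q \<omega> k"
    proof (cases "rn q q \<omega> k \<and> \<not> rn p q \<omega> k")
      case False
      then show ?thesis using pq by (auto simp: Y_def)
    next
      case True
      then have X: "q < Dc \<omega> k + q0 * ?e" "Dc \<omega> k + p0 * ?e \<le> p" by (auto simp: rn_def)
      have V: "V p q \<omega> k = ennreal (exp (- (hs * th \<omega> k)))"
        unfolding V_def using X(1) order_trans[OF barrier_le(1)[of \<omega> k, OF \<omega>] X(2)] by (simp only: simp_thms if_True)
      \<comment> \<open>Ruin from \<open>(q, q)\<close> but not from \<open>(p, q)\<close> forces
        \<open>d exp (- r th) \<le> p - q\<close>: the claim comes after the meeting time. The power
        \<open>s / (2 r)\<close> of this bound is half of the discount.\<close>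
      have "d * ?e \<le> p - q" using X by (simp add: d_def algebra_simps)
      then have "?e \<le> (p - q) / d" using d by (simp add: field_simps)
      then have "?e powr (s / (2 * r)) \<le> ?c" using s r by (intro powr_mono2) auto
      moreover have "?e powr (s / (2 * r)) = exp (- (hs * th \<omega> k))" using r by (simp add: powr_def hs_def)
      ultimately have "exp (- (hs * th \<omega> k)) * exp (- (hs * th \<omega> k)) \<le> ?c * exp (- (hs * th \<omega> k))"
        by (intro mult_right_mono) auto
      moreover have "exp (- (hs * th \<omega> k)) * exp (- (hs * th \<omega> k)) = exp (- (s * th \<omega> k))"
        by (simp add: exp_add[symmetric] hs_def)
      ultimately have "ennreal (exp (- (s * th \<omega> k))) \<le> ennreal ?c * V p q \<omega> k"
        unfolding V by (simp add: ennreal_mult[symmetric] ennreal_leI)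
      then show ?thesis using True by (simp add: Y_def)
    qed
    also have "\<dots> \<le> J p q \<omega> + ennreal ?c * (\<Sum>k. V p q \<omega> k)"
    proof (intro add_mono mult_left_mono)
      show "Y p q \<omega> k \<le> J p q \<omega>" unfolding Jq(2) by (rule SUP_upper) simp
      show "V p q \<omega> k \<le> (\<Sum>k. V p q \<omega> k)"
        using sum_le_suminf[of "V p q \<omega>" "{k}"] by simp
    qed simp
    finally show "Y q q \<omega> k \<le> J p q \<omega> + ennreal ?c * (\<Sum>k. V p q \<omega> k)" .
  qed
qed

text \<open>The two ruin indicators can differ only for claims after the meeting time, which costs the discount
  \<open>(p - q)\<^sup>\<alpha>\<close>, and only if the discounted claim total lies in a window of length \<open>p - q\<close>,
  which the first interarrival time alone makes an event of probability \<open>O(p - q)\<close>.\<close>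

lemma \<Phi>_near0:
  assumes q: "q \<ge> q0" and pq: "q < p" "p \<le> q + d"
  shows "\<bar>\<Phi> p q - \<Phi> q q\<bar> \<le> lam / (r * q0) / (1 - \<rho>) / d powr (s / (2 * r)) * (p - q) powr (1 + s / (2 * r))"
proof -
  let ?c = "((p - q) / d) powr (s / (2 * r))"
  have qp: "q > 0" using q q0 by simp
  have "J p q \<omega> \<le> J q q \<omega>" for \<omega>
  proof -
    have "Y p q \<omega> k \<le> Y q q \<omega> k" for k using pq by (auto simp: Y_def rn_def)
    then show ?thesis using q by (auto simp: J_def intro!: SUP_mono)
  qed
  then have "\<Phi>E p q \<le> \<Phi>E q q" unfolding \<Phi>E_def by (intro nn_integral_mono)
  then have le: "\<Phi> p q \<le> \<Phi> q q" unfolding \<Phi>E_eq by (simp add: \<Phi>_nonneg)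
  have lnb: "ln (p / q) \<le> (p - q) / q0"
  proof -
    have "ln (p / q) \<le> p / q - 1" using pq qp by (intro ln_le_minus_one) auto
    also have "\<dots> = (p - q) / q" using qp by (simp add: diff_divide_distrib)
    also have "\<dots> \<le> (p - q) / q0" using pq q q0 by (intro divide_left_mono) auto
    finally show ?thesis .
  qed
  have ln0: "ln (p / q) \<ge> 0" using pq qp by simp
  have "\<Phi>E q q \<le> (\<integral>\<^sup>+\<omega>. J p q \<omega> + ennreal ?c * (\<Sum>k. V p q \<omega> k) \<partial>Sq)"
    unfolding \<Phi>E_def
  proof (rule nn_integral_mono_AE)
    show "AE \<omega> in Sq. J q q \<omega> \<le> J p q \<omega> + ennreal ?c * (\<Sum>k. V p q \<omega> k)"
      using AE_Sq_nonneg
    proof eventually_elim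
      case (elim \<omega>)
      then show ?case using J_difference[OF q pq] by blast
    qed
  qed
  also have "\<dots> = \<Phi>E p q + (\<integral>\<^sup>+\<omega>. ennreal ?c * (\<Sum>k. V p q \<omega> k) \<partial>Sq)"
    unfolding \<Phi>E_def by (rule nn_integral_add) measurable
  also have "(\<integral>\<^sup>+\<omega>. ennreal ?c * (\<Sum>k. V p q \<omega> k) \<partial>Sq) = ennreal ?c * (\<Sum>k. \<integral>\<^sup>+\<omega>. V p q \<omega> k \<partial>Sq)"
    by (subst nn_integral_cmult) (simp_all add: nn_integral_suminf)
  also have "(\<Sum>k. \<integral>\<^sup>+\<omega>. V p q \<omega> k \<partial>Sq) \<le> (\<Sum>k. ennreal (lam / r * ln (p / q)) * ennreal \<rho> ^ k)"
    by (intro suminf_le V_integral[OF qp pq(1)]) auto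
  also have "\<dots> = (\<Sum>k. ennreal (lam / r * ln (p / q) * \<rho> ^ k))"
    using \<rho> ln0 lam r by (intro arg_cong[where f = suminf] ext) (simp only: ennreal_mult' ennreal_power zero_le_mult_iff zero_le_divide_iff less_imp_le simp_thms)
  also have "\<dots> = ennreal (lam / r * ln (p / q) * (1 / (1 - \<rho>)))"
  proof (rule suminf_ennreal_eq)
    show "0 \<le> lam / r * ln (p / q) * \<rho> ^ i" for i using \<rho> ln0 lam r by simp
    show "(\<lambda>k. lam / r * ln (p / q) * \<rho> ^ k) sums (lam / r * ln (p / q) * (1 / (1 - \<rho>)))"
      using \<rho> by (intro sums_mult geometric_sums) auto
  qed
  finally have "\<Phi>E q q \<le> \<Phi>E p q + ennreal ?c * ennreal (lam / r * ln (p / q) * (1 / (1 - \<rho>)))"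
    by (simp add: add_left_mono mult_left_mono)
  also have "\<dots> = ennreal (\<Phi> p q + ?c * (lam / r * ln (p / q) * (1 / (1 - \<rho>))))"
    using \<rho> ln0 lam r by (simp add: \<Phi>E_eq \<Phi>_nonneg ennreal_mult[symmetric] ennreal_plus[symmetric] del: ennreal_plus)
  finally have "ennreal (\<Phi> q q) \<le> ennreal (\<Phi> p q + ?c * (lam / r * ln (p / q) * (1 / (1 - \<rho>))))"
    unfolding \<Phi>E_eq .
  moreover have "0 \<le> \<Phi> p q + ?c * (lam / r * ln (p / q) * (1 / (1 - \<rho>)))"
    using \<rho> ln0 lam r \<Phi>_nonneg[of p q] by (intro add_nonneg_nonneg mult_nonneg_nonneg) auto
  ultimately have "\<Phi> q q \<le> \<Phi> p q + ?c * (lam / r * ln (p / q) * (1 / (1 - \<rho>)))"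
    by (simp only: ennreal_le_iff)
  also have "?c * (lam / r * ln (p / q) * (1 / (1 - \<rho>))) \<le> ?c * (lam / r * ((p - q) / q0) * (1 / (1 - \<rho>)))"
    using lnb \<rho> lam r by (intro mult_left_mono mult_right_mono) auto
  also have "\<dots> = lam / (r * q0) / (1 - \<rho>) / d powr (s / (2 * r)) * (p - q) powr (1 + s / (2 * r))"
    using pq d by (simp add: powr_divide powr_add mult_ac)
  finally show ?thesis using le by simp
qed

lemma risk_2d: "risk_2d r lam s p0 q0 f \<Phi>"
proof unfold_locales
  show "(\<lambda>x. \<Phi> (fst x) (snd x)) \<in> borel_measurable (borel \<Otimes>\<^sub>M borel)" by (rule \<Phi>_meas0)
  show "\<bar>\<Phi> p q\<bar> \<le> 1" for p q using \<Phi>_nonneg[of p q] \<Phi>_le_1[of p q] by simp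
  show "\<exists>c \<alpha>. 0 < \<alpha> \<and> (\<forall>p q. q0 \<le> q \<longrightarrow> q < p \<longrightarrow> p \<le> q + d \<longrightarrow> \<bar>\<Phi> p q - \<Phi> q q\<bar> \<le> c * (p - q) powr (1 + \<alpha>))"
    using \<Phi>_near0 r s by (intro exI[of _ "lam / (r * q0) / (1 - \<rho>) / d powr (s / (2 * r))"] exI[of _ "s / (2 * r)"]) auto
qed (fact \<Phi>_ruin0 \<Phi>_renewal0 \<Phi>_diag0 \<Phi>_left0)+

section \<open>Exceptional null sets of paths\<close>

lemma AE_Sq_pos: "AE \<omega> in Sq. \<forall>i. fst (\<omega> i) > 0"
  unfolding AE_all_countable
proof
  fix i
  interpret A: prob_space expd by (rule prob_space_exponential_density[OF lam])
  interpret B: prob_space clm by (rule prob_space_claim)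
  interpret P: pair_prob_space expd clm ..
  have "AE x in lborel. 0 < ennreal (exponential_density lam x) \<longrightarrow> 0 < x"
    using AE_lborel_singleton[of 0]
  proof eventually_elim
    case (elim x)
    then show ?case by (cases "x < 0") (auto simp: exponential_density_def)
  qed
  then have "AE x in expd. 0 < x"
    by (subst AE_density) auto
  then have "AE x in D. 0 < fst x"
    unfolding D_def
  proof (intro P.AE_pair_measure)
    show "{x \<in> space (expd \<Otimes>\<^sub>M clm). 0 < fst x} \<in> sets (expd \<Otimes>\<^sub>M clm)" by measurable
  qed (auto elim!: eventually_mono)
  then show "AE \<omega> in Sq. 0 < fst (\<omega> i)"
    unfolding Sq_def by (intro AE_PiM_component[where M = "\<lambda>_. D"] prob_space_D) auto
qed

text \<open>The expectation of the sum of \<open>exp (- hs th)\<close> is a convergent geometric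
  series, so almost surely the terms tend to 0 and the arrival times to infinity.\<close>

lemma AE_Sq_finite: "AE \<omega> in Sq. \<forall>t. finite {k. th \<omega> k \<le> t}"
proof -
  let ?g = "\<lambda>\<omega> k. ennreal (exp (- (hs * th \<omega> k)))"
  have "(\<integral>\<^sup>+\<omega>. (\<Sum>k. ?g \<omega> k) \<partial>Sq) = (\<Sum>k. ennreal \<rho> ^ Suc k)"
    by (subst nn_integral_suminf) (simp_all only: nn_integral_th, measurable)
  also have "\<dots> = (\<Sum>k. ennreal (\<rho> * \<rho> ^ k))"
    using \<rho> by (intro arg_cong[where f = suminf] ext) (simp add: ennreal_mult ennreal_power)
  also have "\<dots> = ennreal (\<rho> * (1 / (1 - \<rho>)))"
    by (rule suminf_ennreal_eq) (use \<rho> in \<open>auto intro!: sums_mult geometric_sums simp del: times_divide_eq_right\<close>)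
  finally have "(\<integral>\<^sup>+\<omega>. (\<Sum>k. ?g \<omega> k) \<partial>Sq) \<noteq> \<infinity>" by simp
  then have "AE \<omega> in Sq. (\<Sum>k. ?g \<omega> k) \<noteq> \<infinity>"
    by (rule nn_integral_noteq_infinite[rotated]) measurable
  then show ?thesis
  proof eventually_elim
    case (elim \<omega>)
    have "summable (\<lambda>k. exp (- (hs * th \<omega> k)))"
      using elim by (intro summable_suminf_not_top) (auto simp: top_ennreal_def infinity_ennreal_def)
    then have lim: "(\<lambda>k. exp (- (hs * th \<omega> k))) \<longlonglongrightarrow> 0" by (rule summable_LIMSEQ_zero)
    show ?case
    proof
      fix t
      have "\<forall>\<^sub>F k in sequentially. exp (- (hs * th \<omega> k)) < exp (- (hs * t))"
        by (rule order_tendstoD(2)[OF lim]) simp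
      then have "\<forall>\<^sub>F k in sequentially. \<not> th \<omega> k \<le> t"
        by eventually_elim (use hs in auto)
      then show "finite {k. th \<omega> k \<le> t}" 
        by (simp add: eventually_cofinite cofinite_eq_sequentially[symmetric])
    qed
  qed
qed

end

section \<open>The ruin time\<close>

definition DD :: "real \<Rightarrow> (nat \<Rightarrow> 'a \<Rightarrow> real) \<Rightarrow> (nat \<Rightarrow> 'a \<Rightarrow> real) \<Rightarrow> real \<Rightarrow> 'a \<Rightarrow> real" where
  "DD r W \<sigma> t \<omega> = (\<Sum>k\<in>{k. arrival W k \<omega> \<le> t}. exp (- (r * arrival W k \<omega>)) * \<sigma> k \<omega>)"

text \<open>Division by \<open>\<delta> exp (r t)\<close> separates the reserve from the claims, so
  that one discounted claim sum serves both processes.\<close>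

lemma surplus_neg_iff:
  assumes r: "r > 0" and \<delta>: "\<delta> > 0"
  shows "surplus r u c \<delta> W \<sigma> t \<omega> < 0 \<longleftrightarrow>
    u / \<delta> + c / (\<delta> * r) < DD r W \<sigma> t \<omega> + c / (\<delta> * r) * exp (- (r * t))"
proof -
  have "(\<Sum>k\<in>{k. arrival W k \<omega> \<le> t}. exp (r * (t - arrival W k \<omega>)) * \<sigma> k \<omega>) = exp (r * t) * DD r W \<sigma> t \<omega>"
    unfolding DD_def sum_distrib_left by (intro sum.cong refl) (simp add: exp_add[symmetric] algebra_simps)
  moreover have "c / (\<delta> * r) * exp (- (r * t)) * (\<delta> * exp (r * t)) = c / r"
    using \<delta> by (simp add: exp_minus field_simps)
  then have "\<delta> * exp (r * t) * (u / \<delta> + c / (\<delta> * r) - (DD r W \<sigma> t \<omega> + c / (\<delta> * r) * exp (- (r * t))))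
      = exp (r * t) * u + c / r * (exp (r * t) - 1) - \<delta> * (exp (r * t) * DD r W \<sigma> t \<omega>)"
    using \<delta> r by (simp add: algebra_simps)
  ultimately have "surplus r u c \<delta> W \<sigma> t \<omega> = \<delta> * exp (r * t) * (u / \<delta> + c / (\<delta> * r) - (DD r W \<sigma> t \<omega> + c / (\<delta> * r) * exp (- (r * t))))"
    by (simp add: surplus_def)
  moreover have "\<delta> * exp (r * t) > 0" using \<delta> by simp
  ultimately show ?thesis using \<delta> by (auto simp: mult_less_0_iff)
qed

definition hit :: "real \<Rightarrow> real \<Rightarrow> real \<Rightarrow> (nat \<Rightarrow> 'a \<Rightarrow> real) \<Rightarrow> (nat \<Rightarrow> 'a \<Rightarrow> real) \<Rightarrow> real \<Rightarrow> real \<Rightarrow> 'a \<Rightarrow> real \<Rightarrow> bool" where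
  "hit r p0 q0 W \<sigma> p q \<omega> t \<longleftrightarrow> 0 \<le> t \<and> p < DD r W \<sigma> t \<omega> + p0 * exp (- (r * t)) \<and> q < DD r W \<sigma> t \<omega> + q0 * exp (- (r * t))"

lemma T_max_eq:
  assumes "r > 0" "\<delta>1 > 0" "\<delta>2 > 0"
  shows "T_max r c1 c2 \<delta>1 \<delta>2 W \<sigma> u1 u2 \<omega> = Inf (ereal ` {t. hit r (c1 / (\<delta>1 * r)) (c2 / (\<delta>2 * r)) W \<sigma>
     (u1 / \<delta>1 + c1 / (\<delta>1 * r)) (u2 / \<delta>2 + c2 / (\<delta>2 * r)) \<omega> t})"
  unfolding T_max_def hit_def by (simp only: max_less_iff_conj surplus_neg_iff[OF assms(1,2)] surplus_neg_iff[OF assms(1,3)])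

text \<open>Without a claim in between, the discounted barrier only falls in time, so ruin cannot
  begin between claims.\<close>

lemma hit_mono:
  assumes h: "hit r p0 q0 W \<sigma> p q \<omega> t" and t: "0 \<le> t'" "t' \<le> t" and eq: "DD r W \<sigma> t' \<omega> = DD r W \<sigma> t \<omega>"
    and "r > 0" "p0 > 0" "q0 > 0"
  shows "hit r p0 q0 W \<sigma> p q \<omega> t'"
proof -
  have "exp (- (r * t)) \<le> exp (- (r * t'))" using t assms by simp
  then have "p0 * exp (- (r * t)) \<le> p0 * exp (- (r * t'))" "q0 * exp (- (r * t)) \<le> q0 * exp (- (r * t'))"
    using assms by (intro mult_left_mono; simp)+
  then show ?thesis using h t unfolding hit_def eq by linarith
qed

text \<open>The infimum defining the ruin time may be taken over countably many measurable times, for every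
  path. On the null set of paths with infinitely many arrivals before some time \<open>t\<close> the sum
  over an infinite set is 0 by convention, and there the rational times suffice.\<close>

lemma hit_inf_countable:
  fixes W \<sigma> :: "nat \<Rightarrow> 'a \<Rightarrow> real" and p q r p0 q0 :: real and \<omega> :: 'a
  assumes pos: "r > 0" "p0 > 0" "q0 > 0"
  defines "R \<equiv> hit r p0 q0 W \<sigma> p q \<omega>"
  defines "e \<equiv> \<lambda>t. if R t then ereal t else \<infinity>"
  shows "Inf (ereal ` {t. R t}) = min (e 0) (min (INF k. e (arrival W k \<omega>)) (INF x. e (of_rat x)))"
proof (rule antisym)
  have le: "Inf (ereal ` {t. R t}) \<le> e t" for t
    unfolding e_def by (auto intro: Inf_lower)
  show "Inf (ereal ` {t. R t}) \<le> min (e 0) (min (INF k. e (arrival W k \<omega>)) (INF x. e (of_rat x)))"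
    by (intro min.boundedI INF_greatest le)
  let ?m = "min (e 0) (min (INF k. e (arrival W k \<omega>)) (INF x. e (of_rat x)))"
  have m0: "?m \<le> e 0" by simp
  have ma: "?m \<le> e (arrival W k \<omega>)" for k
    by (rule order_trans[OF min.cobounded2], rule order_trans[OF min.cobounded1]) (rule INF_lower, simp)
  have mr: "?m \<le> e (of_rat x)" for x
    by (rule order_trans[OF min.cobounded2], rule order_trans[OF min.cobounded2]) (rule INF_lower, simp)
  show "?m \<le> Inf (ereal ` {t. R t})"
  proof (rule Inf_greatest, safe)
    fix t assume t: "R t"
    then have t0: "t \<ge> 0" by (simp add: R_def hit_def)
    show "?m \<le> ereal t"
    proof (cases "finite {k. arrival W k \<omega> \<le> t}")
      case True
      define S where "S = insert 0 ((\<lambda>k. arrival W k \<omega>) ` {k. arrival W k \<omega> \<le> t})"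
      have fS: "finite S" "S \<noteq> {}" using True by (auto simp: S_def)
      \<comment> \<open>The last arrival in \<open>[0, t]\<close>, or 0 if there is none.\<close>
      define t' where "t' = Max S"
      have t'S: "t' \<in> S" unfolding t'_def by (rule Max_in[OF fS])
      have t'0: "t' \<ge> 0" unfolding t'_def by (rule Max_ge[OF fS(1)]) (simp add: S_def)
      have t't: "t' \<le> t" unfolding t'_def using fS t0 by (subst Max_le_iff) (auto simp: S_def)
      have "{k. arrival W k \<omega> \<le> t'} = {k. arrival W k \<omega> \<le> t}"
      proof safe
        fix k assume "arrival W k \<omega> \<le> t'" then show "arrival W k \<omega> \<le> t" using t't by simp
      next
        fix k assume "arrival W k \<omega> \<le> t"
        then show "arrival W k \<omega> \<le> t'" unfolding t'_def by (intro Max_ge[OF fS(1)]) (auto simp: S_def)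
      qed
      then have "DD r W \<sigma> t' \<omega> = DD r W \<sigma> t \<omega>" by (simp add: DD_def)
      then have "R t'" unfolding R_def using hit_mono[OF t[unfolded R_def] t'0 t't _ pos] by simp
      then have e: "e t' = ereal t'" by (simp add: e_def)
      have "?m \<le> e t'" using t'S m0 ma unfolding S_def by auto
      then show ?thesis unfolding e using t't by (meson ereal_less_eq(3) order_trans)
    next
      case False
      have DD0: "DD r W \<sigma> x \<omega> = 0" if "x \<ge> t" for x
      proof -
        have "{k. arrival W k \<omega> \<le> t} \<subseteq> {k. arrival W k \<omega> \<le> x}" using that by auto
        then have "infinite {k. arrival W k \<omega> \<le> x}" using False by (rule infinite_super)
        then show ?thesis by (simp add: DD_def)
      qed
      have lt: "p < p0 * exp (- (r * t))" "q < q0 * exp (- (r * t))"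
        using t DD0[of t] by (auto simp: R_def hit_def)
      have "((\<lambda>x. p0 * exp (- (r * x))) \<longlongrightarrow> p0 * exp (- (r * t))) (at_right t)"
        "((\<lambda>x. q0 * exp (- (r * x))) \<longlongrightarrow> q0 * exp (- (r * t))) (at_right t)"
        by (intro tendsto_intros)+
      from order_tendstoD(1)[OF this(1) lt(1)] order_tendstoD(1)[OF this(2) lt(2)]
      have "\<forall>\<^sub>F x in at_right t. p < p0 * exp (- (r * x)) \<and> q < q0 * exp (- (r * x))" by (rule eventually_conj)
      then obtain b where b: "b > t" "\<And>x. t < x \<Longrightarrow> x < b \<Longrightarrow> p < p0 * exp (- (r * x)) \<and> q < q0 * exp (- (r * x))"
        unfolding eventually_at_right_field by blast
      show ?thesis
      proof (rule ereal_le_epsilon2)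
          fix \<epsilon> :: real assume \<epsilon>: "\<epsilon> > 0"
          obtain y where y: "t < of_rat y" "of_rat y < min b (t + \<epsilon>)"
            using of_rat_dense[of t "min b (t + \<epsilon>)"] b \<epsilon> by auto
          have "0 \<le> real_of_rat y" using y(1) t0 by linarith
          then have "R (of_rat y)" using y b(2)[of "of_rat y"] DD0[of "of_rat y"] t0 by (simp add: R_def hit_def)
          then have "?m \<le> ereal (of_rat y)" using mr[of y] by (simp add: e_def)
          also have "\<dots> \<le> ereal t + ereal \<epsilon>" using y by simp
          finally show "?m \<le> ereal t + ereal \<epsilon>" .
      qed
    qed
  qed
qed

text \<open>The index set of the sum depends on the path, so the sum is rewritten as a series, with
  value 0 if infinitely many arrivals precede the given time.\<close>

lemma DD_measurable [measurable (raw)]: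
  assumes [measurable]: "\<And>k. W k \<in> borel_measurable M" "\<And>k. \<sigma> k \<in> borel_measurable M" "\<tau> \<in> borel_measurable M"
  shows "(\<lambda>\<omega>. DD r W \<sigma> (\<tau> \<omega>) \<omega>) \<in> borel_measurable M"
proof -
  have [measurable]: "(\<lambda>\<omega>. arrival W k \<omega>) \<in> borel_measurable M" for k
    unfolding arrival_def by measurable
  have eq: "DD r W \<sigma> t \<omega> = (if \<exists>n. \<forall>k\<ge>n. t < arrival W k \<omega>
      then (\<Sum>k. if arrival W k \<omega> \<le> t then exp (- (r * arrival W k \<omega>)) * \<sigma> k \<omega> else 0) else 0)" for t \<omega>
  proof -
    have fin: "finite {k. arrival W k \<omega> \<le> t} \<longleftrightarrow> (\<exists>n. \<forall>k\<ge>n. t < arrival W k \<omega>)"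
      using eventually_cofinite[of "\<lambda>k. t < arrival W k \<omega>"]
      by (simp add: cofinite_eq_sequentially eventually_sequentially not_less)
    show ?thesis
    proof (cases "finite {k. arrival W k \<omega> \<le> t}")
      case True
      have "(\<Sum>k. if arrival W k \<omega> \<le> t then exp (- (r * arrival W k \<omega>)) * \<sigma> k \<omega> else 0)
          = (\<Sum>k\<in>{k. arrival W k \<omega> \<le> t}. if arrival W k \<omega> \<le> t then exp (- (r * arrival W k \<omega>)) * \<sigma> k \<omega> else 0)"
        by (rule suminf_finite[OF True]) auto
      then show ?thesis using True fin unfolding DD_def by (auto intro!: sum.cong)
    next
      case False
      then have n: "\<not> (\<exists>n. \<forall>k\<ge>n. t < arrival W k \<omega>)" using fin by blast
      show ?thesis unfolding if_not_P[OF n] using False by (simp add: DD_def)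
    qed
  qed
  show ?thesis unfolding eq by measurable
qed

lemma T_max_measurable:
  assumes [measurable]: "\<And>k. W k \<in> borel_measurable M" "\<And>k. \<sigma> k \<in> borel_measurable M"
    and pos: "r > 0" "\<delta>1 > 0" "\<delta>2 > 0" "c1 > 0" "c2 > 0"
  shows "(\<lambda>\<omega>. T_max r c1 c2 \<delta>1 \<delta>2 W \<sigma> u1 u2 \<omega>) \<in> borel_measurable M"
proof -
  have [measurable]: "(\<lambda>\<omega>. arrival W k \<omega>) \<in> borel_measurable M" for k
    unfolding arrival_def by measurable
  have pos': "c1 / (\<delta>1 * r) > 0" "c2 / (\<delta>2 * r) > 0" using pos by auto
  show ?thesis
    unfolding T_max_eq[OF pos(1-3)] hit_inf_countable[OF pos(1) pos'] hit_def by measurable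
qed

lemma disc_measurable [measurable]: "disc s \<in> borel_measurable borel"
proof -
  have "disc s = (\<lambda>T. if T = \<infinity> \<or> T = - \<infinity> then 0 else exp (- s * real_of_ereal T))"
    by (auto simp: disc_def fun_eq_iff split: ereal.split)
  then show ?thesis by simp
qed

context risk_params
begin

text \<open>With strictly increasing arrival times that do not accumulate, ruin can begin only at
  time 0 or at a claim, so the infimum is attained there whenever ruin occurs at all.\<close>

lemma disc_hit_eq_J:
  assumes W: "\<And>k. W k \<omega> > 0" and fin: "\<And>t. finite {k. arrival W k \<omega> \<le> t}"
  shows "ennreal (disc s (Inf (ereal ` {t. hit r p0 q0 W \<sigma> p q \<omega> t}))) = J p q (\<lambda>k. (W k \<omega>, \<sigma> k \<omega>))"
proof -
  let ?x = "\<lambda>k. (W k \<omega>, \<sigma> k \<omega>)" and ?a = "\<lambda>k. arrival W k \<omega>"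
  let ?R = "hit r p0 q0 W \<sigma> p q \<omega>"
  have p0': "p0 > 0" using p0 q0 by simp
  have th: "th ?x k = ?a k" for k by (simp add: th_def arrival_def)
  have "strict_mono ?a"
    by (rule strict_mono_Suc_iff[THEN iffD2]) (simp add: arrival_def W)
  then have am: "?a i \<le> ?a j \<longleftrightarrow> i \<le> j" for i j by (rule strict_mono_less_eq)
  have a0: "?a k > 0" for k unfolding arrival_def by (intro sum_pos) (auto simp: W)
  have DDa: "DD r W \<sigma> t \<omega> = Dc ?x k" if "{j. ?a j \<le> t} = {..k}" for t k
    unfolding DD_def that Dc_def th by simp
  have DDk: "DD r W \<sigma> (?a k) \<omega> = Dc ?x k" for k by (rule DDa) (auto simp: am)
  have hk: "?R (?a k) \<longleftrightarrow> rn p q ?x k" for k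
    using a0[of k] by (simp add: hit_def rn_def th DDk)
  show ?thesis
  proof (cases "p < p0 \<and> q < q0")
    case True
    have "{j. ?a j \<le> 0} = {}" using a0 by (auto simp: not_le)
    then have "DD r W \<sigma> 0 \<omega> = 0" by (simp add: DD_def)
    then have "?R 0" using True by (simp add: hit_def)
    then have "Inf (ereal ` {t. ?R t}) = ereal 0"
      by (intro antisym Inf_lower Inf_greatest) (auto simp: hit_def)
    then show ?thesis using True by (simp add: disc_def J_def)
  next
    case nr: False
    have hit_k: "\<exists>k. ?R (?a k) \<and> ?a k \<le> t" if t: "?R t" for t
    proof -
      have t0: "t \<ge> 0" using t by (simp add: hit_def)
      have "{j. ?a j \<le> t} \<noteq> {}"
      proof
        assume "{j. ?a j \<le> t} = {}"
        then have "DD r W \<sigma> t \<omega> = 0" by (simp add: DD_def)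
        moreover have "p0 * exp (- (r * t)) \<le> p0 * 1" "q0 * exp (- (r * t)) \<le> q0 * 1"
          using t0 r p0' q0 by (intro mult_left_mono; simp)+
        ultimately show False using t nr unfolding hit_def by auto
      qed
      define k where "k = Max {j. ?a j \<le> t}"
      have k: "?a k \<le> t" using Max_in[OF fin \<open>{j. ?a j \<le> t} \<noteq> {}\<close>] by (simp add: k_def)
      have "j \<le> k" if "?a j \<le> t" for j unfolding k_def using fin that by (intro Max_ge) auto
      then have "{j. ?a j \<le> t} = {..k}" using k am order_trans by blast
      then have "DD r W \<sigma> (?a k) \<omega> = DD r W \<sigma> t \<omega>" using DDa DDk by simp
      then have "?R (?a k)" using hit_mono[OF t _ k _ r p0' q0] a0[of k] by simp
      with k show ?thesis by blast
    qed
    show ?thesis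
    proof (cases "\<exists>k. rn p q ?x k")
      case False
      then have "{t. ?R t} = {}" using hit_k hk by auto
      \<comment> \<open>The infimum of the empty set is \<open>\<infinity>\<close>, where
        \<open>disc\<close> takes its default value 0.\<close>
      then have "disc s (Inf (ereal ` {t. ?R t})) = 0" by (simp add: disc_def top_ereal_def)
      moreover have "J p q ?x = 0" using nr False by (auto simp: J_def Y_def)
      ultimately show ?thesis by simp
    next
      case True
      define K where "K = (LEAST k. rn p q ?x k)"
      have K: "rn p q ?x K" unfolding K_def using True by (rule LeastI_ex)
      have Kmin: "K \<le> k" if "rn p q ?x k" for k unfolding K_def using that by (rule Least_le)
      have "Inf (ereal ` {t. ?R t}) = ereal (?a K)"
      proof (rule antisym)
        show "Inf (ereal ` {t. ?R t}) \<le> ereal (?a K)" using K hk by (intro Inf_lower) auto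
        show "ereal (?a K) \<le> Inf (ereal ` {t. ?R t})"
        proof (rule Inf_greatest, safe)
          fix t assume "?R t"
          then obtain k where "?R (?a k)" "?a k \<le> t" using hit_k by blast
          then show "ereal (?a K) \<le> ereal t" using Kmin[of k] am[of K k] hk[of k] by simp
        qed
      qed
      moreover have "J p q ?x = ennreal (exp (- (s * ?a K)))"
      proof -
        have "(SUP k. Y p q ?x k) = ennreal (exp (- (s * ?a K)))"
        proof (rule antisym)
          show "(SUP k. Y p q ?x k) \<le> ennreal (exp (- (s * ?a K)))"
          proof (rule SUP_least)
            fix k
            show "Y p q ?x k \<le> ennreal (exp (- (s * ?a K)))"
              using Kmin[of k] am[of K k] s by (auto simp: Y_def th intro!: ennreal_leI)
          qed
          have "Y p q ?x K = ennreal (exp (- (s * ?a K)))" using K by (simp add: Y_def th)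
          then show "ennreal (exp (- (s * ?a K))) \<le> (SUP k. Y p q ?x k)"
            using SUP_upper[of K UNIV "\<lambda>k. Y p q ?x k"] by simp
        qed
        then show ?thesis using nr by (auto simp: J_def)
      qed
      ultimately show ?thesis by (simp add: disc_def)
    qed
  qed
qed

end

section \<open>The integro-differential equation\<close>

text \<open>Grouping the independent family by the index sets \<open>{Inl k, Inr k}\<close> gives
  independent pairs with law \<open>D\<close>, so expectations can be computed on the canonical
  space \<open>Sq\<close>.\<close>

lemma (in risk_params) distr_sequence:
  fixes W \<sigma> :: "nat \<Rightarrow> 'a \<Rightarrow> real"
  assumes "prob_space M"
    and W: "\<And>k. distr M lborel (W k) = expd" "\<And>k. W k \<in> borel_measurable M"
    and \<sigma>: "\<And>k. distr M lborel (\<sigma> k) = clm" "\<And>k. \<sigma> k \<in> borel_measurable M"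
    and ind: "prob_space.indep_vars M (\<lambda>_. borel)
           (\<lambda>i \<omega>. case i of Inl k \<Rightarrow> W k \<omega> | Inr k \<Rightarrow> \<sigma> k \<omega>) (UNIV :: (nat + nat) set)"
  shows "(\<lambda>\<omega> k. (W k \<omega>, \<sigma> k \<omega>)) \<in> measurable M Sq" "distr M Sq (\<lambda>\<omega> k. (W k \<omega>, \<sigma> k \<omega>)) = Sq"
proof -
  interpret prob_space M by fact
  have Dk: "distr M D (\<lambda>\<omega>. (W k \<omega>, \<sigma> k \<omega>)) = D" for k
  proof -
    have "indep_var (PiM {Inl k} (\<lambda>_. borel)) (\<lambda>\<omega>. restrict (\<lambda>i. case i of Inl k \<Rightarrow> W k \<omega> | Inr k \<Rightarrow> \<sigma> k \<omega>) {Inl k})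
       (PiM {Inr k} (\<lambda>_. borel)) (\<lambda>\<omega>. restrict (\<lambda>i. case i of Inl k \<Rightarrow> W k \<omega> | Inr k \<Rightarrow> \<sigma> k \<omega>) {Inr k})"
      by (rule indep_var_restrict[OF ind]) auto
    from indep_var_compose[OF this, of "\<lambda>g. g (Inl k)" borel "\<lambda>g. g (Inr k)" borel]
    have "indep_var borel (W k) borel (\<sigma> k)" by (simp add: o_def)
    then have "distr M (borel \<Otimes>\<^sub>M borel) (\<lambda>\<omega>. (W k \<omega>, \<sigma> k \<omega>)) = distr M borel (W k) \<Otimes>\<^sub>M distr M borel (\<sigma> k)"
      unfolding indep_var_distribution_eq by simp
    also have "distr M borel (W k) = expd" unfolding W(1)[of k, symmetric] by (rule distr_cong) auto
    also have "distr M borel (\<sigma> k) = clm" unfolding \<sigma>(1)[of k, symmetric] by (rule distr_cong) auto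
    finally show ?thesis unfolding D_def[symmetric] using distr_cong[OF refl sets_D refl] by metis
  qed
  have rv: "(\<lambda>\<omega>. (W k \<omega>, \<sigma> k \<omega>)) \<in> measurable M D" for k
    unfolding measurable_cong_sets[OF refl sets_D] using W(2) \<sigma>(2) by measurable
  then show m: "(\<lambda>\<omega> k. (W k \<omega>, \<sigma> k \<omega>)) \<in> measurable M Sq"
    unfolding Sq_def by (intro measurable_PiM_single') auto
  have "indep_vars (\<lambda>k. PiM {Inl k, Inr k} (\<lambda>_. borel))
     (\<lambda>k \<omega>. restrict (\<lambda>i. case i of Inl k \<Rightarrow> W k \<omega> | Inr k \<Rightarrow> \<sigma> k \<omega>) {Inl k, Inr k}) UNIV"
    by (rule indep_vars_restrict[OF ind]) (auto simp: disjoint_family_on_def)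
  from indep_vars_compose2[OF this, of "\<lambda>k g. (g (Inl k), g (Inr k))" "\<lambda>_. D"]
  have "indep_vars (\<lambda>_. D) (\<lambda>k \<omega>. (W k \<omega>, \<sigma> k \<omega>)) UNIV"
    by (simp add: measurable_cong_sets[OF refl sets_D])
  then have "distr M (PiM UNIV (\<lambda>_. D)) (\<lambda>\<omega>. \<lambda>k\<in>UNIV. (W k \<omega>, \<sigma> k \<omega>)) = PiM UNIV (\<lambda>k. distr M D (\<lambda>\<omega>. (W k \<omega>, \<sigma> k \<omega>)))"
    by (subst (asm) indep_vars_iff_distr_eq_PiM) (use rv in auto)
  then show "distr M Sq (\<lambda>\<omega> k. (W k \<omega>, \<sigma> k \<omega>)) = Sq"
    by (simp add: Dk Sq_def restrict_def)
qed

lemma ide_dom_iff: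
  assumes "\<delta>1 > 0" "\<delta>2 > 0"
  shows "(x, y) \<in> ide_dom \<delta>1 \<delta>2 \<longleftrightarrow> x / \<delta>1 \<le> y / \<delta>2 \<and> 0 \<le> y"
proof -
  have "0 \<le> y" if "x / \<delta>1 \<le> y / \<delta>2" "0 \<le> x"
  proof -
    have "0 \<le> x / \<delta>1" using that assms by simp
    then have "0 \<le> y / \<delta>2" using that by linarith
    then show ?thesis using assms by (simp add: zero_le_divide_iff)
  qed
  then show ?thesis unfolding ide_dom_def by (auto simp: le_max_iff_disj)
qed

section \<open>Return to the original coordinates\<close>

locale risk_model =
  fixes M :: "'a measure" and W \<sigma> :: "nat \<Rightarrow> 'a \<Rightarrow> real" and f :: "real \<Rightarrow> real"
    and r c1 c2 \<delta>1 \<delta>2 lam s :: real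
  assumes prob: "prob_space M"
    and r: "r > 0" and c: "c1 > 0" "c2 > 0" and \<delta>: "0 < \<delta>1" "0 < \<delta>2" and lam: "lam > 0"
    and cc: "c1 / \<delta>1 > c2 / \<delta>2" and s: "s > 0"
    and W: "\<And>k. distributed M lborel (W k) (\<lambda>x. ennreal (exponential_density lam x))"
    and f0: "\<And>z. f z \<ge> 0"
    and \<sigma>: "\<And>k. distributed M lborel (\<sigma> k) (\<lambda>x. ennreal (f x))"
    and \<sigma>0: "\<And>k \<omega>. \<sigma> k \<omega> \<ge> 0"
    and ind: "prob_space.indep_vars M (\<lambda>_. borel)
           (\<lambda>i \<omega>. case i of Inl k \<Rightarrow> W k \<omega> | Inr k \<Rightarrow> \<sigma> k \<omega>) (UNIV :: (nat + nat) set)"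
begin

interpretation prob_space M by (fact prob)

definition p0 where "p0 = c1 / (\<delta>1 * r)"
definition q0 where "q0 = c2 / (\<delta>2 * r)"
text \<open>The density \<open>f\<close> may be positive on a null set of negative reals.\<close>

definition f1 where "f1 z = indicator {0..} z * f z"

lemma f_meas [measurable]: "f \<in> borel_measurable borel"
  using distributed_real_measurable[OF f0 \<sigma>[of 0]] by simp

lemma W_meas: "W k \<in> borel_measurable M" and \<sigma>_meas: "\<sigma> k \<in> borel_measurable M"
  using distributed_measurable[OF W] distributed_measurable[OF \<sigma>] by simp_all

lemma AE_f_eq: "AE z in lborel. f z = f1 z"
proof -
  have "(\<integral>\<^sup>+z. ennreal (f z) * indicator {..<0} z \<partial>lborel) = emeasure (density lborel (\<lambda>z. ennreal (f z))) {..<0}"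
    by (simp add: emeasure_density)
  also have "\<dots> = emeasure (distr M lborel (\<sigma> 0)) {..<0}"
    by (simp add: distributed_distr_eq_density[OF \<sigma>])
  also have "\<dots> = emeasure M {}"
  proof -
    have "\<sigma> 0 -` {..<0} \<inter> space M = {}" using \<sigma>0[of 0] by (auto simp: less_le_not_le)
    then show ?thesis using \<sigma>_meas[of 0] by (subst emeasure_distr) auto
  qed
  finally have "(\<integral>\<^sup>+z. ennreal (f z) * indicator {..<0} z \<partial>lborel) = 0" by simp
  then have "AE z in lborel. ennreal (f z) * indicator {..<0} z = 0"
    by (subst (asm) nn_integral_0_iff_AE) simp_all
  then show ?thesis
  proof eventually_elim
    case (elim z)
    then show ?case using f0[of z] by (auto simp: f1_def indicator_def not_le split: if_splits)
  qed
qed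

lemma density_eq: "density lborel (\<lambda>z. ennreal (f z)) = density lborel (\<lambda>z. ennreal (f1 z))"
  by (rule density_cong) (use AE_f_eq in \<open>auto simp: f1_def elim!: eventually_mono\<close>)

lemma risk_params: "risk_params r lam s p0 q0 f1"
proof
  show "q0 > 0" using c \<delta> r by (simp add: q0_def)
  have "c2 / \<delta>2 / r < c1 / \<delta>1 / r" using cc r by (rule divide_strict_right_mono)
  then show "p0 > q0" by (simp add: p0_def q0_def)
  show "0 \<le> f1 z" for z using f0 by (simp add: f1_def)
  show fm: "f1 \<in> borel_measurable borel" unfolding f1_def by measurable
  have "prob_space (density lborel (\<lambda>z. ennreal (f1 z)))"
    unfolding density_eq[symmetric] distributed_distr_eq_density[OF \<sigma>[of 0], symmetric]
    using \<sigma>_meas by (intro prob_space_distr) simp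
  then have n: "(\<integral>\<^sup>+z. ennreal (f1 z) \<partial>lborel) = 1"
    using prob_space.emeasure_space_1 fm by (force simp: emeasure_density)
  have nn: "0 \<le> f1 z" for z using f0 by (simp add: f1_def)
  show "integrable lborel f1" by (rule integrableI_nonneg) (use fm nn n in auto)
  show "(LBINT z. f1 z) = 1" by (subst integral_eq_nn_integral) (use fm nn n in auto)
qed (use r lam s in auto)

sublocale risk_params r lam s p0 q0 f1 by (fact risk_params)
sublocale risk_2d r lam s p0 q0 f1 \<Phi> by (rule risk_2d)

abbreviation "Psi \<equiv> Psi_max M r c1 c2 \<delta>1 \<delta>2 W \<sigma> s"

text \<open>The sequence of pairs has law \<open>Sq\<close>. Two null sets are discarded: paths with
  a nonpositive interarrival time and paths with accumulating arrivals.\<close>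

lemma Psi_max_eq: "Psi u1 u2 = \<Phi> (u1 / \<delta>1 + p0) (u2 / \<delta>2 + q0)"
proof -
  let ?seq = "\<lambda>\<omega> k. (W k \<omega>, \<sigma> k \<omega>)" and ?p = "u1 / \<delta>1 + p0" and ?q = "u2 / \<delta>2 + q0"
  have law: "?seq \<in> measurable M Sq" "distr M Sq ?seq = Sq"
    using distr_sequence[OF prob _ W_meas _ \<sigma>_meas ind] distributed_distr_eq_density[OF W] distributed_distr_eq_density[OF \<sigma>]
    by (simp_all add: density_eq)
  have AE1: "AE \<omega> in M. \<forall>i. 0 < W i \<omega>"
    using AE_distrD[OF law(1), unfolded law(2), OF AE_Sq_pos] by simp
  have AE2: "AE \<omega> in M. \<forall>t. finite {k. th (?seq \<omega>) k \<le> t}"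
    by (rule AE_distrD[OF law(1), unfolded law(2), OF AE_Sq_finite])
  have "AE \<omega> in M. ennreal (disc s (T_max r c1 c2 \<delta>1 \<delta>2 W \<sigma> u1 u2 \<omega>)) = J ?p ?q (?seq \<omega>)"
    using AE1 AE2
  proof eventually_elim
    case (elim \<omega>)
    have "th (?seq \<omega>) k = arrival W k \<omega>" for k by (simp add: th_def arrival_def)
    with elim have "\<And>k. 0 < W k \<omega>" "\<And>t. finite {k. arrival W k \<omega> \<le> t}" by auto
    from disc_hit_eq_J[OF this] show ?case unfolding T_max_eq[OF r \<delta>] p0_def q0_def .
  qed
  then have "(\<integral>\<^sup>+\<omega>. ennreal (disc s (T_max r c1 c2 \<delta>1 \<delta>2 W \<sigma> u1 u2 \<omega>)) \<partial>M) = (\<integral>\<^sup>+\<omega>. J ?p ?q (?seq \<omega>) \<partial>M)"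
    by (rule nn_integral_cong_AE)
  also have "\<dots> = (\<integral>\<^sup>+\<omega>. J ?p ?q \<omega> \<partial>distr M Sq ?seq)"
    by (rule nn_integral_distr[OF law(1), symmetric]) measurable
  also have "\<dots> = \<Phi>E ?p ?q" unfolding law(2) \<Phi>E_def ..
  finally have n: "(\<integral>\<^sup>+\<omega>. ennreal (disc s (T_max r c1 c2 \<delta>1 \<delta>2 W \<sigma> u1 u2 \<omega>)) \<partial>M) = \<Phi>E ?p ?q" .
  have "(\<lambda>\<omega>. disc s (T_max r c1 c2 \<delta>1 \<delta>2 W \<sigma> u1 u2 \<omega>)) \<in> borel_measurable M"
    by (rule measurable_compose[OF T_max_measurable disc_measurable]) (use W_meas \<sigma>_meas r c \<delta> in auto)
  then show ?thesis
    unfolding Psi_max_def \<Phi>_def n[symmetric]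
    by (intro integral_eq_nn_integral) (auto simp: disc_def split: ereal.split)
qed

text \<open>From a start with \<open>u1/\<delta>1 = u2/\<delta>2\<close> the first process has the
  larger scaled surplus at all times, so both are negative exactly when the first one is.\<close>

lemma Lap1_eq: "Lap1 M r c1 \<delta>1 W \<sigma> s u1 = Psi u1 (\<delta>2 / \<delta>1 * u1)"
proof -
  have "T_max r c1 c2 \<delta>1 \<delta>2 W \<sigma> u1 (\<delta>2 / \<delta>1 * u1) \<omega> = ruin_time1 r u1 c1 \<delta>1 W \<sigma> \<omega>" for \<omega>
  proof -
    have "max (surplus r u1 c1 \<delta>1 W \<sigma> t \<omega>) (surplus r (\<delta>2 / \<delta>1 * u1) c2 \<delta>2 W \<sigma> t \<omega>) < 0 \<longleftrightarrow> surplus r u1 c1 \<delta>1 W \<sigma> t \<omega> < 0"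
      if "0 \<le> t" for t
    proof -
      have "d * exp (- (r * t)) \<le> d * 1" using d r that by (intro mult_left_mono) auto
      then have "p0 * exp (- (r * t)) - p0 \<le> q0 * exp (- (r * t)) - q0" by (simp add: d_def algebra_simps)
      then show ?thesis
        using \<delta> unfolding max_less_iff_conj surplus_neg_iff[OF r \<delta>(1)] surplus_neg_iff[OF r \<delta>(2)] p0_def[symmetric] q0_def[symmetric]
        by auto
    qed
    then show ?thesis unfolding T_max_def ruin_time1_def by (intro arg_cong[where f = "\<lambda>A. Inf (ereal ` A)"]) auto
  qed
  then show ?thesis unfolding Lap1_def Psi_max_def by simp
qed

lemma shift_integral:
  assumes "\<And>z. z \<ge> 0 \<Longrightarrow> k z = k' z"
  shows "set_integrable lborel {0..} (\<lambda>z. k z * f z) \<longleftrightarrow> integrable lborel (\<lambda>z. k' z * f1 z)"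
    and "(LBINT z:{0..}. k z * f z) = (LBINT z. k' z * f1 z)"
proof -
  have "(\<lambda>z. indicator {0..} z *\<^sub>R (k z * f z)) = (\<lambda>z. k' z * f1 z)"
    using assms by (auto simp: fun_eq_iff f1_def indicator_def)
  then show "set_integrable lborel {0..} (\<lambda>z. k z * f z) \<longleftrightarrow> integrable lborel (\<lambda>z. k' z * f1 z)"
    "(LBINT z:{0..}. k z * f z) = (LBINT z. k' z * f1 z)"
    by (simp_all add: set_integrable_def set_lebesgue_integral_def)
qed

lemma domain_iff: "(u1, u2) \<in> ide_dom \<delta>1 \<delta>2 \<longleftrightarrow> q0 \<le> u2 / \<delta>2 + q0 \<and> u1 / \<delta>1 + p0 \<le> u2 / \<delta>2 + q0 + d"
  unfolding ide_dom_iff[OF \<delta>] using \<delta> by (auto simp: d_def zero_le_divide_iff)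

text \<open>An affine change of variables: \<open>u1 + c1/r = \<delta>1 p\<close> and
  \<open>u2 + c2/r = \<delta>2 q\<close> turn the coefficients of the equation into those of the
  flow, and the factors \<open>\<delta>1\<close>, \<open>\<delta>2\<close> cancel against the chain
  rule.\<close>

lemma Psi_max_solves: "solves_IDE r c1 c2 \<delta>1 \<delta>2 lam f s Psi"
  unfolding solves_IDE_def
proof (intro allI impI)
  fix u1 u2 assume dom: "(u1, u2) \<in> ide_dom \<delta>1 \<delta>2"
  define p q where "p = u1 / \<delta>1 + p0" and "q = u2 / \<delta>2 + q0"
  have pq: "q0 \<le> q" "p \<le> q + d" using dom unfolding domain_iff p_def q_def by auto
  define B2 where "B2 = \<Psi> (p, q) / (r * q) - A1 p q * (p / q)"
  have D1: "((\<lambda>x. Psi x u2) has_real_derivative A1 p q * (1 / \<delta>1)) (at u1 within {x. (x, u2) \<in> ide_dom \<delta>1 \<delta>2})"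
  proof -
    have d1: "((\<lambda>x. \<Phi> x q) has_real_derivative A1 p q) (at (u1 / \<delta>1 + p0) within (\<lambda>x. x / \<delta>1 + p0) ` {x. (x, u2) \<in> ide_dom \<delta>1 \<delta>2})"
      unfolding p_def[symmetric] by (rule has_field_derivative_subset[OF \<Phi>_derivative_1[OF pq]]) (auto simp: domain_iff q_def)
    have d2: "((\<lambda>x. x / \<delta>1 + p0) has_real_derivative 1 / \<delta>1) (at u1 within {x. (x, u2) \<in> ide_dom \<delta>1 \<delta>2})"
      using \<delta> by (auto intro!: derivative_eq_intros)
    show ?thesis
      using DERIV_image_chain[OF d1 d2] unfolding o_def Psi_max_eq q_def .
  qed
  have D2: "((\<lambda>y. Psi u1 y) has_real_derivative B2 * (1 / \<delta>2)) (at u2 within {y. (u1, y) \<in> ide_dom \<delta>1 \<delta>2})"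
  proof -
    have d1: "((\<lambda>y. \<Phi> p y) has_real_derivative B2) (at (u2 / \<delta>2 + q0) within (\<lambda>y. y / \<delta>2 + q0) ` {y. (u1, y) \<in> ide_dom \<delta>1 \<delta>2})"
      unfolding B2_def q_def[symmetric] by (rule has_field_derivative_subset[OF \<Phi>_derivative_2[OF pq]]) (auto simp: domain_iff p_def)
    have d2: "((\<lambda>y. y / \<delta>2 + q0) has_real_derivative 1 / \<delta>2) (at u2 within {y. (u1, y) \<in> ide_dom \<delta>1 \<delta>2})"
      using \<delta> by (auto intro!: derivative_eq_intros)
    show ?thesis
      using DERIV_image_chain[OF d1 d2] unfolding o_def Psi_max_eq p_def .
  qed
  have sh: "Psi (u1 - \<delta>1 * z) (u2 - \<delta>2 * z) = \<Phi> (p - z) (q - z)" for z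
    using \<delta> by (simp add: Psi_max_eq p_def q_def diff_divide_distrib algebra_simps)
  have int: "set_integrable lborel {0..} (\<lambda>z. Psi (u1 - \<delta>1 * z) (u2 - \<delta>2 * z) * f z)"
    unfolding shift_integral(1)[OF sh] by (rule integrable_f_bounded[where B = 1]) (use \<Phi>_bound in auto)
  have val: "(LBINT z:{0..}. Psi (u1 - \<delta>1 * z) (u2 - \<delta>2 * z) * f z) = H p q"
    unfolding shift_integral(2)[OF sh] H_def ..
  have e: "u1 + c1 / r = \<delta>1 * p" "u2 + c2 / r = \<delta>2 * q"
    using \<delta> r by (simp_all add: p_def q_def p0_def q0_def field_simps)
  have "(u1 + c1 / r) * (A1 p q * (1 / \<delta>1)) + (u2 + c2 / r) * (B2 * (1 / \<delta>2)) = p * A1 p q + q * B2"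
    unfolding e using \<delta> by simp
  also have "\<dots> = (lam + s) / r * Psi u1 u2 - lam / r * H p q"
    unfolding B2_def \<Phi>_ide[OF pq(1)] by (simp add: \<mu>_def Psi_max_eq p_def q_def)
  finally show "\<exists>D1 D2.
           ((\<lambda>x. Psi x u2) has_real_derivative D1) (at u1 within {x. (x, u2) \<in> ide_dom \<delta>1 \<delta>2}) \<and>
           ((\<lambda>y. Psi u1 y) has_real_derivative D2) (at u2 within {y. (u1, y) \<in> ide_dom \<delta>1 \<delta>2}) \<and>
           set_integrable lborel {0..} (\<lambda>z. Psi (u1 - \<delta>1 * z) (u2 - \<delta>2 * z) * f z) \<and>
           (u1 + c1 / r) * D1 + (u2 + c2 / r) * D2 - (lam + s) / r * Psi u1 u2
             + lam / r * (LBINT z:{0..}. Psi (u1 - \<delta>1 * z) (u2 - \<delta>2 * z) * f z) = 0"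
    using D1 D2 int unfolding val by (intro exI[of _ "A1 p q * (1 / \<delta>1)"] exI[of _ "B2 * (1 / \<delta>2)"]) simp
qed

text \<open>In the coordinates \<open>p\<close>, \<open>q\<close> the difference between
  \<open>g\<close> and \<open>Psi\<close> satisfies \<open>separate_ide\<close>. The prescribed
  value 1 in the ruin quadrant makes the difference vanish for \<open>q < q0\<close>, so the
  integral term is controlled by the difference on the domain.\<close>

lemma uniqueness:
  fixes g :: "real \<Rightarrow> real \<Rightarrow> real"
  assumes g1: "\<And>u1 u2. max u1 u2 < 0 \<Longrightarrow> g u1 u2 = 1"
    and gB: "\<And>u1 u2. u1 / \<delta>1 \<le> u2 / \<delta>2 \<Longrightarrow> \<bar>g u1 u2\<bar> \<le> B"
    and gI: "solves_IDE r c1 c2 \<delta>1 \<delta>2 lam f s g"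
    and gL: "\<And>u1. g u1 (\<delta>2 / \<delta>1 * u1) = Lap1 M r c1 \<delta>1 W \<sigma> s u1"
    and dom: "u1 / \<delta>1 \<le> u2 / \<delta>2"
  shows "g u1 u2 = Psi u1 u2"
proof -
  define a b where "a p = \<delta>1 * (p - p0)" and "b q = \<delta>2 * (q - q0)" for p q
  have ab: "a p / \<delta>1 + p0 = p" "b q / \<delta>2 + q0 = q" for p q
    using \<delta> by (simp_all add: a_def b_def)
  have dom_ab: "(a p, b q) \<in> ide_dom \<delta>1 \<delta>2 \<longleftrightarrow> q0 \<le> q \<and> p \<le> q + d" for p q
    unfolding domain_iff ab ..
  have Pab: "Psi (a p) (b q) = \<Phi> p q" for p q unfolding Psi_max_eq ab ..
  define w where "w x = g (a (fst x)) (b (snd x)) - \<Phi> (fst x) (snd x)" for x :: "real \<times> real"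
  define P where "P u1 u2 D \<longleftrightarrow>
           ((\<lambda>x. g x u2) has_real_derivative fst D) (at u1 within {x. (x, u2) \<in> ide_dom \<delta>1 \<delta>2}) \<and>
           ((\<lambda>y. g u1 y) has_real_derivative snd D) (at u2 within {y. (u1, y) \<in> ide_dom \<delta>1 \<delta>2}) \<and>
           set_integrable lborel {0..} (\<lambda>z. g (u1 - \<delta>1 * z) (u2 - \<delta>2 * z) * f z) \<and>
           (u1 + c1 / r) * fst D + (u2 + c2 / r) * snd D - (lam + s) / r * g u1 u2
             + lam / r * (LBINT z:{0..}. g (u1 - \<delta>1 * z) (u2 - \<delta>2 * z) * f z) = 0"
    for u1 u2 :: real and D :: "real \<times> real"
  \<comment> \<open>The equation supplies the two derivatives only existentially and as a pair, so
    one pair is chosen at each point.\<close>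
  define E1 E2 where "E1 u1 u2 = fst (SOME D. P u1 u2 D)" and "E2 u1 u2 = snd (SOME D. P u1 u2 D)" for u1 u2
  have P: "P u1 u2 (SOME D. P u1 u2 D)" if "(u1, u2) \<in> ide_dom \<delta>1 \<delta>2" for u1 u2
  proof (rule someI_ex)
    from gI[unfolded solves_IDE_def, rule_format, OF that] obtain a' b' where "P u1 u2 (a', b')"
      unfolding P_def fst_conv snd_conv by (elim exE)
    then show "\<exists>D. P u1 u2 D" ..
  qed
  have E: "
           ((\<lambda>x. g x u2) has_real_derivative E1 u1 u2) (at u1 within {x. (x, u2) \<in> ide_dom \<delta>1 \<delta>2})"
      "
           ((\<lambda>y. g u1 y) has_real_derivative E2 u1 u2) (at u2 within {y. (u1, y) \<in> ide_dom \<delta>1 \<delta>2})"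
      " set_integrable lborel {0..} (\<lambda>z. g (u1 - \<delta>1 * z) (u2 - \<delta>2 * z) * f z)"
      " (u1 + c1 / r) * E1 u1 u2 + (u2 + c2 / r) * E2 u1 u2 - (lam + s) / r * g u1 u2
             + lam / r * (LBINT z:{0..}. g (u1 - \<delta>1 * z) (u2 - \<delta>2 * z) * f z) = 0"
    if "(u1, u2) \<in> ide_dom \<delta>1 \<delta>2" for u1 u2
    using P[OF that] unfolding P_def E1_def E2_def by blast+
  have sh: "g (a p - \<delta>1 * z) (b q - \<delta>2 * z) = g (a (p - z)) (b (q - z))" for p q z
    by (simp add: a_def b_def algebra_simps)
  define w1 where "w1 x = \<delta>1 * E1 (a (fst x)) (b (snd x)) - A1 (fst x) (snd x)" for x :: "real \<times> real"
  define w2 where "w2 x = \<delta>2 * E2 (a (fst x)) (b (snd x)) - (\<Psi> (fst x, snd x) / (r * snd x) - A1 (fst x) (snd x) * (fst x / snd x))" for x :: "real \<times> real"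
  define I where "I x = lam / r * (LBINT z. w (fst x - z, snd x - z) * f1 z)" for x :: "real \<times> real"
  have int\<Phi>: "integrable lborel (\<lambda>z. \<Phi> (p - z) (q - z) * f1 z)" for p q
    by (rule integrable_f_bounded[where B = 1]) (use \<Phi>_bound in auto)
  have intg: "integrable lborel (\<lambda>z. g (a (p - z)) (b (q - z)) * f1 z)" if "q0 \<le> q" "p \<le> q + d" for p q
    using E(3)[of "a p" "b q"] that unfolding dom_ab shift_integral(1)[OF sh] by blast
  have weq: "(\<lambda>z. w (p - z, q - z) * f1 z) = (\<lambda>z. g (a (p - z)) (b (q - z)) * f1 z - \<Phi> (p - z) (q - z) * f1 z)" for p q
    by (simp add: w_def left_diff_distrib)
  have intw: "integrable lborel (\<lambda>z. w (p - z, q - z) * f1 z)" if "q0 \<le> q" "p \<le> q + d" for p q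
    unfolding weq by (intro Bochner_Integration.integrable_diff intg int\<Phi> that)
  have w0: "w (p, q) = 0" if "q < q0" "p \<le> q + d" for p q
  proof -
    have pq: "p < p0" "q < q0" using that by (auto simp: d_def)
    then have "a p < 0" "b q < 0" using \<delta> by (auto simp: a_def b_def mult_pos_neg)
    then show ?thesis using g1[of "a p" "b q"] \<Phi>_ruin[OF pq] by (simp add: w_def)
  qed
  \<comment> \<open>A claim leads either back into the domain or to \<open>q - z < q0\<close>, where
    \<open>w\<close> is 0; the latter case is covered by \<open>m \<ge> 0\<close>.\<close>
  have cls: "w (p - z, q - z) \<le> m" if "\<And>x y. q0 \<le> y \<Longrightarrow> x \<le> y + d \<Longrightarrow> w (x, y) \<le> m" "m \<ge> 0" "p \<le> q + d" for p q m z
    using that w0[of "q - z" "p - z"] by (cases "q0 \<le> q - z") auto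
  have cls': "- m \<le> w (p - z, q - z)" if "\<And>x y. q0 \<le> y \<Longrightarrow> x \<le> y + d \<Longrightarrow> - m \<le> w (x, y)" "m \<ge> 0" "p \<le> q + d" for p q m z
    using that w0[of "q - z" "p - z"] by (cases "q0 \<le> q - z") auto
  interpret sep: separate_ide w w1 w2 I q0 d "\<mu> / r" "lam / r" "B + 1"
  proof
    show "q0 > 0" "d > 0" by (fact q0 d)+
    show "0 \<le> lam / r" using lam r by simp
    show "lam / r < \<mu> / r" using mu(2) r by (rule divide_strict_right_mono)
  next
    fix x y assume xy: "q0 \<le> y" "x \<le> y + d"
    then have D: "(a x, b y) \<in> ide_dom \<delta>1 \<delta>2" unfolding dom_ab by simp
    show "((\<lambda>t. w (t, y)) has_real_derivative w1 (x, y)) (at x within {..y + d})"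
    proof -
      have "((\<lambda>t. g t (b y)) has_real_derivative E1 (a x) (b y)) (at (a x) within a ` {..y + d})"
        by (rule has_field_derivative_subset[OF E(1)[OF D]]) (use xy dom_ab in auto)
      moreover have "(a has_real_derivative \<delta>1) (at x within {..y + d})"
        unfolding a_def by (auto intro!: derivative_eq_intros)
      ultimately have "((\<lambda>t. g t (b y)) \<circ> a has_real_derivative E1 (a x) (b y) * \<delta>1) (at x within {..y + d})"
        by (rule DERIV_image_chain)
      from DERIV_diff[OF this \<Phi>_derivative_1[OF xy]] show ?thesis by (simp add: w_def w1_def o_def mult.commute)
    qed
    show "((\<lambda>t. w (x, t)) has_real_derivative w2 (x, y)) (at y within {max q0 (x - d)..})"
    proof -
      have "((\<lambda>t. g (a x) t) has_real_derivative E2 (a x) (b y)) (at (b y) within b ` {max q0 (x - d)..})"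
        by (rule has_field_derivative_subset[OF E(2)[OF D]]) (use xy dom_ab in auto)
      moreover have "(b has_real_derivative \<delta>2) (at y within {max q0 (x - d)..})"
        unfolding b_def by (auto intro!: derivative_eq_intros)
      ultimately have "((\<lambda>t. g (a x) t) \<circ> b has_real_derivative E2 (a x) (b y) * \<delta>2) (at y within {max q0 (x - d)..})"
        by (rule DERIV_image_chain)
      from DERIV_diff[OF this \<Phi>_derivative_2[OF xy]] show ?thesis by (simp add: w_def w2_def o_def mult.commute)
    qed
    show "x * w1 (x, y) + y * w2 (x, y) = \<mu> / r * w (x, y) - I (x, y)"
    proof -
      have e: "a x + c1 / r = \<delta>1 * x" "b y + c2 / r = \<delta>2 * y"
        using \<delta> r by (simp_all add: a_def b_def p0_def q0_def field_simps)
      have i: "I (x, y) = lam / r * (LBINT z. g (a (x - z)) (b (y - z)) * f1 z) - lam / r * H x y"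
        unfolding I_def fst_conv snd_conv weq H_def
        by (subst Bochner_Integration.integral_diff[OF intg[OF xy] int\<Phi>]) (rule right_diff_distrib)
      have "x * w1 (x, y) + y * w2 (x, y) = (\<delta>1 * x * E1 (a x) (b y) + \<delta>2 * y * E2 (a x) (b y))
          - (x * A1 x y + y * (\<Psi> (x, y) / (r * y) - A1 x y * (x / y)))"
        by (simp add: w1_def w2_def algebra_simps)
      moreover have "\<delta>1 * x * E1 (a x) (b y) + \<delta>2 * y * E2 (a x) (b y) = \<mu> / r * g (a x) (b y) - lam / r * (LBINT z. g (a (x - z)) (b (y - z)) * f1 z)"
        using E(4)[OF D] unfolding e shift_integral(2)[OF sh] \<mu>_def by linarith
      ultimately show ?thesis unfolding \<Phi>_ide[OF xy(1)] i by (simp add: w_def algebra_simps)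
    qed
    show "\<bar>w (x, y)\<bar> \<le> B + 1"
    proof -
      have "a x / \<delta>1 \<le> b y / \<delta>2" using D unfolding ide_dom_iff[OF \<delta>] by simp
      from gB[OF this] \<Phi>_bound[of x y] show ?thesis by (simp add: w_def)
    qed
    fix m :: real assume m: "m \<ge> 0"
    { assume le: "\<And>x y. q0 \<le> y \<Longrightarrow> x \<le> y + d \<Longrightarrow> w (x, y) \<le> m"
      have "(LBINT z. w (x - z, y - z) * f1 z) \<le> (LBINT z. m * f1 z)"
        by (intro integral_mono intw xy integrable_mult_right f_int mult_right_mono cls[OF le m xy(2)] risk_params.f0[OF risk_params])
      then show "I (x, y) \<le> lam / r * m"
        unfolding I_def using lam r f1 by (intro mult_left_mono) auto }
    { assume le: "\<And>x y. q0 \<le> y \<Longrightarrow> x \<le> y + d \<Longrightarrow> - m \<le> w (x, y)"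
      have "(LBINT z. - m * f1 z) \<le> (LBINT z. w (x - z, y - z) * f1 z)"
        by (intro integral_mono intw xy integrable_mult_right f_int mult_right_mono cls'[OF le m xy(2)] risk_params.f0[OF risk_params])
      then have "lam / r * (- m) \<le> I (x, y)"
        unfolding I_def using lam r f1 by (intro mult_left_mono) auto
      then show "- (lam / r * m) \<le> I (x, y)" by simp }
  next
    fix y assume "q0 \<le> y"
    have "b y = \<delta>2 / \<delta>1 * a (y + d)" using \<delta> by (simp add: a_def b_def d_def)
    then have "g (a (y + d)) (b y) = Psi (a (y + d)) (b y)" using gL[of "a (y + d)"] Lap1_eq by simp
    then show "w (y + d, y) = 0" unfolding Pab w_def by simp
  qed
  define p q where "p = u1 / \<delta>1 + p0" and "q = u2 / \<delta>2 + q0"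
  have pq: "a p = u1" "b q = u2" using \<delta> by (simp_all add: p_def q_def a_def b_def)
  have "p \<le> q + d" using dom by (simp add: p_def q_def d_def)
  then have "w (p, q) = 0" using sep.unique w0 by (cases "q0 \<le> q") auto
  then have "g u1 u2 = \<Phi> p q" by (simp add: w_def pq)
  then show ?thesis using Pab[of p q] by (simp add: pq)
qed

end

theorem theorem2p3:
  fixes M :: "'a measure" and W \<sigma> :: "nat \<Rightarrow> 'a \<Rightarrow> real" and f :: "real \<Rightarrow> real"
    and r c1 c2 \<delta>1 \<delta>2 lam s :: real
  assumes "prob_space M"
    and "r > 0" and "c1 > 0" and "c2 > 0"
    and "0 < \<delta>1" and "\<delta>1 < 1" and "0 < \<delta>2" and "\<delta>2 < 1" and "\<delta>1 + \<delta>2 = 1"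
    and "lam > 0"
    and "c1 / \<delta>1 > c2 / \<delta>2"
    and "s > 0"
    \<comment> \<open>interarrival times i.i.d. Exp(lambda): N is a Poisson process with intensity lambda\<close>
    and "\<And>k. distributed M lborel (W k) (\<lambda>x. ennreal (exponential_density lam x))"
    \<comment> \<open>claim sizes i.i.d. nonnegative with density f\<close>
    and "\<And>z. f z \<ge> 0"
    and "\<And>k. distributed M lborel (\<sigma> k) (\<lambda>x. ennreal (f x))"
    and "\<And>k \<omega>. \<sigma> k \<omega> \<ge> 0"
    \<comment> \<open>all interarrival times and claim sizes mutually independent\<close>
    and "prob_space.indep_vars M (\<lambda>_. borel)
           (\<lambda>i \<omega>. case i of Inl k \<Rightarrow> W k \<omega> | Inr k \<Rightarrow> \<sigma> k \<omega>) (UNIV :: (nat + nat) set)"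
  shows
    "solves_IDE r c1 c2 \<delta>1 \<delta>2 lam f s (Psi_max M r c1 c2 \<delta>1 \<delta>2 W \<sigma> s)
     \<and> (\<forall>u1. Psi_max M r c1 c2 \<delta>1 \<delta>2 W \<sigma> s u1 (\<delta>2 / \<delta>1 * u1) = Lap1 M r c1 \<delta>1 W \<sigma> s u1)
     \<and> (\<forall>g :: real \<Rightarrow> real \<Rightarrow> real.
          (\<forall>u1 u2. max u1 u2 < 0 \<longrightarrow> g u1 u2 = 1)
          \<and> (\<exists>B. \<forall>u1 u2. u1 / \<delta>1 \<le> u2 / \<delta>2 \<longrightarrow> \<bar>g u1 u2\<bar> \<le> B)
          \<and> solves_IDE r c1 c2 \<delta>1 \<delta>2 lam f s g
          \<and> (\<forall>u1. g u1 (\<delta>2 / \<delta>1 * u1) = Lap1 M r c1 \<delta>1 W \<sigma> s u1)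
          \<longrightarrow> (\<forall>u1 u2. u1 / \<delta>1 \<le> u2 / \<delta>2 \<longrightarrow> g u1 u2 = Psi_max M r c1 c2 \<delta>1 \<delta>2 W \<sigma> s u1 u2))"
proof -
  interpret risk_model M W \<sigma> f r c1 c2 \<delta>1 \<delta>2 lam s
    by (rule risk_model.intro) (fact assms)+
  show ?thesis
  proof (intro conjI allI impI)
    fix g :: "real \<Rightarrow> real \<Rightarrow> real" and u1 u2 :: real
    assume g: "(\<forall>u1 u2. max u1 u2 < 0 \<longrightarrow> g u1 u2 = 1)
          \<and> (\<exists>B. \<forall>u1 u2. u1 / \<delta>1 \<le> u2 / \<delta>2 \<longrightarrow> \<bar>g u1 u2\<bar> \<le> B)
          \<and> solves_IDE r c1 c2 \<delta>1 \<delta>2 lam f s g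
          \<and> (\<forall>u1. g u1 (\<delta>2 / \<delta>1 * u1) = Lap1 M r c1 \<delta>1 W \<sigma> s u1)"
      and u: "u1 / \<delta>1 \<le> u2 / \<delta>2"
    then obtain B where "\<And>u1 u2. u1 / \<delta>1 \<le> u2 / \<delta>2 \<Longrightarrow> \<bar>g u1 u2\<bar> \<le> B" by blast
    with g u show "g u1 u2 = Psi_max M r c1 c2 \<delta>1 \<delta>2 W \<sigma> s u1 u2"
      by (intro uniqueness[of g B]) simp_all
  qed (simp_all add: Psi_max_solves Lap1_eq)
qed

end
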